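(* Let $\beta=(\pi_\ell)_{\ell=1}^L$ be a non-redundant chainable architecture of depth $L\ge 2$, let $\mathbf{A}\in\mathbb{C}^{m\times n}$ with $m=a_1b_1d_1$, $n=a_Lc_Ld_L$, and let $\sigma=(\sigma_1,\dots,\sigma_{L-1})$ be any permutation of $\{1,\dots,L-1\}$. Then the butterfly algorithm with inputs $(\mathbf{A},\beta,\sigma)$ returns $(\mathbf{X}_\ell)_{\ell=1}^L\in\Sigma^\beta$ such that $$\|\mathbf{A}-\mathbf{X}_1\cdots\mathbf{X}_L\|_F\le\sum_{k=1}^{L-1}E^{\beta_{\sigma_k}}(\mathbf{A}).$$
   Context: A pattern is a tuple $\pi=(a,b,c,d)$ of positive integers; $\mathbf{S}_\pi:=\mathbf{I}_a\otimes\mathbf{1}_{b\times c}\otimes\mathbf{I}_d\in\{0,1\}^{abd\times acd}$. A $\pi$-factor is a complex $abd\times acd$ matrix with support contained in that of $\mathbf{S}_\pi$; $\Sigma^\pi$ is the set of $\pi$-factors. Patterns $\pi_1=(a_1,b_1,c_1,d_1),\pi_2=(a_2,b_2,c_2,d_2)$ are chainable if $a_1c_1/a_2=b_2d_2/d_1=:r(\pi_1,\pi_2)$ is an integer, $a_1\mid a_2$, $d_2\mid d_1$; then $\pi_1*\pi_2:=(a_1,b_1d_1/d_2,a_2c_2/a_1,d_2)$; such a pair is redundant if $r(\pi_1,\pi_2)\ge\min(b_1,c_2)$. An architecture $\beta=(\pi_\ell)_{\ell=1}^L$ is a sequence of patterns with $a_\ell c_\ell d_\ell=a_{\ell+1}b_{\ell+1}d_{\ell+1}$;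 it is chainable if consecutive pairs are chainable and redundant if some consecutive pair is redundant. $\pi_{[p,q]}:=\pi_p*\cdots*\pi_q$ (iterated product, well defined for chainable $\beta$). $\Sigma^\beta:=\Sigma^{\pi_1}\times\cdots\times\Sigma^{\pi_L}$. For $s\in\{1,\dots,L-1\}$, $\beta_s:=(\pi_{[1,s]},\pi_{[s+1,L]})$ and $E^{\beta_s}(\mathbf{A}):=\min_{\mathbf{X}\in\Sigma^{\pi_{[1,s]}},\mathbf{Y}\in\Sigma^{\pi_{[s+1,L]}}}\|\mathbf{A}-\mathbf{X}\mathbf{Y}\|_F$. For binary $\mathbf{L},\mathbf{R}$ with $\mathbf{U}_i:=\mathbf{L}[:,i]\mathbf{R}[i,:]$, $\mathcal{P}(\mathbf{L},\mathbf{R})$ is the partition of column indices of $\mathbf{L}$ into classes of the relation $\mathbf{U}_i=\mathbf{U}_j$, and $R_P\times C_P$ is the support of $\mathbf{U}_i$ for $i\in P$. TwoFactor$(\mathbf{M},\pi,\pi')$: zero $\mathbf{X},\mathbf{Y}$ of $\pi$-, $\pi'$-factor sizes; for each $P\in\mathcal{P}(\mathbf{S}_\pi,\mathbf{S}_{\pi'})$ set $(\mathbf{X}[R_P,P],\mathbf{Y}[P,C_P])$ to any minimizer $(\mathbf{H},\mathbf{K})$ of $\|\mathbf{M}[R_P,C_P]-\mathbf{H}\mathbf{K}\|_F$ over $\mathbf{H}\in\mathbb{C}^{|R_P|\times|P|},\mathbf{K}\in\mathbb{C}^{|P|\times|C_P|}$. Ortho$(\pi,\pi',\mathbf{X},\mathbf{Y},u)$: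 zero $\tilde{\mathbf{X}},\tilde{\mathbf{Y}}$; for each $P\in\mathcal{P}(\mathbf{S}_\pi,\mathbf{S}_{\pi'})$: if $u=$ column, QR-decompose $\mathbf{X}[R_P,P]=\mathbf{Q}\mathbf{R}$ and set $\tilde{\mathbf{X}}[R_P,P]=\mathbf{Q}$, $\tilde{\mathbf{Y}}[P,C_P]=\mathbf{R}\mathbf{Y}[P,C_P]$; if $u=$ row, QR-decompose $\mathbf{Y}[P,C_P]^\top=\mathbf{Q}\mathbf{R}$ and set $\tilde{\mathbf{X}}[R_P,P]=\mathbf{X}[R_P,P]\mathbf{R}^\top$, $\tilde{\mathbf{Y}}[P,C_P]=\mathbf{Q}^\top$. Butterfly algorithm: keep consecutive intervals $I_1,\dots,I_J$ partitioning $\{1,\dots,L\}$ with factors $\mathbf{X}_{I_k}$, initially $I_1=[1,L]$, $\mathbf{X}_{I_1}=\mathbf{A}$. For $J=1,\dots,L-1$: $s=\sigma_J$, $j$ with $s\in I_j=[q,t]$; for $k=1,\dots,j-1$: $(\mathbf{X}_{I_k},\mathbf{X}_{I_{k+1}})\leftarrow$ Ortho$(\pi_{I_k},\pi_{I_{k+1}},\mathbf{X}_{I_k},\mathbf{X}_{I_{k+1}},\text{column})$; for $k=J,\dots,j+1$ (decreasing): $(\mathbf{X}_{I_{k-1}},\mathbf{X}_{I_k})\leftarrow$ Ortho$(\pi_{I_{k-1}},\pi_{I_k},\mathbf{X}_{I_{k-1}},\mathbf{X}_{I_k},\text{row})$; then $(\mathbf{X}_{[q,s]},\mathbf{X}_{[s+1,t]})\leftarrow$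 TwoFactor$(\mathbf{X}_{I_j},\pi_{[q,s]},\pi_{[s+1,t]})$ and $I_j$ is replaced by $[q,s],[s+1,t]$. Output $(\mathbf{X}_{[\ell,\ell]})_{\ell=1}^L$. *)

theory Defs
  imports Complex_Main "Jordan_Normal_Form.Matrix" "Jordan_Normal_Form.DL_Submatrix"
begin

type_synonym pattern = "nat \<times> nat \<times> nat \<times> nat"

fun pa :: "pattern \<Rightarrow> nat" where "pa (a,b,c,d) = a"
fun pb :: "pattern \<Rightarrow> nat" where "pb (a,b,c,d) = b"
fun pc :: "pattern \<Rightarrow> nat" where "pc (a,b,c,d) = c"
fun pd :: "pattern \<Rightarrow> nat" where "pd (a,b,c,d) = d"

definition pattern_ok :: "pattern \<Rightarrow> bool" where
  "pattern_ok p \<longleftrightarrow> pa p > 0 \<and> pb p > 0 \<and> pc p > 0 \<and> pd p > 0"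

definition nrows :: "pattern \<Rightarrow> nat" where "nrows p = pa p * pb p * pd p"
definition ncols :: "pattern \<Rightarrow> nat" where "ncols p = pa p * pc p * pd p"

text \<open>Support of S_pi = I_a (x) 1_{b x c} (x) I_d (0-based indices, Kronecker
  convention: row i = (i1*b + i2)*d + i3, column j = (j1*c + j2)*d + j3;
  the entry is 1 iff i1 = j1 and i3 = j3).\<close>
definition supp :: "pattern \<Rightarrow> nat \<Rightarrow> nat \<Rightarrow> bool" where
  "supp p i j \<longleftrightarrow> i < nrows p \<and> j < ncols p \<and>
     i div (pb p * pd p) = j div (pc p * pd p) \<and> i mod pd p = j mod pd p"

definition is_factor :: "pattern \<Rightarrow> complex mat \<Rightarrow> bool" where
  "is_factor p X \<longleftrightarrow> X \<in> carrier_mat (nrows p) (ncols p) \<and>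
     (\<forall>i<nrows p. \<forall>j<ncols p. \<not> supp p i j \<longrightarrow> X $$ (i,j) = 0)"

definition chainable :: "pattern \<Rightarrow> pattern \<Rightarrow> bool" where
  "chainable p1 p2 \<longleftrightarrow>
     pa p2 dvd pa p1 * pc p1 \<and> pd p1 dvd pb p2 * pd p2 \<and>
     pa p1 * pc p1 div pa p2 = pb p2 * pd p2 div pd p1 \<and>
     pa p1 dvd pa p2 \<and> pd p2 dvd pd p1"

definition ratio :: "pattern \<Rightarrow> pattern \<Rightarrow> nat" where
  "ratio p1 p2 = pa p1 * pc p1 div pa p2"

definition redundant_pair :: "pattern \<Rightarrow> pattern \<Rightarrow> bool" where
  "redundant_pair p1 p2 \<longleftrightarrow> ratio p1 p2 \<ge> min (pb p1) (pc p2)"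

definition pstar :: "pattern \<Rightarrow> pattern \<Rightarrow> pattern" where
  "pstar p1 p2 = (pa p1, pb p1 * pd p1 div pd p2, pa p2 * pc p2 div pa p1, pd p2)"

text \<open>An architecture is a list of patterns; pattern number l (1-based) is
  beta ! (l - 1).\<close>
definition architecture :: "pattern list \<Rightarrow> bool" where
  "architecture \<beta> \<longleftrightarrow> (\<forall>p\<in>set \<beta>. pattern_ok p) \<and>
     (\<forall>l. Suc l < length \<beta> \<longrightarrow> ncols (\<beta> ! l) = nrows (\<beta> ! Suc l))"

definition chainable_arch :: "pattern list \<Rightarrow> bool" where
  "chainable_arch \<beta> \<longleftrightarrow> (\<forall>l. Suc l < length \<beta> \<longrightarrow> chainable (\<beta> ! l) (\<beta> ! Suc l))"

definition redundant_arch :: "pattern list \<Rightarrow> bool" where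
  "redundant_arch \<beta> \<longleftrightarrow> (\<exists>l. Suc l < length \<beta> \<and> redundant_pair (\<beta> ! l) (\<beta> ! Suc l))"

text \<open>pi_[p,q] = pi_p * ... * pi_q (1-based, iterated left to right).\<close>
definition piv :: "pattern list \<Rightarrow> nat \<Rightarrow> nat \<Rightarrow> pattern" where
  "piv \<beta> p q = foldl pstar (\<beta> ! (p - 1)) (map (\<lambda>l. \<beta> ! (l - 1)) [Suc p..<Suc q])"

definition in_Sigma_arch :: "pattern list \<Rightarrow> complex mat list \<Rightarrow> bool" where
  "in_Sigma_arch \<beta> Xs \<longleftrightarrow> length Xs = length \<beta> \<and> (\<forall>l<length \<beta>. is_factor (\<beta> ! l) (Xs ! l))"

definition frob :: "complex mat \<Rightarrow> real" where
  "frob M = sqrt (\<Sum>i<dim_row M. \<Sum>j<dim_col M. (cmod (M $$ (i,j)))\<^sup>2)"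

fun mat_prod_list :: "complex mat list \<Rightarrow> complex mat" where
  "mat_prod_list [] = undefined"
| "mat_prod_list [X] = X"
| "mat_prod_list (X # Xs) = X * mat_prod_list Xs"

definition ctrans :: "complex mat \<Rightarrow> complex mat" where
  "ctrans Q = mat (dim_col Q) (dim_row Q) (\<lambda>(i,j). cnj (Q $$ (j,i)))"

definition is_QR :: "complex mat \<Rightarrow> complex mat \<Rightarrow> complex mat \<Rightarrow> bool" where
  "is_QR M Q R \<longleftrightarrow> Q \<in> carrier_mat (dim_row M) (dim_col M) \<and>
     R \<in> carrier_mat (dim_col M) (dim_col M) \<and>
     ctrans Q * Q = 1\<^sub>m (dim_col M) \<and>
     (\<forall>i<dim_col M. \<forall>j<dim_col M. j < i \<longrightarrow> R $$ (i,j) = 0) \<and>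
     M = Q * R"

definition Ebeta :: "pattern list \<Rightarrow> nat \<Rightarrow> complex mat \<Rightarrow> real" where
  "Ebeta \<beta> s A = Inf {frob (A - X * Y) | X Y.
      is_factor (piv \<beta> 1 s) X \<and> is_factor (piv \<beta> (Suc s) (length \<beta>)) Y}"

definition Usupp :: "pattern \<Rightarrow> pattern \<Rightarrow> nat \<Rightarrow> nat \<Rightarrow> nat \<Rightarrow> bool" where
  "Usupp p p' i r c \<longleftrightarrow> supp p r i \<and> supp p' i c"

definition Ucls :: "pattern \<Rightarrow> pattern \<Rightarrow> nat \<Rightarrow> nat set" where
  "Ucls p p' i = {j. j < ncols p \<and>
     (\<forall>r<nrows p. \<forall>c<ncols p'. Usupp p p' i r c = Usupp p p' j r c)}"

definition partP :: "pattern \<Rightarrow> pattern \<Rightarrow> nat set set" where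
  "partP p p' = {Ucls p p' i | i. i < ncols p}"

definition RP :: "pattern \<Rightarrow> pattern \<Rightarrow> nat set \<Rightarrow> nat set" where
  "RP p p' P = {r. r < nrows p \<and> (\<exists>i\<in>P. \<exists>c<ncols p'. Usupp p p' i r c)}"

definition CP :: "pattern \<Rightarrow> pattern \<Rightarrow> nat set \<Rightarrow> nat set" where
  "CP p p' P = {c. c < ncols p' \<and> (\<exists>i\<in>P. \<exists>r<nrows p. Usupp p p' i r c)}"

definition block_shaped :: "pattern \<Rightarrow> pattern \<Rightarrow> complex mat \<Rightarrow> complex mat \<Rightarrow> bool" where
  "block_shaped p p' X Y \<longleftrightarrow>
     X \<in> carrier_mat (nrows p) (ncols p) \<and> Y \<in> carrier_mat (nrows p') (ncols p') \<and>
     (\<forall>r<nrows p. \<forall>i<ncols p. (\<forall>P\<in>partP p p'. \<not> (r \<in> RP p p' P \<and> i \<in> P)) \<longrightarrow> X $$ (r,i) = 0) \<and>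
     (\<forall>i<nrows p'. \<forall>c<ncols p'. (\<forall>P\<in>partP p p'. \<not> (i \<in> P \<and> c \<in> CP p p' P)) \<longrightarrow> Y $$ (i,c) = 0)"

section \<open>TwoFactor and Ortho (as relations: any admissible choice)\<close>

definition two_factor :: "complex mat \<Rightarrow> pattern \<Rightarrow> pattern \<Rightarrow> complex mat \<Rightarrow> complex mat \<Rightarrow> bool" where
  "two_factor M p p' X Y \<longleftrightarrow> block_shaped p p' X Y \<and>
     (\<forall>P\<in>partP p p'.
        (\<forall>H K. H \<in> carrier_mat (card (RP p p' P)) (card P) \<longrightarrow>
               K \<in> carrier_mat (card P) (card (CP p p' P)) \<longrightarrow>
          frob (submatrix M (RP p p' P) (CP p p' P)
                - submatrix X (RP p p' P) P * submatrix Y P (CP p p' P))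
          \<le> frob (submatrix M (RP p p' P) (CP p p' P) - H * K)))"

datatype orient = Column | Row

definition ortho :: "pattern \<Rightarrow> pattern \<Rightarrow> complex mat \<Rightarrow> complex mat \<Rightarrow> orient
      \<Rightarrow> complex mat \<Rightarrow> complex mat \<Rightarrow> bool" where
  "ortho p p' X Y u X' Y' \<longleftrightarrow> block_shaped p p' X' Y' \<and>
     (\<forall>P\<in>partP p p'.
        (case u of
          Column \<Rightarrow> (\<exists>Q R. is_QR (submatrix X (RP p p' P) P) Q R \<and>
                        submatrix X' (RP p p' P) P = Q \<and>
                        submatrix Y' P (CP p p' P) = R * submatrix Y P (CP p p' P))
        | Row \<Rightarrow> (\<exists>Q R. is_QR (transpose_mat (submatrix Y P (CP p p' P))) Q R \<and>
                        submatrix X' (RP p p' P) P = submatrix X (RP p p' P) P * transpose_mat R \<and>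
                        submatrix Y' P (CP p p' P) = transpose_mat Q)))"

text \<open>A state is the list of intervals I_1,...,I_J (as pairs (q,t), 1-based,
  in increasing order) together with the current factors X_{I_k}.\<close>
type_synonym bstate = "((nat \<times> nat) \<times> complex mat) list"

definition ortho_at :: "pattern list \<Rightarrow> orient \<Rightarrow> nat \<Rightarrow> bstate \<Rightarrow> bstate \<Rightarrow> bool" where
  "ortho_at \<beta> u k st st' \<longleftrightarrow> Suc k < length st \<and> length st' = length st \<and>
     (\<forall>i<length st. i \<noteq> k \<and> i \<noteq> Suc k \<longrightarrow> st' ! i = st ! i) \<and>
     fst (st' ! k) = fst (st ! k) \<and> fst (st' ! Suc k) = fst (st ! Suc k) \<and>
     ortho (case_prod (piv \<beta>) (fst (st ! k))) (case_prod (piv \<beta>) (fst (st ! Suc k)))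
       (snd (st ! k)) (snd (st ! Suc k)) u (snd (st' ! k)) (snd (st' ! Suc k))"

text \<open>for k = 1,...,j-1: Ortho(I_k, I_{k+1}, column) (0-based position k-1).\<close>
definition left_sweep :: "pattern list \<Rightarrow> nat \<Rightarrow> bstate \<Rightarrow> bstate \<Rightarrow> bool" where
  "left_sweep \<beta> j st st' \<longleftrightarrow> (\<exists>sts. length sts = j \<and> sts ! 0 = st \<and> sts ! (j - 1) = st' \<and>
     (\<forall>i. Suc i < j \<longrightarrow> ortho_at \<beta> Column i (sts ! i) (sts ! Suc i)))"

text \<open>for k = J,...,j+1 (decreasing): Ortho(I_{k-1}, I_k, row)
  (0-based position k-2), where J = number of current intervals.\<close>
definition right_sweep :: "pattern list \<Rightarrow> nat \<Rightarrow> bstate \<Rightarrow> bstate \<Rightarrow> bool" where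
  "right_sweep \<beta> j st st' \<longleftrightarrow> (let J = length st in
     (\<exists>sts. length sts = Suc (J - j) \<and> sts ! 0 = st \<and> sts ! (J - j) = st' \<and>
       (\<forall>i. i < J - j \<longrightarrow> ortho_at \<beta> Row (J - 2 - i) (sts ! i) (sts ! Suc i))))"

definition butterfly_step :: "pattern list \<Rightarrow> nat \<Rightarrow> bstate \<Rightarrow> bstate \<Rightarrow> bool" where
  "butterfly_step \<beta> s st st' \<longleftrightarrow>
     (\<exists>j q t st1 st2 X1 X2. 1 \<le> j \<and> j \<le> length st \<and> fst (st ! (j - 1)) = (q, t) \<and>
        q \<le> s \<and> s \<le> t \<and>
        left_sweep \<beta> j st st1 \<and> right_sweep \<beta> j st1 st2 \<and>
        two_factor (snd (st2 ! (j - 1))) (piv \<beta> q s) (piv \<beta> (Suc s) t) X1 X2 \<and>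
        st' = take (j - 1) st2 @ [((q, s), X1), ((Suc s, t), X2)] @ drop j st2)"

definition butterfly_output :: "complex mat \<Rightarrow> pattern list \<Rightarrow> nat list \<Rightarrow> complex mat list \<Rightarrow> bool" where
  "butterfly_output A \<beta> \<sigma> Xs \<longleftrightarrow> (let L = length \<beta> in
     (\<exists>sts. length sts = L \<and> sts ! 0 = [((1, L), A)] \<and>
        (\<forall>J. Suc J < L \<longrightarrow> butterfly_step \<beta> (\<sigma> ! J) (sts ! J) (sts ! Suc J)) \<and>
        Xs = map snd (sts ! (L - 1))))"

end

theory Submission
  imports "HOL-Analysis.Function_Topology" "HOL-Analysis.L2_Norm" "HOL-Analysis.Topology_Euclidean_Space"
    "Jordan_Normal_Form.Determinant" Defs
begin

text \<open>Let \<open>B\<close> and \<open>B'\<close> be the products of all current factors before and after the splitting at \<open>s\<close>. The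
  factors to the left of the split one act as isometries from the left, those to its right as isometries
  from the right. Hence \<open>B'\<close> is a best approximation of \<open>B\<close> among the products belonging to \<open>\<beta>\<^sub>s\<close>, and the
  step costs at most \<open>Ebeta \<beta> s B\<close>. Moreover \<open>B'\<close> is the image of \<open>B\<close> under an orthogonal projection (onto
  a space of matrices \<open>F * N\<close>, or of matrices \<open>N * F\<close>) which, owing to the nesting of the supports, maps the
  products belonging to a later (respectively earlier) splitting position \<open>s'\<close> to such products. So no
  error \<open>Ebeta \<beta> s'\<close> with \<open>s' \<noteq> s\<close> increases, and the triangle inequality along the run gives the bound.
  Non-redundancy makes every block tall (respectively wide) enough for the QR decompositions to exist.\<close>

subsection \<open>Frobenius norm and masked orthogonality\<close>

text \<open>Ortho normalises each block separately. Columns in different blocks may occupy the same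
  rows without being orthogonal, so an orthonormalised factor is not an isometry on all matrices,
  only on those whose support fits the architecture. All orthogonality is therefore relative to
  masks: Gram entries are prescribed only inside a block (\<open>col_orth\<close>), and
  \<open>perp\<close> tests only the entries in a given support. TwoFactor is optimal in both
  factors at once, whereas an orthogonal projection needs one factor fixed. A QR decomposition made
  inside the proof rewrites \<open>X * Y\<close> as \<open>F * Z\<close> with \<open>F\<close>
  orthonormal on blocks; minimality in \<open>Z\<close> alone then gives the normal equations. The
  input \<open>A\<close> has no prescribed support.\<close>

lemma mult_mat_entry:
  assumes "A \<in> carrier_mat m n" "B \<in> carrier_mat n k" "i < m" "j < k"
  shows "(A * B) $$ (i,j) = (\<Sum>l<n. A $$ (i,l) * B $$ (l,j))"
  using assms by (auto simp: scalar_prod_def lessThan_atLeast0)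

lemma ctrans_carrier: "F \<in> carrier_mat m n \<Longrightarrow> ctrans F \<in> carrier_mat n m"
  by (auto simp: ctrans_def)

lemma ctrans_mult_entry:
  assumes "F \<in> carrier_mat m n" "G \<in> carrier_mat m k" "i < n" "j < k"
  shows "(ctrans F * G) $$ (i,j) = (\<Sum>r<m. cnj (F $$ (r,i)) * G $$ (r,j))"
  using assms by (subst mult_mat_entry[OF ctrans_carrier]) (auto simp: ctrans_def)

lemma frob_L2_set:
  "frob M = L2_set (\<lambda>(i,j). cmod (M $$ (i,j))) ({..<dim_row M} \<times> {..<dim_col M})"
  by (simp add: frob_def L2_set_def sum.cartesian_product case_prod_unfold)

lemma frob_nonneg [simp]: "0 \<le> frob M"
  by (simp add: frob_L2_set)

lemma frob_carrier: "M \<in> carrier_mat m n \<Longrightarrow> frob M = sqrt (\<Sum>i<m. \<Sum>j<n. (cmod (M $$ (i,j)))\<^sup>2)"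
  by (auto simp: frob_def)

lemma frob_sq: "M \<in> carrier_mat m n \<Longrightarrow> (frob M)\<^sup>2 = (\<Sum>i<m. \<Sum>j<n. (cmod (M $$ (i,j)))\<^sup>2)"
  by (auto simp: frob_def sum_nonneg)

lemma frob_triangle:
  assumes "A \<in> carrier_mat m n" "B \<in> carrier_mat m n"
  shows "frob (A + B) \<le> frob A + frob B"
proof -
  let ?S = "{..<m} \<times> {..<n}"
  have "frob (A + B) = L2_set (\<lambda>(i,j). cmod ((A + B) $$ (i,j))) ?S"
    using assms by (auto simp: frob_L2_set)
  also have "\<dots> \<le> L2_set (\<lambda>x. (case x of (i,j) \<Rightarrow> cmod (A $$ (i,j))) + (case x of (i,j) \<Rightarrow> cmod (B $$ (i,j)))) ?S"
    by (rule L2_set_mono) (use assms in \<open>auto simp: norm_triangle_ineq\<close>)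
  also have "\<dots> \<le> L2_set (\<lambda>(i,j). cmod (A $$ (i,j))) ?S + L2_set (\<lambda>(i,j). cmod (B $$ (i,j))) ?S"
    by (rule L2_set_triangle_ineq)
  also have "\<dots> = frob A + frob B" using assms by (auto simp: frob_L2_set)
  finally show ?thesis .
qed

lemma frob_zero: "M \<in> carrier_mat m n \<Longrightarrow> frob M = 0 \<Longrightarrow> M = 0\<^sub>m m n"
proof -
  assume M: "M \<in> carrier_mat m n" and "frob M = 0"
  then have "(\<Sum>i<m. \<Sum>j<n. (cmod (M $$ (i,j)))\<^sup>2) = 0" using frob_sq[OF M] by simp
  then have "\<forall>i<m. \<forall>j<n. M $$ (i,j) = 0"
    by (simp add: sum_nonneg_eq_0_iff sum_nonneg)
  then show ?thesis using M by (intro eq_matI) auto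
qed

lemma frob_transpose: "frob (transpose_mat M) = frob M"
proof -
  have "(\<Sum>i<dim_col M. \<Sum>j<dim_row M. (cmod (M $$ (j,i)))\<^sup>2) =
      (\<Sum>i<dim_row M. \<Sum>j<dim_col M. (cmod (M $$ (i,j)))\<^sup>2)"
    by (rule sum.swap)
  then show ?thesis by (simp add: frob_def)
qed

lemma frob_add_sq:
  assumes G: "G \<in> carrier_mat m n" and K: "K \<in> carrier_mat m n"
    and orth: "(\<Sum>i<m. \<Sum>j<n. cnj (G $$ (i,j)) * K $$ (i,j)) = 0"
  shows "(frob (G + K))\<^sup>2 = (frob G)\<^sup>2 + (frob K)\<^sup>2"
proof -
  have e: "(cmod (x + y))\<^sup>2 = (cmod x)\<^sup>2 + (cmod y)\<^sup>2 + 2 * Re (cnj x * y)" for x y :: complex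
    unfolding cmod_power2 by (simp add: power2_eq_square algebra_simps)
  have "(frob (G + K))\<^sup>2 = (\<Sum>i<m. \<Sum>j<n. (cmod (G $$ (i,j) + K $$ (i,j)))\<^sup>2)"
    using G K by (subst frob_sq[of _ m n]) auto
  also have "\<dots> = (frob G)\<^sup>2 + (frob K)\<^sup>2 + 2 * Re (\<Sum>i<m. \<Sum>j<n. cnj (G $$ (i,j)) * K $$ (i,j))"
    unfolding e frob_sq[OF G] frob_sq[OF K] sum.distrib Re_sum sum_distrib_left by simp
  finally show ?thesis using orth by simp
qed

section \<open>Masked supports, masked orthogonality and projections\<close>

definition supported :: "(nat \<Rightarrow> nat \<Rightarrow> bool) \<Rightarrow> complex mat \<Rightarrow> bool" where
  "supported S X \<longleftrightarrow> (\<forall>i<dim_row X. \<forall>j<dim_col X. \<not> S i j \<longrightarrow> X $$ (i,j) = 0)"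

text \<open>Amounts to orthogonality of \<open>G\<close> to all \<open>F * N\<close> with
  \<open>N\<close> supported in \<open>S\<close>: entries of \<open>ctrans F * G\<close> outside
  \<open>S\<close> only ever meet zeros of \<open>N\<close>.\<close>

definition perp :: "(nat \<Rightarrow> nat \<Rightarrow> bool) \<Rightarrow> complex mat \<Rightarrow> complex mat \<Rightarrow> bool" where
  "perp S F G \<longleftrightarrow> (\<forall>i<dim_col F. \<forall>j<dim_col G. S i j \<longrightarrow> (ctrans F * G) $$ (i,j) = 0)"

text \<open>Orthonormality within the classes of \<open>E\<close> only: each block is
  orthonormalised on its own, and columns from different blocks may overlap.\<close>

definition col_orth :: "(nat \<Rightarrow> nat \<Rightarrow> bool) \<Rightarrow> complex mat \<Rightarrow> bool" where
  "col_orth E F \<longleftrightarrow> (\<forall>i<dim_col F. \<forall>k<dim_col F. E i k \<longrightarrow>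
     (ctrans F * F) $$ (i,k) = (if i = k then 1 else 0))"

lemma supportedD:
  "supported S X \<Longrightarrow> X \<in> carrier_mat m n \<Longrightarrow> i < m \<Longrightarrow> j < n \<Longrightarrow> X $$ (i,j) \<noteq> 0 \<Longrightarrow> S i j"
  unfolding supported_def by auto

lemma supported_diff:
  assumes "supported S X" "supported S Y" "X \<in> carrier_mat m n" "Y \<in> carrier_mat m n"
  shows "supported S (X - Y)"
  using assms unfolding supported_def by auto

lemma supported_mult:
  assumes "supported S X" "supported T Y" "X \<in> carrier_mat m n" "Y \<in> carrier_mat n k"
    and ST: "\<And>i l j. i < m \<Longrightarrow> l < n \<Longrightarrow> j < k \<Longrightarrow> S i l \<Longrightarrow> T l j \<Longrightarrow> U i j"
  shows "supported U (X * Y)"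
  unfolding supported_def
proof (intro allI impI)
  fix i j assume ij: "i < dim_row (X * Y)" "j < dim_col (X * Y)" "\<not> U i j"
  then have ij': "i < m" "j < k" using assms by auto
  have "X $$ (i,l) * Y $$ (l,j) = 0" if "l < n" for l
    using that ST[OF ij'(1) that ij'(2)] ij(3) supportedD[OF assms(1,3) ij'(1) that]
      supportedD[OF assms(2,4) that ij'(2)] by (metis mult_eq_0_iff)
  then show "(X * Y) $$ (i,j) = 0"
    unfolding mult_mat_entry[OF assms(3,4) ij'] by (intro sum.neutral) auto
qed

lemma supported_transpose:
  "supported S X \<Longrightarrow> supported (\<lambda>i j. S j i) (transpose_mat X)"
  unfolding supported_def by auto

text \<open>Adjointness turns the sum into the inner product of \<open>ctrans F * G\<close> with
  \<open>N\<close>; the former vanishes on \<open>S\<close>, the latter outside it.\<close>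

lemma perp_imp_orthogonal:
  assumes F: "F \<in> carrier_mat m n" and N: "N \<in> carrier_mat n k" and G: "G \<in> carrier_mat m k"
    and "supported S N" "perp S F G"
  shows "(\<Sum>r<m. \<Sum>e<k. cnj (G $$ (r,e)) * (F * N) $$ (r,e)) = 0"
proof -
  have "(\<Sum>r<m. \<Sum>e<k. cnj (G $$ (r,e)) * (F * N) $$ (r,e))
      = (\<Sum>r<m. \<Sum>e<k. \<Sum>i<n. cnj (G $$ (r,e)) * F $$ (r,i) * N $$ (i,e))"
    by (intro sum.cong refl) (simp add: mult_mat_entry[OF F N] sum_distrib_left mult.assoc)
  also have "\<dots> = (\<Sum>e<k. \<Sum>r<m. \<Sum>i<n. cnj (G $$ (r,e)) * F $$ (r,i) * N $$ (i,e))"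
    by (rule sum.swap)
  also have "\<dots> = (\<Sum>e<k. \<Sum>i<n. \<Sum>r<m. cnj (G $$ (r,e)) * F $$ (r,i) * N $$ (i,e))"
    by (intro sum.cong refl sum.swap)
  also have "\<dots> = (\<Sum>e<k. \<Sum>i<n. cnj ((ctrans F * G) $$ (i,e)) * N $$ (i,e))"
    by (intro sum.cong refl) (simp add: ctrans_mult_entry[OF F G] sum_distrib_right sum_distrib_left mult_ac)
  also have "\<dots> = 0"
  proof (intro sum.neutral ballI)
    fix e i assume "e \<in> {..<k}" "i \<in> {..<n}"
    then show "cnj ((ctrans F * G) $$ (i,e)) * N $$ (i,e) = 0"
      using assms supportedD[OF assms(4) N, of i e] unfolding perp_def by (cases "S i e") auto
  qed
  finally show ?thesis .
qed

lemma frob_perp_sq: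
  assumes "F \<in> carrier_mat m n" "N \<in> carrier_mat n k" "G \<in> carrier_mat m k"
    and "supported S N" "perp S F G"
  shows "(frob (G + F * N))\<^sup>2 = (frob G)\<^sup>2 + (frob (F * N))\<^sup>2"
  by (rule frob_add_sq[OF assms(3) _ perp_imp_orthogonal[OF assms]]) (use assms in auto)

lemma frob_perp_le:
  assumes "F \<in> carrier_mat m n" "N \<in> carrier_mat n k" "G \<in> carrier_mat m k"
    and "supported S N" "perp S F G"
  shows "frob (F * N) \<le> frob (G + F * N)"
  by (rule power2_le_imp_le) (use frob_perp_sq[OF assms] in auto)

lemma perp_diff:
  assumes "F \<in> carrier_mat m n" "G \<in> carrier_mat m k" "H \<in> carrier_mat m k"
    and "perp S F G" "perp S F H"
  shows "perp S F (G - H)"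
proof -
  have "ctrans F * (G - H) = ctrans F * G - ctrans F * H"
    by (rule mult_minus_distrib_mat[OF ctrans_carrier[OF assms(1)] assms(2,3)])
  then show ?thesis using assms unfolding perp_def by (auto simp: ctrans_def)
qed

text \<open>At masked entries \<open>ctrans F * F\<close> acts as the identity. A term
  \<open>l\<close> survives only if columns \<open>i\<close> and \<open>l\<close> of
  \<open>F\<close> share a row and \<open>N\<close> is nonzero at \<open>(l,e)\<close>; then
  \<open>TE\<close> puts \<open>i\<close> and \<open>l\<close> into one class of \<open>E\<close>,
  where the Gram matrix is the identity.\<close>

lemma gram_mult_entry:
  assumes F: "F \<in> carrier_mat m n" and N: "N \<in> carrier_mat n k"
    and sF: "supported T F" and "supported S N" and orth: "col_orth E F" and E_refl: "\<And>i. E i i"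
    and TE: "\<And>r i l e. r < m \<Longrightarrow> i < n \<Longrightarrow> l < n \<Longrightarrow> e < k \<Longrightarrow> T r i \<Longrightarrow> T r l \<Longrightarrow> S i e \<Longrightarrow> S l e \<Longrightarrow> E i l"
    and ie: "i < n" "e < k" "S i e"
  shows "(ctrans F * (F * N)) $$ (i,e) = N $$ (i,e)"
proof -
  have FN: "F * N \<in> carrier_mat m k" using F N by auto
  have gz: "(ctrans F * F) $$ (i,l) * N $$ (l,e) = (if l = i then N $$ (i,e) else 0)" if l: "l < n" for l
  proof (cases "(ctrans F * F) $$ (i,l) * N $$ (l,e) = 0 \<and> l \<noteq> i")
    case False
    have "E i l"
    proof (cases "l = i")
      case False
      then have nz: "(\<Sum>r<m. cnj (F $$ (r,i)) * F $$ (r,l)) \<noteq> 0" "N $$ (l,e) \<noteq> 0"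
        using \<open>\<not> (_ \<and> _)\<close> by (auto simp: ctrans_mult_entry[OF F F ie(1) l])
      then obtain r where r: "r < m" "F $$ (r,i) \<noteq> 0" "F $$ (r,l) \<noteq> 0"
        by (metis (no_types, lifting) complex_cnj_zero lessThan_iff mult_eq_0_iff sum.neutral)
      then show ?thesis
        using TE[OF r(1) ie(1) l ie(2)] supportedD[OF sF F] supportedD[OF assms(4) N l ie(2) nz(2)] ie l by blast
    qed (use E_refl in auto)
    then show ?thesis using orth ie l F unfolding col_orth_def by auto
  qed auto
  have "ctrans F * (F * N) = ctrans F * F * N"
    by (rule assoc_mult_mat[symmetric, OF ctrans_carrier[OF F] F N])
  also have "\<dots> $$ (i,e) = (\<Sum>l<n. (ctrans F * F) $$ (i,l) * N $$ (l,e))"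
    by (rule mult_mat_entry) (use F N ie ctrans_carrier[OF F] in auto)
  also have "\<dots> = (\<Sum>l<n. if l = i then N $$ (i,e) else 0)"
    by (rule sum.cong) (use gz in auto)
  finally show ?thesis using ie by simp
qed

text \<open>The squared norm of \<open>F * N\<close> is the inner product of
  \<open>ctrans F * (F * N)\<close> with \<open>N\<close>. Only entries in \<open>S\<close> count,
  and there \<open>gram_mult_entry\<close> removes \<open>F\<close>.\<close>

lemma frob_isometry:
  assumes F: "F \<in> carrier_mat m n" and N: "N \<in> carrier_mat n k"
    and sF: "supported T F" and sN: "supported S N" and orth: "col_orth E F" and E_refl: "\<And>i. E i i"
    and TE: "\<And>r i l e. r < m \<Longrightarrow> i < n \<Longrightarrow> l < n \<Longrightarrow> e < k \<Longrightarrow> T r i \<Longrightarrow> T r l \<Longrightarrow> S i e \<Longrightarrow> S l e \<Longrightarrow> E i l"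
  shows "frob (F * N) = frob N"
proof -
  have FN: "F * N \<in> carrier_mat m k" using F N by auto
  have e: "of_real ((frob M)\<^sup>2) = (\<Sum>i<a. \<Sum>j<b. cnj (M $$ (i,j)) * M $$ (i,j))"
    if "M \<in> carrier_mat a b" for M a b
    unfolding frob_sq[OF that] of_real_sum by (simp only: complex_norm_square mult.commute)
  have "complex_of_real ((frob (F * N))\<^sup>2) = (\<Sum>r<m. \<Sum>e<k. \<Sum>i<n. cnj ((F * N) $$ (r,e)) * F $$ (r,i) * N $$ (i,e))"
    unfolding e[OF FN]
    by (intro sum.cong refl) (simp add: mult_mat_entry[OF F N] sum_distrib_left mult.assoc)
  also have "\<dots> = (\<Sum>e<k. \<Sum>r<m. \<Sum>i<n. cnj ((F * N) $$ (r,e)) * F $$ (r,i) * N $$ (i,e))"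
    by (rule sum.swap)
  also have "\<dots> = (\<Sum>e<k. \<Sum>i<n. \<Sum>r<m. cnj ((F * N) $$ (r,e)) * F $$ (r,i) * N $$ (i,e))"
    by (intro sum.cong refl sum.swap)
  also have "\<dots> = (\<Sum>e<k. \<Sum>i<n. cnj ((ctrans F * (F * N)) $$ (i,e)) * N $$ (i,e))"
    by (intro sum.cong refl)
      (simp add: ctrans_mult_entry[OF F FN] sum_distrib_right sum_distrib_left mult_ac del: index_mult_mat)
  also have "\<dots> = (\<Sum>e<k. \<Sum>i<n. cnj (N $$ (i,e)) * N $$ (i,e))"
  proof (intro sum.cong refl)
    fix e i assume ie: "e \<in> {..<k}" "i \<in> {..<n}"
    show "cnj ((ctrans F * (F * N)) $$ (i,e)) * N $$ (i,e) = cnj (N $$ (i,e)) * N $$ (i,e)"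
    proof (cases "S i e")
      case True
      then show ?thesis using gram_mult_entry[OF F N sF sN orth E_refl _ _ _ True] TE ie by simp
    next
      case False
      then show ?thesis using supportedD[OF sN N, of i e] ie by auto
    qed
  qed
  also have "\<dots> = of_real ((frob N)\<^sup>2)" unfolding e[OF N] by (rule sum.swap)
  finally have "(frob (F * N))\<^sup>2 = (frob N)\<^sup>2" using of_real_eq_iff by blast
  then show ?thesis by simp
qed

lemma masked_projection:
  assumes F: "F \<in> carrier_mat m n" and U: "U \<in> carrier_mat m k"
    and sF: "supported T F" and orth: "col_orth E F" and E_refl: "\<And>i. E i i"
    and TE: "\<And>r i l e. r < m \<Longrightarrow> i < n \<Longrightarrow> l < n \<Longrightarrow> e < k \<Longrightarrow> T r i \<Longrightarrow> T r l \<Longrightarrow> S i e \<Longrightarrow> S l e \<Longrightarrow> E i l"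
  obtains W where "W \<in> carrier_mat n k" "supported S W" "perp S F (U - F * W)"
proof
  \<comment> \<open>The masked normal equations have this explicit solution because
    \<open>ctrans F * F\<close> acts as the identity on masked entries.\<close>
  define W where "W = mat n k (\<lambda>(i,e). if S i e then (ctrans F * U) $$ (i,e) else 0)"
  show W: "W \<in> carrier_mat n k" and sW: "supported S W"
    by (auto simp: W_def supported_def)
  have FW: "F * W \<in> carrier_mat m k" using F W by auto
  have d: "ctrans F * (U - F * W) = ctrans F * U - ctrans F * (F * W)"
    by (rule mult_minus_distrib_mat[OF ctrans_carrier[OF F] U FW])
  show "perp S F (U - F * W)"
    unfolding perp_def
  proof (intro allI impI)
    fix i e assume "i < dim_col F" "e < dim_col (U - F * W)" and S: "S i e"
    then have ie: "i < n" "e < k" using F W by auto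
    have "(ctrans F * (U - F * W)) $$ (i,e) = (ctrans F * U) $$ (i,e) - (ctrans F * (F * W)) $$ (i,e)"
      unfolding d using ie F FW ctrans_carrier[OF F] by (intro index_minus_mat) auto
    also have "(ctrans F * (F * W)) $$ (i,e) = W $$ (i,e)"
      by (rule gram_mult_entry[OF F W sF sW orth E_refl _ ie S]) (rule TE)
    finally show "(ctrans F * (U - F * W)) $$ (i,e) = 0" using ie S by (simp add: W_def)
  qed
qed

text \<open>By \<open>ext\<close>, every term contributing to an entry of
  \<open>ctrans F * (D * V)\<close> in the mask \<open>sZ\<close> uses an entry of
  \<open>ctrans F * D\<close> in the mask \<open>sW\<close>, which is zero.\<close>

lemma perp_mult:
  assumes F: "F \<in> carrier_mat m n" and D: "D \<in> carrier_mat m k" and V: "V \<in> carrier_mat k l"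
    and sF: "supported sF F" and sD: "supported sD D" and sV: "supported sV V" and p: "perp sW F D"
    and ext: "\<And>r i j e. r < m \<Longrightarrow> i < n \<Longrightarrow> j < k \<Longrightarrow> e < l \<Longrightarrow> sF r i \<Longrightarrow> sD r j \<Longrightarrow> sV j e \<Longrightarrow> sZ i e \<Longrightarrow> sW i j"
  shows "perp sZ F (D * V)"
  unfolding perp_def
proof (intro allI impI)
  fix i e assume "i < dim_col F" "e < dim_col (D * V)" and Z: "sZ i e"
  then have ie: "i < n" "e < l" using F V by auto
  have z: "(ctrans F * D) $$ (i,j) * V $$ (j,e) = 0" if j: "j < k" for j
  proof (rule ccontr)
    assume nz: "\<not> ?thesis"
    then have "(\<Sum>r<m. cnj (F $$ (r,i)) * D $$ (r,j)) \<noteq> 0" by (auto simp: ctrans_mult_entry[OF F D ie(1) j])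
    then obtain r where r: "r < m" "F $$ (r,i) \<noteq> 0" "D $$ (r,j) \<noteq> 0"
      by (metis (no_types, lifting) complex_cnj_zero lessThan_iff mult_eq_0_iff sum.neutral)
    then have "sW i j"
      using ext[OF r(1) ie(1) j ie(2)] supportedD[OF sF F] supportedD[OF sD D] supportedD[OF sV V j ie(2)] Z nz ie j by auto
    then show False using p nz ie j F D unfolding perp_def by auto
  qed
  have "ctrans F * (D * V) = ctrans F * D * V"
    by (rule assoc_mult_mat[symmetric, OF ctrans_carrier[OF F] D V])
  also have "\<dots> $$ (i,e) = (\<Sum>j<k. (ctrans F * D) $$ (i,j) * V $$ (j,e))"
    by (rule mult_mat_entry) (use F D V ie ctrans_carrier[OF F] in auto)
  also have "\<dots> = 0" by (intro sum.neutral) (use z in auto)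
  finally show "(ctrans F * (D * V)) $$ (i,e) = 0" .
qed

lemma minus_add_minus_mat:
  fixes A B C :: "complex mat"
  assumes "A \<in> carrier_mat m n" "B \<in> carrier_mat m n" "C \<in> carrier_mat m n"
  shows "(A - B) + (B - C) = A - C"
  using assms by (intro eq_matI) auto

lemma minus_minus_add_minus_mat:
  fixes A B C D :: "complex mat"
  assumes "A \<in> carrier_mat m n" "B \<in> carrier_mat m n" "C \<in> carrier_mat m n" "D \<in> carrier_mat m n"
  shows "A - B - (C - D) + (B - D) = A - C"
  using assms by (intro eq_matI) auto

text \<open>Projecting \<open>B - U * V\<close> orthogonally onto the matrices \<open>F * N\<close> with \<open>N\<close> supported in \<open>sZ\<close>
  sends \<open>B\<close> to \<open>F * Z\<close> and \<open>U * V\<close> to \<open>F * W * V\<close>: the masks are such that projecting \<open>U\<close> alone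
  commutes with the right multiplication by \<open>V\<close>.\<close>
lemma compress_left:
  assumes F: "F \<in> carrier_mat n0 n1" and Z: "Z \<in> carrier_mat n1 n3" and B: "B \<in> carrier_mat n0 n3"
    and U: "U \<in> carrier_mat n0 n2" and V: "V \<in> carrier_mat n2 n3"
    and sF: "supported sF F" and sZ: "supported sZ Z" and sU: "supported sU U" and sV: "supported sV V"
    and orth: "col_orth E F" and E_refl: "\<And>i. E i i"
    and BZ: "perp sZ F (B - F * Z)"
    and EZ: "\<And>r i l e. r < n0 \<Longrightarrow> i < n1 \<Longrightarrow> l < n1 \<Longrightarrow> e < n3 \<Longrightarrow> sF r i \<Longrightarrow> sF r l \<Longrightarrow> sZ i e \<Longrightarrow> sZ l e \<Longrightarrow> E i l"
    and EW: "\<And>r i l j. r < n0 \<Longrightarrow> i < n1 \<Longrightarrow> l < n1 \<Longrightarrow> j < n2 \<Longrightarrow> sF r i \<Longrightarrow> sF r l \<Longrightarrow> sW i j \<Longrightarrow> sW l j \<Longrightarrow> E i l"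
    and FW: "\<And>r i j. r < n0 \<Longrightarrow> i < n1 \<Longrightarrow> j < n2 \<Longrightarrow> sF r i \<Longrightarrow> sW i j \<Longrightarrow> sU r j"
    and WV: "\<And>i j e. i < n1 \<Longrightarrow> j < n2 \<Longrightarrow> e < n3 \<Longrightarrow> sW i j \<Longrightarrow> sV j e \<Longrightarrow> sZ i e"
    and ext: "\<And>r i j e. r < n0 \<Longrightarrow> i < n1 \<Longrightarrow> j < n2 \<Longrightarrow> e < n3 \<Longrightarrow> sF r i \<Longrightarrow> sU r j \<Longrightarrow> sV j e \<Longrightarrow> sZ i e \<Longrightarrow> sW i j"
  obtains W where "W \<in> carrier_mat n1 n2" "supported sW W" "frob (Z - W * V) \<le> frob (B - U * V)"
proof -
  obtain W where W: "W \<in> carrier_mat n1 n2" and sW: "supported sW W" and pW: "perp sW F (U - F * W)"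
    by (rule masked_projection[OF F U sF orth E_refl, of sW]) (use EW in blast)+
  have c: "F * W \<in> carrier_mat n0 n2" "W * V \<in> carrier_mat n1 n3" "F * Z \<in> carrier_mat n0 n3"
    "U - F * W \<in> carrier_mat n0 n2" "F * W * V \<in> carrier_mat n0 n3" "U * V \<in> carrier_mat n0 n3"
    "Z - W * V \<in> carrier_mat n1 n3" "(U - F * W) * V \<in> carrier_mat n0 n3" "B - F * Z \<in> carrier_mat n0 n3"
    using F W V Z U B by auto
  have "supported sU (U - F * W)"
    by (rule supported_diff[OF sU _ U c(1)]) (rule supported_mult[OF sF sW F W], use FW in auto)
  then have pD: "perp sZ F ((U - F * W) * V)"
    by (rule perp_mult[OF F c(4) V sF _ sV pW]) (use ext in auto)
  have sN: "supported sZ (Z - W * V)"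
    by (rule supported_diff[OF sZ _ Z c(2)]) (rule supported_mult[OF sW sV W V], use WV in auto)
  \<comment> \<open>\<open>B - U * V\<close> is \<open>G\<close> plus
    \<open>F * (Z - W * V)\<close>, and \<open>G\<close> is orthogonal to the second summand;
    dropping it can only shrink the norm.\<close>
  define G where "G = (B - F * Z) - (U - F * W) * V"
  have G: "G \<in> carrier_mat n0 n3" unfolding G_def by (rule minus_carrier_mat[OF c(8)])
  have pG: "perp sZ F G" unfolding G_def by (rule perp_diff[OF F c(9,8) BZ pD])
  have FN: "F * (Z - W * V) = F * Z - F * W * V"
    using mult_minus_distrib_mat[OF F Z c(2)] assoc_mult_mat[OF F W V] by simp
  have D: "(U - F * W) * V = U * V - F * W * V" by (rule minus_mult_distrib_mat[OF U c(1) V])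
  have "G + F * (Z - W * V) = B - U * V"
    unfolding G_def FN D by (rule minus_minus_add_minus_mat[OF B c(3,6,5)])
  moreover have "frob (F * (Z - W * V)) = frob (Z - W * V)"
    by (rule frob_isometry[OF F c(7) sF sN orth E_refl]) (rule EZ)
  ultimately have "frob (Z - W * V) \<le> frob (B - U * V)"
    using frob_perp_le[OF F c(7) G sN pG] by simp
  then show thesis using that W sW by blast
qed

text \<open>Transposition reverses products and preserves the Frobenius norm, so
  \<open>compress_left\<close> applies to the transposes. Here the rows of \<open>F\<close> are
  orthonormal within classes.\<close>

lemma compress_right:
  assumes F: "F \<in> carrier_mat n1 n0" and Z: "Z \<in> carrier_mat n3 n1" and B: "B \<in> carrier_mat n3 n0"
    and U: "U \<in> carrier_mat n2 n0" and V: "V \<in> carrier_mat n3 n2"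
    and sF: "supported sF F" and sZ: "supported sZ Z" and sU: "supported sU U" and sV: "supported sV V"
    and orth: "col_orth E (transpose_mat F)" and E_refl: "\<And>i. E i i"
    and BZ: "perp (\<lambda>i e. sZ e i) (transpose_mat F) (transpose_mat (B - Z * F))"
    and EZ: "\<And>r i l e. r < n0 \<Longrightarrow> i < n1 \<Longrightarrow> l < n1 \<Longrightarrow> e < n3 \<Longrightarrow> sF i r \<Longrightarrow> sF l r \<Longrightarrow> sZ e i \<Longrightarrow> sZ e l \<Longrightarrow> E i l"
    and EW: "\<And>r i l j. r < n0 \<Longrightarrow> i < n1 \<Longrightarrow> l < n1 \<Longrightarrow> j < n2 \<Longrightarrow> sF i r \<Longrightarrow> sF l r \<Longrightarrow> sW j i \<Longrightarrow> sW j l \<Longrightarrow> E i l"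
    and FW: "\<And>r i j. r < n0 \<Longrightarrow> i < n1 \<Longrightarrow> j < n2 \<Longrightarrow> sF i r \<Longrightarrow> sW j i \<Longrightarrow> sU j r"
    and WV: "\<And>i j e. i < n1 \<Longrightarrow> j < n2 \<Longrightarrow> e < n3 \<Longrightarrow> sW j i \<Longrightarrow> sV e j \<Longrightarrow> sZ e i"
    and ext: "\<And>r i j e. r < n0 \<Longrightarrow> i < n1 \<Longrightarrow> j < n2 \<Longrightarrow> e < n3 \<Longrightarrow> sF i r \<Longrightarrow> sU j r \<Longrightarrow> sV e j \<Longrightarrow> sZ e i \<Longrightarrow> sW j i"
  obtains W where "W \<in> carrier_mat n2 n1" "supported sW W" "frob (Z - V * W) \<le> frob (B - V * U)"
proof -
  have ZF: "Z * F \<in> carrier_mat n3 n0" and VU: "V * U \<in> carrier_mat n3 n0" using Z F V U by auto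
  have t: "transpose_mat (B - Z * F) = transpose_mat B - transpose_mat F * transpose_mat Z"
    using transpose_minus[OF B ZF] transpose_mult[OF Z F] by simp
  have u: "transpose_mat (B - V * U) = transpose_mat B - transpose_mat U * transpose_mat V"
    using transpose_minus[OF B VU] transpose_mult[OF V U] by simp
  have tc: "transpose_mat F \<in> carrier_mat n0 n1" "transpose_mat Z \<in> carrier_mat n1 n3"
    "transpose_mat B \<in> carrier_mat n0 n3" "transpose_mat U \<in> carrier_mat n0 n2" "transpose_mat V \<in> carrier_mat n2 n3"
    using F Z B U V by auto
  obtain W where W: "W \<in> carrier_mat n1 n2" "supported (\<lambda>i j. sW j i) W"
    "frob (transpose_mat Z - W * transpose_mat V) \<le> frob (transpose_mat B - transpose_mat U * transpose_mat V)"
    by (rule compress_left[of "transpose_mat F" n0 n1 "transpose_mat Z" n3 "transpose_mat B" "transpose_mat U" n2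
        "transpose_mat V" "\<lambda>i j. sF j i" "\<lambda>i j. sZ j i" "\<lambda>i j. sU j i" "\<lambda>i j. sV j i" E "\<lambda>i j. sW j i",
        OF tc supported_transpose[OF sF] supported_transpose[OF sZ] supported_transpose[OF sU]
          supported_transpose[OF sV] orth E_refl BZ[unfolded t]])
      (blast intro: EZ EW FW WV ext)+
  have VW: "V * transpose_mat W \<in> carrier_mat n3 n1" using V W by auto
  have "transpose_mat (Z - V * transpose_mat W) = transpose_mat Z - W * transpose_mat V"
    using transpose_minus[OF Z VW] transpose_mult[OF V, of "transpose_mat W" n1] W by simp
  then have "frob (Z - V * transpose_mat W) \<le> frob (B - V * U)"
    using W(3) u frob_transpose by metis
  then show thesis using that[of "transpose_mat W"] W supported_transpose[OF W(2)] by auto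
qed

text \<open>Normal equations without differentiation: by Pythagoras the squared error at
  \<open>Z\<close> exceeds that at the masked projection \<open>W\<close> by the squared norm of
  \<open>F * (W - Z)\<close>. Minimality makes this zero, and the isometry gives
  \<open>W = Z\<close>.\<close>

lemma minimal_imp_perp:
  assumes F: "F \<in> carrier_mat m n" and Z: "Z \<in> carrier_mat n k" and B: "B \<in> carrier_mat m k"
    and sF: "supported T F" and sZ: "supported S Z" and orth: "col_orth E F" and E_refl: "\<And>i. E i i"
    and TE: "\<And>r i l e. r < m \<Longrightarrow> i < n \<Longrightarrow> l < n \<Longrightarrow> e < k \<Longrightarrow> T r i \<Longrightarrow> T r l \<Longrightarrow> S i e \<Longrightarrow> S l e \<Longrightarrow> E i l"
    and min: "\<And>N. N \<in> carrier_mat n k \<Longrightarrow> supported S N \<Longrightarrow> frob (B - F * Z) \<le> frob (B - F * N)"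
  shows "perp S F (B - F * Z)"
proof -
  obtain W where W: "W \<in> carrier_mat n k" and sW: "supported S W" and pW: "perp S F (B - F * W)"
    by (rule masked_projection[OF F B sF orth E_refl, of S]) (use TE in blast)+
  have FW: "F * W \<in> carrier_mat m k" and FZ: "F * Z \<in> carrier_mat m k" using F W Z by auto
  have N: "W - Z \<in> carrier_mat n k" by (rule minus_carrier_mat[OF Z])
  have sN: "supported S (W - Z)" by (rule supported_diff[OF sW sZ W Z])
  have "(B - F * W) + F * (W - Z) = B - F * Z"
    unfolding mult_minus_distrib_mat[OF F W Z] by (rule minus_add_minus_mat[OF B FW FZ])
  then have "(frob (B - F * Z))\<^sup>2 = (frob (B - F * W))\<^sup>2 + (frob (F * (W - Z)))\<^sup>2"
    using frob_perp_sq[OF F N minus_carrier_mat[OF FW] sN pW] by simp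
  moreover have "(frob (B - F * Z))\<^sup>2 \<le> (frob (B - F * W))\<^sup>2" by (rule power_mono[OF min[OF W sW]]) simp
  ultimately have "frob (F * (W - Z)) = 0" by simp
  moreover have "frob (F * (W - Z)) = frob (W - Z)"
    by (rule frob_isometry[OF F N sF sN orth E_refl]) (rule TE)
  ultimately have "W - Z = 0\<^sub>m n k" using frob_zero[OF N] by simp
  then have "W $$ (i,j) = Z $$ (i,j)" if "i < n" "j < k" for i j
    using that Z W by (metis carrier_matD eq_iff_diff_eq_0 index_minus_mat(1) index_zero_mat(1))
  then have "W = Z" using W Z by (intro eq_matI) auto
  then show ?thesis using pW by simp
qed

text \<open>Supplies the residual condition when the matrix to be compressed is itself the product
  \<open>F * Z\<close>, as happens when a side factor is stripped.\<close>

lemma perp_self_minus: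
  assumes "F \<in> carrier_mat m n" "A \<in> carrier_mat m k"
  shows "perp S F (A - A)"
proof -
  have "A - A = 0\<^sub>m m k" using assms by auto
  moreover have "ctrans F * 0\<^sub>m m k = 0\<^sub>m n k" using ctrans_carrier[OF assms(1)] by simp
  ultimately show ?thesis using assms unfolding perp_def by auto
qed

subsection \<open>QR decompositions and best low-rank approximations\<close>

lemma exists_normalising_factor:
  fixes w :: "nat \<Rightarrow> complex"
  assumes "r0 < m" "w r0 \<noteq> 0"
  obtains t :: real where "t > 0" "(\<Sum>r<m. cnj (w r / t) * (w r / t)) = 1"
proof
  define S where "S = (\<Sum>r<m. (cmod (w r))\<^sup>2)"
  have S: "S > 0" unfolding S_def by (rule sum_pos2[of _ r0]) (use assms in auto)
  then show t: "sqrt S > 0" by simp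
  have e: "cnj (x / t) * (x / t) = of_real ((cmod x)\<^sup>2 / t\<^sup>2)" for x :: complex and t :: real
    using complex_norm_square[of x] by (simp add: power2_eq_square mult.commute[of x])
  have "(\<Sum>r<m. cnj (w r / sqrt S) * (w r / sqrt S)) = of_real (\<Sum>r<m. (cmod (w r))\<^sup>2 / (sqrt S)\<^sup>2)"
    unfolding e by simp
  also have "(\<Sum>r<m. (cmod (w r))\<^sup>2 / (sqrt S)\<^sup>2) = S / (sqrt S)\<^sup>2"
    unfolding S_def sum_divide_distrib by simp
  finally show "(\<Sum>r<m. cnj (w r / sqrt S) * (w r / sqrt S)) = 1" using S by simp
qed

lemma exists_unit_orthogonal:
  fixes Q :: "nat \<Rightarrow> nat \<Rightarrow> complex"
  assumes "n < m"
  obtains v where "(\<Sum>r<m. cnj (v r) * v r) = 1" "\<And>i. i < n \<Longrightarrow> (\<Sum>r<m. cnj (Q r i) * v r) = 0"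
proof -
  define c where "c i = vec m (\<lambda>r. if i < n then cnj (Q r i) else 0)" for i
  \<comment> \<open>The rows are the conjugated vectors, completed by zero rows. Row
    \<open>n\<close> being zero makes the matrix singular, and a kernel vector is orthogonal to all
    the given ones.\<close>
  define A where "A = mat\<^sub>r m m (\<lambda>i. if i = n then 0\<^sub>v m else c i)"
  have A: "A \<in> carrier_mat m m" by (auto simp: A_def)
  have "det A = 0" unfolding A_def by (rule det_row_0) (use assms in \<open>auto simp: c_def\<close>)
  then obtain v where v: "v \<in> carrier_vec m" "v \<noteq> 0\<^sub>v m" "A *\<^sub>v v = 0\<^sub>v m"
    using det_0_iff_vec_prod_zero_field[OF A] by auto
  obtain r0 where r0: "r0 < m" "v $ r0 \<noteq> 0" using v by (metis carrier_vecD eq_vecI index_zero_vec)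
  obtain t :: real where t: "t > 0" "(\<Sum>r<m. cnj (v $ r / t) * (v $ r / t)) = 1"
    by (rule exists_normalising_factor[of r0 m "\<lambda>r. v $ r"]) (use r0 in auto)
  show thesis
  proof
    show "(\<Sum>r<m. cnj (v $ r / t) * (v $ r / t)) = 1" by (rule t)
    fix i assume i: "i < n"
    then have im: "i < m" "i \<noteq> n" using assms by auto
    have "(A *\<^sub>v v) $ i = (\<Sum>r<m. cnj (Q r i) * v $ r)"
      using im i v(1) by (auto simp: A_def c_def scalar_prod_def lessThan_atLeast0 intro!: sum.cong)
    then have "(\<Sum>r<m. cnj (Q r i) * v $ r) = 0" using v(3) im by simp
    then show "(\<Sum>r<m. cnj (Q r i) * (v $ r / t)) = 0"
      by (simp flip: sum_divide_distrib)
  qed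
qed

text \<open>Gram-Schmidt, by induction on the number of columns. Rank-deficient blocks occur, so a
  column in the span of the earlier ones gets diagonal entry 0 and an arbitrary orthogonal unit
  vector, for which \<open>n \<le> m\<close> leaves room.\<close>

lemma QR_exists_fun:
  fixes M :: "nat \<Rightarrow> nat \<Rightarrow> complex"
  assumes "n \<le> m"
  shows "\<exists>Q R. (\<forall>i<n. \<forall>j<n. (\<Sum>r<m. cnj (Q r i) * Q r j) = (if i = j then 1 else 0)) \<and>
    (\<forall>i j. j < i \<longrightarrow> R i j = 0) \<and> (\<forall>r<m. \<forall>j<n. M r j = (\<Sum>i<n. Q r i * R i j))"
  using assms
proof (induction n)
  case 0
  show ?case by (intro exI[of _ "\<lambda>_ _. 0"] conjI) simp_all
next
  case (Suc n)
  have "n \<le> m" using Suc.prems by simp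
  from Suc.IH[OF this] obtain Q R
    where H: "(\<forall>i<n. \<forall>j<n. (\<Sum>r<m. cnj (Q r i) * Q r j) = (if i = j then 1 else 0)) \<and>
      (\<forall>i j. j < i \<longrightarrow> R i j = 0) \<and> (\<forall>r<m. \<forall>j<n. M r j = (\<Sum>i<n. Q r i * R i j))"
    by (elim exE)
  have Q: "\<And>i j. i < n \<Longrightarrow> j < n \<Longrightarrow> (\<Sum>r<m. cnj (Q r i) * Q r j) = (if i = j then 1 else 0)"
    and R: "\<And>i j. j < i \<Longrightarrow> R i j = 0" and QR: "\<And>r j. r < m \<Longrightarrow> j < n \<Longrightarrow> M r j = (\<Sum>i<n. Q r i * R i j)"
    using H by blast+
  \<comment> \<open>Coefficients of column \<open>n\<close> along the earlier vectors;
    \<open>w\<close> is the remainder orthogonal to them.\<close>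
  define c where "c i = (\<Sum>r<m. cnj (Q r i) * M r n)" for i
  define w where "w r = M r n - (\<Sum>k<n. Q r k * c k)" for r
  have w: "(\<Sum>r<m. cnj (Q r i) * w r) = 0" if i: "i < n" for i
  proof -
    have "(\<Sum>r<m. cnj (Q r i) * w r) = c i - (\<Sum>r<m. \<Sum>k<n. cnj (Q r i) * Q r k * c k)"
      unfolding w_def right_diff_distrib sum_subtractf c_def[of i] sum_distrib_left by (simp only: mult.assoc)
    also have "(\<Sum>r<m. \<Sum>k<n. cnj (Q r i) * Q r k * c k) = (\<Sum>k<n. (\<Sum>r<m. cnj (Q r i) * Q r k) * c k)"
      unfolding sum_distrib_right by (rule sum.swap)
    also have "\<dots> = (\<Sum>k<n. if i = k then c i else 0)"
      by (intro sum.cong) (use Q i in auto)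
    finally show ?thesis using i by simp
  qed
  obtain q z where q: "(\<Sum>r<m. cnj (q r) * q r) = 1" "\<And>i. i < n \<Longrightarrow> (\<Sum>r<m. cnj (Q r i) * q r) = 0"
    and z: "\<And>r. r < m \<Longrightarrow> w r = q r * z"
  proof (cases "\<forall>r<m. w r = 0")
    case True
    have "n < m" using Suc by simp
    then obtain v where "(\<Sum>r<m. cnj (v r) * v r) = 1" "\<And>i. i < n \<Longrightarrow> (\<Sum>r<m. cnj (Q r i) * v r) = 0"
      by (rule exists_unit_orthogonal[of n m Q]) blast
    then show thesis using that[of v 0] True by auto
  next
    case False
    then obtain r0 where r0: "r0 < m" "w r0 \<noteq> 0" by auto
    obtain t :: real where t: "t > 0" "(\<Sum>r<m. cnj (w r / t) * (w r / t)) = 1"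
      by (rule exists_normalising_factor[of r0 m w]) (use r0 in auto)
    moreover have "(\<Sum>r<m. cnj (Q r i) * (w r / t)) = 0" if "i < n" for i
      using w[OF that] by (simp flip: sum_divide_distrib)
    ultimately show thesis using that[of "\<lambda>r. w r / t" t] t by simp
  qed
  have q': "(\<Sum>r<m. cnj (q r) * Q r i) = 0" if "i < n" for i
  proof -
    have "cnj (\<Sum>r<m. cnj (Q r i) * q r) = 0" using q(2)[OF that] by simp
    then show ?thesis by (simp add: mult.commute)
  qed
  define Q' where "Q' r i = (if i < n then Q r i else q r)" for r i
  define R' where "R' i j = (if j < n then R i j else if j = n then (if i < n then c i else if i = n then z else 0) else 0)" for i j
  have "(\<Sum>r<m. cnj (Q' r i) * Q' r j) = (if i = j then 1 else 0)" if "i < Suc n" "j < Suc n" for i j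
  proof -
    have "i < n \<or> i = n" "j < n \<or> j = n" using that by linarith+
    then show ?thesis
      by (elim disjE) (simp_all add: Q'_def Q q q')
  qed
  moreover have "R' i j = 0" if "j < i" for i j
    using that R by (auto simp: R'_def)
  moreover have "M r j = (\<Sum>i<Suc n. Q' r i * R' i j)" if "r < m" "j < Suc n" for r j
  proof (cases "j < n")
    case True
    then show ?thesis using QR[OF that(1) True] R[OF True] by (simp add: Q'_def R'_def)
  next
    case False
    then have j: "j = n" using that by simp
    have "M r n = (\<Sum>k<n. Q r k * c k) + q r * z" using z[OF that(1)] by (simp add: w_def algebra_simps)
    then show ?thesis by (simp add: Q'_def R'_def j)
  qed
  ultimately show ?case by blast
qed

lemma QR_exists:
  assumes "dim_col M \<le> dim_row M"
  obtains Q R where "is_QR M Q R"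
proof -
  let ?m = "dim_row M" and ?n = "dim_col M"
  obtain Q R where Q: "\<forall>i<?n. \<forall>j<?n. (\<Sum>r<?m. cnj (Q r i) * Q r j) = (if i = j then 1 else 0)"
    and R: "\<forall>i j. j < i \<longrightarrow> R i j = 0" and QR: "\<forall>r<?m. \<forall>j<?n. M $$ (r,j) = (\<Sum>i<?n. Q r i * R i j)"
    using QR_exists_fun[OF assms, of "\<lambda>r j. M $$ (r,j)"] by (elim exE conjE)
  define Qm where "Qm = mat ?m ?n (\<lambda>(r,i). Q r i)"
  define Rm where "Rm = mat ?n ?n (\<lambda>(i,j). R i j)"
  have c: "Qm \<in> carrier_mat ?m ?n" "Rm \<in> carrier_mat ?n ?n" by (auto simp: Qm_def Rm_def)
  have "ctrans Qm * Qm = 1\<^sub>m ?n"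
  proof (rule eq_matI)
    fix i j assume "i < dim_row (1\<^sub>m ?n)" "j < dim_col (1\<^sub>m ?n)"
    then have ij: "i < ?n" "j < ?n" by auto
    show "(ctrans Qm * Qm) $$ (i,j) = 1\<^sub>m ?n $$ (i,j)"
      unfolding ctrans_mult_entry[OF c(1) c(1) ij] using Q ij by (simp add: Qm_def)
  qed (use c ctrans_carrier[OF c(1)] in auto)
  moreover have "\<forall>i<?n. \<forall>j<?n. j < i \<longrightarrow> Rm $$ (i,j) = 0" using R by (simp add: Rm_def)
  moreover have "M = Qm * Rm"
  proof (rule eq_matI)
    fix i j assume "i < dim_row (Qm * Rm)" "j < dim_col (Qm * Rm)"
    then have ij: "i < ?m" "j < ?n" using c by auto
    show "M $$ (i,j) = (Qm * Rm) $$ (i,j)"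
      unfolding mult_mat_entry[OF c ij] using QR ij by (simp add: Qm_def Rm_def)
  qed (use c in auto)
  ultimately have "is_QR M Qm Rm" unfolding is_QR_def using c by blast
  then show thesis by (rule that)
qed

section \<open>Compactness and best low-rank approximations\<close>

lemma compact_unit_entries: "compact {f :: nat \<times> nat \<Rightarrow> complex. \<forall>x. f x \<in> cball 0 1}"
proof -
  \<comment> \<open>Tychonoff. Matrices are encoded as functions on all index pairs so that the
    product topology applies; entries outside the index range are bounded as well.\<close>
  have "compactin (product_topology (\<lambda>_. euclidean) UNIV) (PiE UNIV (\<lambda>_ :: nat \<times> nat. cball (0 :: complex) 1))"
    unfolding compactin_PiE by auto
  moreover have "PiE UNIV (\<lambda>_ :: nat \<times> nat. cball (0 :: complex) 1) = {f. \<forall>x. f x \<in> cball 0 1}"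
    by (auto simp: PiE_def extensional_def)
  ultimately show ?thesis by (simp add: euclidean_product_topology)
qed

text \<open>For orthonormal columns \<open>Q\<close> the best second factor is \<open>ctrans Q * M\<close>, so by QR it suffices to
  minimise over the compact set of such \<open>Q\<close>.\<close>
lemma best_rank_approximation_exists:
  fixes M :: "complex mat"
  assumes M: "M \<in> carrier_mat m k" and nm: "n \<le> m"
  obtains H K where "H \<in> carrier_mat m n" "K \<in> carrier_mat n k"
    "\<And>H' K'. H' \<in> carrier_mat m n \<Longrightarrow> K' \<in> carrier_mat n k \<Longrightarrow> frob (M - H * K) \<le> frob (M - H' * K')"
proof -
  define mk where "mk f = mat m n f" for f :: "nat \<times> nat \<Rightarrow> complex"
  define g where "g f = frob (M - mk f * (ctrans (mk f) * M))" for f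
  \<comment> \<open>Orthonormal columns force entries of modulus at most 1, so the box excludes none
    of them and makes the set compact.\<close>
  define C where "C = {f :: nat \<times> nat \<Rightarrow> complex. \<forall>x. f x \<in> cball 0 1} \<inter>
     (\<Inter>i\<in>{..<n}. \<Inter>j\<in>{..<n}. {f. (\<Sum>r<m. cnj (f (r,i)) * f (r,j)) = (if i = j then 1 else 0)})"
  have mkc: "mk f \<in> carrier_mat m n" for f by (auto simp: mk_def)
  have mkM: "ctrans (mk f) * M \<in> carrier_mat n k" for f by (rule mult_carrier_mat[OF ctrans_carrier[OF mkc] M])
  have closed: "closed {f :: nat \<times> nat \<Rightarrow> complex. (\<Sum>r<m. cnj (f (r,i)) * f (r,j)) = (if i = j then 1 else 0)}" for i j
    by (intro closed_Collect_eq continuous_intros continuous_on_product_coordinates)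
  have compact: "compact C" unfolding C_def
    by (intro compact_Int_closed compact_unit_entries closed_INT ballI closed)
  \<comment> \<open>Written out in entries, \<open>g\<close> is visibly continuous in finitely many
    coordinates.\<close>
  have g_eq: "g f = sqrt (\<Sum>i<m. \<Sum>j<k. (cmod (M $$ (i,j) - (\<Sum>l<n. f (i,l) * (\<Sum>r<m. cnj (f (r,l)) * M $$ (r,j)))))\<^sup>2)" for f
  proof -
    have c: "M - mk f * (ctrans (mk f) * M) \<in> carrier_mat m k"
      by (rule minus_carrier_mat[OF mult_carrier_mat[OF mkc mkM]])
    have "(M - mk f * (ctrans (mk f) * M)) $$ (i,j) =
        M $$ (i,j) - (\<Sum>l<n. f (i,l) * (\<Sum>r<m. cnj (f (r,l)) * M $$ (r,j)))" if "i < m" "j < k" for i j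
    proof -
      have "(M - mk f * (ctrans (mk f) * M)) $$ (i,j) = M $$ (i,j) - (mk f * (ctrans (mk f) * M)) $$ (i,j)"
        using that mult_carrier_mat[OF mkc mkM, of f f] by (intro index_minus_mat) auto
      also have "(mk f * (ctrans (mk f) * M)) $$ (i,j) = (\<Sum>l<n. mk f $$ (i,l) * (ctrans (mk f) * M) $$ (l,j))"
        by (rule mult_mat_entry[OF mkc mkM that])
      also have "\<dots> = (\<Sum>l<n. f (i,l) * (\<Sum>r<m. cnj (f (r,l)) * M $$ (r,j)))"
      proof (intro sum.cong refl)
        fix l assume "l \<in> {..<n}"
        then have l: "l < n" by simp
        show "mk f $$ (i,l) * (ctrans (mk f) * M) $$ (l,j) = f (i,l) * (\<Sum>r<m. cnj (f (r,l)) * M $$ (r,j))"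
          unfolding ctrans_mult_entry[OF mkc M l that(2)] using that l by (simp add: mk_def)
      qed
      finally show ?thesis .
    qed
    then show ?thesis unfolding g_def frob_carrier[OF c]
      by (intro arg_cong[where f = sqrt] sum.cong refl) (simp only: lessThan_iff)
  qed
  have coord: "continuous_on C (\<lambda>f. f x)" for x
    by (rule continuous_on_subset[OF continuous_on_product_coordinates]) simp
  have cont: "continuous_on C g" unfolding g_eq[abs_def]
    by (intro continuous_intros coord)
  have in_C: "\<exists>f\<in>C. Q = mk f" if Q: "Q \<in> carrier_mat m n" "ctrans Q * Q = 1\<^sub>m n" for Q
  proof -
    define f where "f = (\<lambda>(r,i). if r < m \<and> i < n then Q $$ (r,i) else 0)"
    have e: "(\<Sum>r<m. cnj (Q $$ (r,i)) * Q $$ (r,j)) = (if i = j then 1 else 0)" if "i < n" "j < n" for i j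
      using ctrans_mult_entry[OF Q(1) Q(1) that] Q(2) that by simp
    have "cmod (Q $$ (r,i)) \<le> 1" if "r < m" "i < n" for r i
    proof -
      have "complex_of_real (\<Sum>r<m. (cmod (Q $$ (r,i)))\<^sup>2) = 1"
        using e[OF that(2) that(2)] unfolding of_real_sum complex_norm_square by (simp add: mult.commute)
      then have "(\<Sum>r<m. (cmod (Q $$ (r,i)))\<^sup>2) = 1" using of_real_eq_1_iff by blast
      moreover have "(cmod (Q $$ (r,i)))\<^sup>2 \<le> (\<Sum>r<m. (cmod (Q $$ (r,i)))\<^sup>2)"
        by (rule member_le_sum) (use that in auto)
      ultimately show ?thesis by (simp add: abs_square_le_1)
    qed
    then have "\<forall>x. f x \<in> cball 0 1" by (simp add: f_def case_prod_unfold)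
    moreover have "(\<Sum>r<m. cnj (f (r,i)) * f (r,j)) = (if i = j then 1 else 0)" if "i < n" "j < n" for i j
      unfolding e[OF that, symmetric] using that by (simp add: f_def)
    ultimately have "f \<in> C" unfolding C_def by blast
    moreover have "Q = mk f" using Q by (intro eq_matI) (auto simp: mk_def f_def)
    ultimately show ?thesis by blast
  qed
  have orth: "col_orth (\<lambda>_ _. True) (mk f)" if "f \<in> C" for f
    unfolding col_orth_def
  proof (intro allI impI)
    fix i j assume "i < dim_col (mk f)" "j < dim_col (mk f)"
    then have ij: "i < n" "j < n" by (auto simp: mk_def)
    show "(ctrans (mk f) * mk f) $$ (i,j) = (if i = j then 1 else 0)"
      unfolding ctrans_mult_entry[OF mkc mkc ij] using that ij by (auto simp: C_def mk_def)
  qed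
  have best: "g f \<le> frob (M - mk f * K)" if f: "f \<in> C" and K: "K \<in> carrier_mat n k" for f K
  proof -
    let ?F = "mk f" and ?W = "ctrans (mk f) * M"
    have s: "supported (\<lambda>_ _. True) X" for X by (simp add: supported_def)
    have FW: "?F * ?W \<in> carrier_mat m k" by (rule mult_carrier_mat[OF mkc mkM])
    have G: "M - ?F * ?W \<in> carrier_mat m k" by (rule minus_carrier_mat[OF FW])
    have N: "?W - K \<in> carrier_mat n k" by (rule minus_carrier_mat[OF K])
    have "perp (\<lambda>_ _. True) ?F (M - ?F * ?W)"
      unfolding perp_def
    proof (intro allI impI)
      fix i j assume "i < dim_col (mk f)" "j < dim_col (M - ?F * ?W)"
      then have ij: "i < n" "j < k" using mkc[of f] FW by auto
      have "ctrans ?F * (M - ?F * ?W) = ctrans ?F * M - ctrans ?F * (?F * ?W)"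
        by (rule mult_minus_distrib_mat[OF ctrans_carrier[OF mkc] M FW])
      also have "\<dots> $$ (i,j) = (ctrans ?F * M) $$ (i,j) - (ctrans ?F * (?F * ?W)) $$ (i,j)"
        using ij mkc[of f] M by (intro index_minus_mat) (auto simp: ctrans_def)
      also have "(ctrans ?F * (?F * ?W)) $$ (i,j) = ?W $$ (i,j)"
        by (rule gram_mult_entry[where S = "\<lambda>_ _. True" and T = "\<lambda>_ _. True" and E = "\<lambda>_ _. True" and n = n and m = m and k = k])
          (simp_all only: mkc mkM s orth[OF f] ij)
      finally show "(ctrans ?F * (M - ?F * ?W)) $$ (i,j) = 0" by simp
    qed
    then have "(frob ((M - ?F * ?W) + ?F * (?W - K)))\<^sup>2 = (frob (M - ?F * ?W))\<^sup>2 + (frob (?F * (?W - K)))\<^sup>2"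
      by (rule frob_perp_sq[where S = "\<lambda>_ _. True", OF mkc N G s])
    moreover have "(M - ?F * ?W) + ?F * (?W - K) = M - ?F * K"
      unfolding mult_minus_distrib_mat[OF mkc mkM K]
      by (rule minus_add_minus_mat[OF M FW mult_carrier_mat[OF mkc K]])
    ultimately have "(frob (M - ?F * ?W))\<^sup>2 \<le> (frob (M - ?F * K))\<^sup>2" by simp
    then show ?thesis unfolding g_def by (rule power2_le_imp_le) simp
  qed
  \<comment> \<open>Orthonormal columns exist at all: the \<open>Q\<close> of the zero matrix is an
    example.\<close>
  obtain Q0 R0 where "is_QR (0\<^sub>m m n) Q0 R0" using QR_exists[of "0\<^sub>m m n"] nm by auto
  then have "C \<noteq> {}" using in_C[of Q0] unfolding is_QR_def index_zero_mat by blast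
  then obtain f0 where f0: "f0 \<in> C" "\<And>f. f \<in> C \<Longrightarrow> g f0 \<le> g f"
    using continuous_attains_inf[OF compact _ cont] by blast
  show thesis
  proof
    show "mk f0 \<in> carrier_mat m n" "ctrans (mk f0) * M \<in> carrier_mat n k" by (rule mkc mkM)+
    fix H' K' :: "complex mat" assume H': "H' \<in> carrier_mat m n" and K': "K' \<in> carrier_mat n k"
    obtain Q R where "is_QR H' Q R" using QR_exists[of H'] nm H' by auto
    then have QR: "Q \<in> carrier_mat m n" "R \<in> carrier_mat n n" "ctrans Q * Q = 1\<^sub>m n" "H' = Q * R"
      unfolding is_QR_def carrier_matD[OF H'] by blast+
    obtain f where f: "f \<in> C" "Q = mk f" using in_C[OF QR(1,3)] by auto
    \<comment> \<open>The triangular factor is absorbed into the second factor, so only orthonormal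
      first factors compete.\<close>
    have "H' * K' = mk f * (R * K')" using assoc_mult_mat[OF QR(1,2) K'] QR(4) f by simp
    then have "g f \<le> frob (M - H' * K')" using best[OF f(1) mult_carrier_mat[OF QR(2) K']] by simp
    then show "frob (M - mk f0 * (ctrans (mk f0) * M)) \<le> frob (M - H' * K')"
      using f0(2)[OF f(1)] unfolding g_def by linarith
  qed
qed

subsection \<open>Blocks of a chainable pair\<close>

text \<open>What the block structure needs of two neighbouring patterns. The witness
  \<open>r\<close> is the size of every class \<open>P\<close>, while \<open>pb p\<close> and
  \<open>pc p'\<close> are the numbers of rows and columns of its rectangle.\<close>

definition chain_pair :: "pattern \<Rightarrow> pattern \<Rightarrow> bool" where
  "chain_pair p p' \<longleftrightarrow> pattern_ok p \<and> pattern_ok p' \<and> ncols p = nrows p' \<and> pa p dvd pa p' \<and> pd p' dvd pd p \<and>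
     (\<exists>r. ncols p = pa p' * r * pd p \<and> r \<le> pb p \<and> r \<le> pc p')"

text \<open>The relation \<open>U_i = U_j\<close> in arithmetic form. The chunk length comes from
  the second pattern and the modulus from the first, each being the finer of the two.\<close>

definition same_block :: "pattern \<Rightarrow> pattern \<Rightarrow> nat \<Rightarrow> nat \<Rightarrow> bool" where
  "same_block p p' i j \<longleftrightarrow>
     i div (ncols p div pa p') = j div (ncols p div pa p') \<and> i mod pd p = j mod pd p"

lemma is_factor_iff: "is_factor p X \<longleftrightarrow> X \<in> carrier_mat (nrows p) (ncols p) \<and> supported (supp p) X"
  unfolding is_factor_def supported_def by auto

text \<open>The indices are \<open>(u * b + x) * d + v\<close> with \<open>x < b\<close>: in mixed
  radix only the middle digit is free.\<close>

lemma card_residue_block: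
  assumes "u < a" "v < (d::nat)" "b > 0"
  shows "card {i. i < a * b * d \<and> i div (b * d) = u \<and> i mod d = v} = b"
proof -
  have d: "d > 0" using assms by auto
  have e: "(u * b + x) * d + v < a * b * d" "((u * b + x) * d + v) div (b * d) = u" "((u * b + x) * d + v) mod d = v"
    if "x < b" for x
  proof -
    show "((u * b + x) * d + v) mod d = v" using assms by simp
    have q: "((u * b + x) * d + v) div d = u * b + x" using assms d by simp
    have "((u * b + x) * d + v) div (d * b) = (u * b + x) div b" by (simp only: div_mult2_eq q)
    then show "((u * b + x) * d + v) div (b * d) = u" using that by (simp add: mult.commute)
    have "u * b + x < a * b"
    proof -
      have "u * b + x < (u + 1) * b" using that by simp
      also have "\<dots> \<le> a * b" using assms by (intro mult_le_mono1) simp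
      finally show ?thesis .
    qed
    then have "((u * b + x) + 1) * d \<le> a * b * d" by (intro mult_le_mono1) simp
    moreover have "(u * b + x) * d + v < ((u * b + x) + 1) * d" using assms by simp
    ultimately show "(u * b + x) * d + v < a * b * d" by linarith
  qed
  have "bij_betw (\<lambda>x. (u * b + x) * d + v) {..<b} {i. i < a * b * d \<and> i div (b * d) = u \<and> i mod d = v}"
    unfolding bij_betw_def
  proof
    show "inj_on (\<lambda>x. (u * b + x) * d + v) {..<b}" using d by (auto simp: inj_on_def)
    show "(\<lambda>x. (u * b + x) * d + v) ` {..<b} = {i. i < a * b * d \<and> i div (b * d) = u \<and> i mod d = v}"
    proof (intro Set.set_eqI iffI)
      fix i assume "i \<in> {i. i < a * b * d \<and> i div (b * d) = u \<and> i mod d = v}"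
      then have i: "i div d div b = u" "i mod d = v" by (auto simp: div_mult2_eq mult.commute[of b])
      have "i div d = u * b + i div d mod b" using i div_mult_mod_eq[of "i div d" b] by simp
      then have "i = (u * b + i div d mod b) * d + v" using i div_mult_mod_eq[of i d] by simp
      then show "i \<in> (\<lambda>x. (u * b + x) * d + v) ` {..<b}" using assms(3) by (intro image_eqI[of _ _ "i div d mod b"]) auto
    qed (use e in auto)
  qed
  then show ?thesis using bij_betw_same_card by fastforce
qed

text \<open>The chunk length \<open>pb p' * pd p'\<close> divides \<open>pc p * pd p\<close>, and
  \<open>pd p'\<close> divides \<open>pd p\<close>.\<close>

lemma chain_pair_coarse:
  assumes "chain_pair p p'" "same_block p p' i j"
  shows "i div (pc p * pd p) = j div (pc p * pd p)" "i div (pb p' * pd p') = j div (pb p' * pd p')"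
    "i mod pd p = j mod pd p" "i mod pd p' = j mod pd p'"
proof -
  have ok: "pa p > 0" "pa p' > 0" "pd p' dvd pd p" "pa p * (pc p * pd p) = pa p' * (pb p' * pd p')"
    using assms(1) by (auto simp: chain_pair_def pattern_ok_def ncols_def nrows_def mult.assoc)
  obtain k where k: "pa p' = pa p * k" using assms(1) by (auto simp: chain_pair_def)
  have "ncols p div pa p' = pb p' * pd p'" using ok assms(1) by (simp add: chain_pair_def nrows_def mult.assoc)
  then have 1: "i div (pb p' * pd p') = j div (pb p' * pd p')" "i mod pd p = j mod pd p"
    using assms(2) by (auto simp: same_block_def)
  have "pc p * pd p = pb p' * pd p' * k" using ok k by (simp add: mult_ac)
  then show "i div (pc p * pd p) = j div (pc p * pd p)" using 1 by (simp add: div_mult2_eq)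
  show "i div (pb p' * pd p') = j div (pb p' * pd p')" "i mod pd p = j mod pd p" by (rule 1)+
  show "i mod pd p' = j mod pd p'" using 1(2) ok(3) by (metis mod_mod_cancel)
qed

lemma same_block_supp:
  assumes "chain_pair p p'" "same_block p p' i j" "i < ncols p" "j < ncols p"
  shows "supp p r i \<longleftrightarrow> supp p r j" "supp p' i c \<longleftrightarrow> supp p' j c"
  using chain_pair_coarse[OF assms(1,2)] assms by (auto simp: supp_def chain_pair_def)

text \<open>A shared row fixes the residue modulo \<open>pd p\<close>; a shared column fixes the
  chunk of length \<open>pb p' * pd p'\<close>.\<close>

lemma supp_imp_same_block:
  assumes "chain_pair p p'" "supp p r i" "supp p r j" "supp p' i c" "supp p' j c"
  shows "same_block p p' i j"
proof -
  have "ncols p div pa p' = pb p' * pd p'" using assms(1) by (auto simp: chain_pair_def pattern_ok_def nrows_def mult.assoc)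
  then show ?thesis using assms by (auto simp: supp_def same_block_def)
qed

lemma block_index_less:
  assumes "u < a" "v < (d::nat)" "b > 0"
  shows "u * (b * d) + v < a * b * d" "(u * (b * d) + v) div (b * d) = u" "(u * (b * d) + v) mod d = v"
proof -
  have bd: "v < b * d" using assms by (metis less_le_trans mult_le_mono1 nat_mult_1 Suc_leI One_nat_def)
  then show "(u * (b * d) + v) div (b * d) = u" using assms by simp
  show "(u * (b * d) + v) mod d = v" using assms by (simp flip: mult.assoc)
  have "u * (b * d) + v < (u + 1) * (b * d)" using bd by simp
  also have "\<dots> \<le> a * (b * d)" using assms by (intro mult_le_mono1) simp
  finally show "u * (b * d) + v < a * b * d" by (simp add: mult.assoc)
qed

lemma supp_row_ex:
  assumes "pattern_ok p" "i < ncols p"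
  shows "\<exists>r. supp p r i"
proof -
  have "i div (pc p * pd p) < pa p" using assms by (auto simp: ncols_def pattern_ok_def mult.assoc less_mult_imp_div_less)
  then have "supp p (i div (pc p * pd p) * (pb p * pd p) + i mod pd p) i"
    using assms block_index_less[of "i div (pc p * pd p)" "pa p" "i mod pd p" "pd p" "pb p"]
    by (auto simp: supp_def nrows_def pattern_ok_def)
  then show ?thesis by blast
qed

lemma supp_col_ex:
  assumes "pattern_ok p" "i < nrows p"
  shows "\<exists>c. supp p i c"
proof -
  have "i div (pb p * pd p) < pa p" using assms by (auto simp: nrows_def pattern_ok_def mult.assoc less_mult_imp_div_less)
  then have "supp p i (i div (pb p * pd p) * (pc p * pd p) + i mod pd p)"
    using assms block_index_less[of "i div (pb p * pd p)" "pa p" "i mod pd p" "pd p" "pc p"]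
    by (auto simp: supp_def ncols_def pattern_ok_def)
  then show ?thesis by blast
qed

lemma supp_bounds: "supp p i j \<Longrightarrow> i < nrows p" "supp p i j \<Longrightarrow> j < ncols p"
  by (auto simp: supp_def)

lemma same_block_refl [simp]: "same_block p p' i i"
  by (simp add: same_block_def)

text \<open>Every \<open>U_i\<close> is nonzero, so \<open>U_i = U_j\<close> provides a row and a
  column shared by \<open>i\<close> and \<open>j\<close>.\<close>

lemma Ucls_eq:
  assumes "chain_pair p p'" "i < ncols p"
  shows "Ucls p p' i = {j. j < ncols p \<and> same_block p p' i j}"
proof (intro Set.set_eqI iffI)
  fix j assume j: "j \<in> Ucls p p' i"
  obtain r c where rc: "supp p r i" "supp p' i c"
    using supp_row_ex[of p i] supp_col_ex[of p' i] assms by (auto simp: chain_pair_def)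
  then have "supp p r j" "supp p' j c"
    using j supp_bounds[OF rc(1)] supp_bounds[OF rc(2)] by (auto simp: Ucls_def Usupp_def)
  then show "j \<in> {j. j < ncols p \<and> same_block p p' i j}"
    using supp_imp_same_block[OF assms(1) rc(1) _ rc(2)] j by (auto simp: Ucls_def)
next
  fix j assume "j \<in> {j. j < ncols p \<and> same_block p p' i j}"
  then show "j \<in> Ucls p p' i"
    using same_block_supp[OF assms(1)] assms(2) by (auto simp: Ucls_def Usupp_def)
qed

lemma Ucls_self:
  assumes "chain_pair p p'" "i < ncols p"
  shows "i \<in> Ucls p p' i" "Ucls p p' i \<in> partP p p'"
proof -
  show "i \<in> Ucls p p' i" using assms by (simp add: Ucls_eq)
  show "Ucls p p' i \<in> partP p p'" using assms by (auto simp: partP_def)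
qed

text \<open>All members of a class have the same row and column supports, so any one of them
  determines the class and its rectangle.\<close>

lemma partP_eqs:
  assumes "chain_pair p p'" "P \<in> partP p p'" "i \<in> P"
  shows "i < ncols p" "P = Ucls p p' i" "P = {j. j < ncols p \<and> same_block p p' i j}"
    "RP p p' P = {r. supp p r i}" "CP p p' P = {c. supp p' i c}"
proof -
  obtain i0 where i0: "i0 < ncols p" "P = Ucls p p' i0" using assms(2) by (auto simp: partP_def)
  then have i: "i < ncols p" "same_block p p' i0 i" using assms(3) by (auto simp: Ucls_eq[OF assms(1)])
  show "i < ncols p" by (rule i)
  show P: "P = {j. j < ncols p \<and> same_block p p' i j}"
    using i unfolding i0(2) Ucls_eq[OF assms(1) i0(1)] by (auto simp: same_block_def)
  then show "P = Ucls p p' i" by (simp add: Ucls_eq[OF assms(1) i(1)])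
  have nc: "i < nrows p'" using i assms(1) by (simp add: chain_pair_def)
  obtain r0 c0 where rc: "supp p r0 i" "supp p' i c0"
    using supp_row_ex[of p i] supp_col_ex[of p' i] assms(1) i nc by (auto simp: chain_pair_def)
  have s: "supp p r j \<longleftrightarrow> supp p r i" "supp p' j c \<longleftrightarrow> supp p' i c" if "j \<in> P" for j r c
    using that same_block_supp[OF assms(1), of i j] i(1) unfolding P by auto
  show "RP p p' P = {r. supp p r i}"
  proof (intro Set.set_eqI iffI)
    fix r assume "r \<in> RP p p' P"
    then show "r \<in> {r. supp p r i}" using s(1) by (auto simp: RP_def Usupp_def)
  next
    fix r assume "r \<in> {r. supp p r i}"
    then have "supp p r i" by simp
    then show "r \<in> RP p p' P"
      using assms(3) rc(2) supp_bounds(2)[OF rc(2)] supp_bounds(1)[of p r i] by (auto simp: RP_def Usupp_def)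
  qed
  show "CP p p' P = {c. supp p' i c}"
  proof (intro Set.set_eqI iffI)
    fix c assume "c \<in> CP p p' P"
    then show "c \<in> {c. supp p' i c}" using s(2) by (auto simp: CP_def Usupp_def)
  next
    fix c assume "c \<in> {c. supp p' i c}"
    then have "supp p' i c" by simp
    then show "c \<in> CP p p' P"
      using assms(3) rc(1) supp_bounds(1)[OF rc(1)] supp_bounds(2)[of p' i c] by (auto simp: CP_def Usupp_def)
  qed
qed

lemma partP_nonempty: "chain_pair p p' \<Longrightarrow> P \<in> partP p p' \<Longrightarrow> \<exists>i. i \<in> P"
  unfolding partP_def using Ucls_self(1) by blast

lemma partP_subsets:
  assumes "chain_pair p p'" "P \<in> partP p p'"
  shows "P \<subseteq> {..<ncols p}" "P \<subseteq> {..<nrows p'}" "RP p p' P \<subseteq> {..<nrows p}" "CP p p' P \<subseteq> {..<ncols p'}"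
  using partP_eqs(1)[OF assms] assms by (auto simp: RP_def CP_def chain_pair_def)

lemma finite_partP: "finite (partP p p')"
proof -
  have "partP p p' = (\<lambda>i. Ucls p p' i) ` {..<ncols p}" by (auto simp: partP_def)
  then show ?thesis by simp
qed

text \<open>Members of two classes whose rectangles share an entry share a row and a column, hence a
  block. Disjointness makes the squared norm additive over the rectangles.\<close>

lemma partP_disjoint:
  assumes "chain_pair p p'" "P \<in> partP p p'" "P' \<in> partP p p'"
    and "r \<in> RP p p' P" "c \<in> CP p p' P" "r \<in> RP p p' P'" "c \<in> CP p p' P'"
  shows "P = P'"
proof -
  obtain i j where ij: "i \<in> P" "j \<in> P'" using partP_nonempty assms by metis
  have s: "supp p r i" "supp p' i c" "supp p r j" "supp p' j c"
    using assms partP_eqs(4,5)[OF assms(1,2) ij(1)] partP_eqs(4,5)[OF assms(1,3) ij(2)] by auto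
  then have "same_block p p' i j" by (intro supp_imp_same_block[OF assms(1)])
  then show ?thesis
    using partP_eqs(3)[OF assms(1,2) ij(1)] partP_eqs(3)[OF assms(1,3) ij(2)] by (auto simp: same_block_def)
qed

text \<open>The three cardinalities are \<open>pb p\<close>, \<open>r\<close> and
  \<open>pc p'\<close>, with \<open>r\<close> the witness of \<open>chain_pair\<close>. The
  inequalities are the size conditions for the QR decompositions in column and in row mode.\<close>

lemma partP_cards:
  assumes "chain_pair p p'" "P \<in> partP p p'"
  shows "card P \<le> card (RP p p' P)" "card P \<le> card (CP p p' P)"
proof -
  obtain i where i: "i \<in> P" using partP_nonempty[OF assms] by auto
  note eqs = partP_eqs[OF assms i]
  have ok: "pa p > 0" "pb p > 0" "pd p > 0" "pc p > 0" "pa p' > 0" "pb p' > 0" "pd p' > 0" "pc p' > 0"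
    and N: "ncols p = nrows p'" using assms(1) by (auto simp: chain_pair_def pattern_ok_def)
  obtain r where r: "ncols p = pa p' * r * pd p" "r \<le> pb p" "r \<le> pc p'" using assms(1) unfolding chain_pair_def by blast
  have r0: "r > 0" using r(1) eqs(1) by (cases r) auto
  have "{j. supp p j i} = {j. j < pa p * pb p * pd p \<and> j div (pb p * pd p) = i div (pc p * pd p) \<and> j mod pd p = i mod pd p}"
    using eqs(1) by (auto simp: supp_def nrows_def)
  moreover have "card \<dots> = pb p"
    using ok eqs(1) by (intro card_residue_block) (auto simp: ncols_def mult.assoc less_mult_imp_div_less)
  ultimately have R: "card (RP p p' P) = pb p" using eqs(4) by simp
  have "{c. supp p' i c} = {j. j < pa p' * pc p' * pd p' \<and> j div (pc p' * pd p') = i div (pb p' * pd p') \<and> j mod pd p' = i mod pd p'}"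
    using eqs(1) N by (auto simp: supp_def ncols_def)
  moreover have "card \<dots> = pc p'"
    using ok eqs(1) N by (intro card_residue_block) (auto simp: nrows_def mult.assoc less_mult_imp_div_less)
  ultimately have C: "card (CP p p' P) = pc p'" using eqs(5) by simp
  have "ncols p div pa p' = r * pd p" using ok r by (simp add: mult.assoc)
  then have "P = {j. j < pa p' * r * pd p \<and> j div (r * pd p) = i div (r * pd p) \<and> j mod pd p = i mod pd p}"
    using eqs(3) r(1) by (auto simp: same_block_def)
  moreover have "card \<dots> = r"
    using ok eqs(1) r r0 by (intro card_residue_block) (auto simp: mult.assoc less_mult_imp_div_less)
  ultimately have "card P = r" by simp
  then show "card P \<le> card (RP p p' P)" "card P \<le> card (CP p p' P)" using R C r by auto
qed

text \<open>The rectangles \<open>R_P x P\<close> cover exactly the support of \<open>S_p\<close>,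
  and the rectangles \<open>P x C_P\<close> that of \<open>S_p'\<close>: each index lies in its own
  class, which has the same supports.\<close>

lemma block_shaped_iff:
  assumes "chain_pair p p'"
  shows "block_shaped p p' X Y \<longleftrightarrow> is_factor p X \<and> is_factor p' Y"
proof -
  have 1: "(\<exists>P\<in>partP p p'. r \<in> RP p p' P \<and> i \<in> P) \<longleftrightarrow> supp p r i" if "i < ncols p" for r i
    using partP_eqs(4)[OF assms] Ucls_self[OF assms that] by blast
  have 2: "(\<exists>P\<in>partP p p'. i \<in> P \<and> c \<in> CP p p' P) \<longleftrightarrow> supp p' i c" if "i < nrows p'" for i c
    using partP_eqs(5)[OF assms] Ucls_self[OF assms, of i] that assms unfolding chain_pair_def by (metis mem_Collect_eq)
  have n1: "(\<forall>P\<in>partP p p'. \<not> (r \<in> RP p p' P \<and> i \<in> P)) \<longleftrightarrow> \<not> supp p r i" if "i < ncols p" for r i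
    using 1[OF that, of r] by blast
  have n2: "(\<forall>P\<in>partP p p'. \<not> (i \<in> P \<and> c \<in> CP p p' P)) \<longleftrightarrow> \<not> supp p' i c" if "i < nrows p'" for i c
    using 2[OF that, of c] by blast
  show ?thesis unfolding block_shaped_def is_factor_def using n1 n2 by auto
qed

section \<open>Submatrices and products along the blocks\<close>

lemma submatrix_carrier:
  assumes "A \<in> carrier_mat m n" "I \<subseteq> {..<m}" "J \<subseteq> {..<n}"
  shows "submatrix A I J \<in> carrier_mat (card I) (card J)"
proof -
  have "{i. i < m \<and> i \<in> I} = I" "{i. i < n \<and> i \<in> J} = J" using assms by auto
  then show ?thesis using assms(1) by (intro carrier_matI) (auto simp: dim_submatrix)
qed

lemma submatrix_entry:
  assumes "A \<in> carrier_mat m n" "I \<subseteq> {..<m}" "J \<subseteq> {..<n}" "x < card I" "y < card J"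
  shows "submatrix A I J $$ (x,y) = A $$ (pick I x, pick J y)"
proof -
  have "{i. i < m \<and> i \<in> I} = I" "{i. i < n \<and> i \<in> J} = J" using assms by auto
  then show ?thesis using assms by (intro submatrix_index) auto
qed

lemma bij_betw_pick: "finite I \<Longrightarrow> bij_betw (pick I) {..<card I} I"
proof -
  assume fin: "finite I"
  have inj: "inj_on (pick I) {..<card I}"
    by (rule inj_onI) (metis card_pick_le lessThan_iff)
  moreover have "pick I ` {..<card I} \<subseteq> I" using pick_in_set_le by auto
  ultimately have "pick I ` {..<card I} = I"
    using fin by (metis card_image card_lessThan card_subset_eq)
  then show ?thesis using inj by (simp add: bij_betw_def)
qed

lemma sum_pick: "finite I \<Longrightarrow> (\<Sum>x<card I. f (pick I x)) = sum f I"
  by (rule sum.reindex_bij_betw[OF bij_betw_pick])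

lemma card_less_card: "finite I \<Longrightarrow> i \<in> I \<Longrightarrow> card {a \<in> I. a < (i::nat)} < card I"
  by (rule psubset_card_mono) auto

lemma frob_submatrix_sq:
  assumes "A \<in> carrier_mat m n" "I \<subseteq> {..<m}" "J \<subseteq> {..<n}"
  shows "(frob (submatrix A I J))\<^sup>2 = (\<Sum>r\<in>I. \<Sum>c\<in>J. (cmod (A $$ (r,c)))\<^sup>2)"
proof -
  have fin: "finite I" "finite J" using assms finite_subset by blast+
  have "(frob (submatrix A I J))\<^sup>2 = (\<Sum>x<card I. \<Sum>y<card J. (cmod (A $$ (pick I x, pick J y)))\<^sup>2)"
    unfolding frob_sq[OF submatrix_carrier[OF assms]] by (intro sum.cong refl) (simp add: submatrix_entry[OF assms])
  also have "\<dots> = (\<Sum>x<card I. \<Sum>c\<in>J. (cmod (A $$ (pick I x, c)))\<^sup>2)"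
    by (intro sum.cong refl sum_pick fin)
  also have "\<dots> = (\<Sum>r\<in>I. \<Sum>c\<in>J. (cmod (A $$ (r,c)))\<^sup>2)"
    by (rule sum_pick[OF fin(1)])
  finally show ?thesis .
qed

lemma submatrix_minus:
  fixes A B :: "complex mat"
  assumes "A \<in> carrier_mat m n" "B \<in> carrier_mat m n" "I \<subseteq> {..<m}" "J \<subseteq> {..<n}"
  shows "submatrix (A - B) I J = submatrix A I J - submatrix B I J"
proof (rule eq_matI)
  have AB: "A - B \<in> carrier_mat m n" using assms by auto
  note c = submatrix_carrier[OF assms(1,3,4)] submatrix_carrier[OF assms(2,3,4)] submatrix_carrier[OF AB assms(3,4)]
  show "dim_row (submatrix (A - B) I J) = dim_row (submatrix A I J - submatrix B I J)"
    "dim_col (submatrix (A - B) I J) = dim_col (submatrix A I J - submatrix B I J)" using c by auto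
  fix x y assume "x < dim_row (submatrix A I J - submatrix B I J)" "y < dim_col (submatrix A I J - submatrix B I J)"
  then have xy: "x < card I" "y < card J" using c by auto
  have "pick I x < m" "pick J y < n" using pick_in_set_le xy assms by blast+
  then show "submatrix (A - B) I J $$ (x,y) = (submatrix A I J - submatrix B I J) $$ (x,y)"
    using c xy submatrix_entry[OF assms(1,3,4) xy] submatrix_entry[OF assms(2,3,4) xy] submatrix_entry[OF AB assms(3,4) xy]
      assms by simp
qed

text \<open>A contributing index shares the row \<open>r\<close> and the column \<open>c\<close>
  with a member of \<open>P\<close>, hence belongs to \<open>P\<close>.\<close>

lemma mult_entry_block:
  assumes cp: "chain_pair p p'" and X: "is_factor p X" and Y: "is_factor p' Y"
    and P: "P \<in> partP p p'" and r: "r \<in> RP p p' P" and c: "c \<in> CP p p' P"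
  shows "(X * Y) $$ (r,c) = (\<Sum>i\<in>P. X $$ (r,i) * Y $$ (i,c))"
proof -
  have cX: "X \<in> carrier_mat (nrows p) (ncols p)" and cY: "Y \<in> carrier_mat (ncols p) (ncols p')"
    using X Y cp by (auto simp: is_factor_iff chain_pair_def)
  have rc: "r < nrows p" "c < ncols p'" using partP_subsets[OF cp P] r c by auto
  have "(\<Sum>i<ncols p. X $$ (r,i) * Y $$ (i,c)) = (\<Sum>i\<in>P. X $$ (r,i) * Y $$ (i,c))"
  proof (rule sum.mono_neutral_right)
    show "\<forall>i\<in>{..<ncols p} - P. X $$ (r,i) * Y $$ (i,c) = 0"
    proof (rule ballI, rule ccontr)
      fix i assume i: "i \<in> {..<ncols p} - P" and nz: "X $$ (r,i) * Y $$ (i,c) \<noteq> 0"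
      obtain j where j: "j \<in> P" using partP_nonempty[OF cp P] by auto
      note eqs = partP_eqs[OF cp P j]
      have "supp p r i" "supp p' i c"
        using nz i rc X Y cX cY supportedD[of "supp p" X "nrows p" "ncols p" r i] supportedD[of "supp p'" Y "ncols p" "ncols p'" i c]
        by (auto simp: is_factor_iff)
      then have "same_block p p' j i" using supp_imp_same_block[OF cp] r c eqs(4,5) by auto
      then show False using i eqs(3) by auto
    qed
  qed (use partP_subsets[OF cp P] in auto)
  then show ?thesis by (simp add: mult_mat_entry[OF cX cY rc] del: index_mult_mat)
qed

lemma mult_entry_outside:
  assumes cp: "chain_pair p p'" and X: "is_factor p X" and Y: "is_factor p' Y"
    and rc: "r < nrows p" "c < ncols p'" and out: "\<And>P. P \<in> partP p p' \<Longrightarrow> r \<in> RP p p' P \<Longrightarrow> c \<in> CP p p' P \<Longrightarrow> False"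
  shows "(X * Y) $$ (r,c) = 0"
proof -
  have cX: "X \<in> carrier_mat (nrows p) (ncols p)" and cY: "Y \<in> carrier_mat (ncols p) (ncols p')"
    using X Y cp by (auto simp: is_factor_iff chain_pair_def)
  have "X $$ (r,i) * Y $$ (i,c) = 0" if i: "i < ncols p" for i
  proof (rule ccontr)
    assume nz: "X $$ (r,i) * Y $$ (i,c) \<noteq> 0"
    have "supp p r i" "supp p' i c"
      using nz i rc X Y cX cY supportedD[of "supp p" X "nrows p" "ncols p" r i] supportedD[of "supp p'" Y "ncols p" "ncols p'" i c]
      by (auto simp: is_factor_iff)
    then show False
      using out[OF Ucls_self(2)[OF cp i]] partP_eqs(4,5)[OF cp Ucls_self(2,1)[OF cp i]] by auto
  qed
  then show ?thesis unfolding mult_mat_entry[OF cX cY rc] by (intro sum.neutral) auto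
qed

lemma submatrix_mult_block:
  assumes cp: "chain_pair p p'" and X: "is_factor p X" and Y: "is_factor p' Y" and P: "P \<in> partP p p'"
  shows "submatrix (X * Y) (RP p p' P) (CP p p' P) = submatrix X (RP p p' P) P * submatrix Y P (CP p p' P)"
    (is "?l = ?a * ?b")
proof -
  have cX: "X \<in> carrier_mat (nrows p) (ncols p)" and cY: "Y \<in> carrier_mat (ncols p) (ncols p')"
    using X Y cp by (auto simp: is_factor_iff chain_pair_def)
  have cXY: "X * Y \<in> carrier_mat (nrows p) (ncols p')" using cX cY by auto
  note sub = partP_subsets[OF cp P]
  have finP: "finite P" using sub(1) finite_subset by blast
  have cl: "?l \<in> carrier_mat (card (RP p p' P)) (card (CP p p' P))" by (rule submatrix_carrier[OF cXY sub(3,4)])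
  have ca: "?a \<in> carrier_mat (card (RP p p' P)) (card P)" by (rule submatrix_carrier[OF cX sub(3,1)])
  have cb: "?b \<in> carrier_mat (card P) (card (CP p p' P))" by (rule submatrix_carrier[OF cY sub(1,4)])
  show ?thesis
  proof (rule eq_matI)
    fix x y assume "x < dim_row (?a * ?b)" "y < dim_col (?a * ?b)"
    then have xy: "x < card (RP p p' P)" "y < card (CP p p' P)" using ca cb by auto
    have "?l $$ (x,y) = (\<Sum>i\<in>P. X $$ (pick (RP p p' P) x,i) * Y $$ (i, pick (CP p p' P) y))"
      unfolding submatrix_entry[OF cXY sub(3,4) xy]
      by (rule mult_entry_block[OF cp X Y P]) (use pick_in_set_le xy in auto)
    also have "\<dots> = (\<Sum>l<card P. X $$ (pick (RP p p' P) x, pick P l) * Y $$ (pick P l, pick (CP p p' P) y))"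
      by (rule sum_pick[OF finP, symmetric])
    also have "\<dots> = (\<Sum>l<card P. ?a $$ (x,l) * ?b $$ (l,y))"
      by (intro sum.cong refl) (simp add: submatrix_entry[OF cX sub(3,1) xy(1)] submatrix_entry[OF cY sub(1,4) _ xy(2)])
    also have "\<dots> = (?a * ?b) $$ (x,y)" by (rule mult_mat_entry[OF ca cb xy, symmetric])
    finally show "?l $$ (x,y) = (?a * ?b) $$ (x,y)" .
  qed (use cl ca cb in auto)
qed

lemma mult_eq_if_blocks_eq:
  assumes cp: "chain_pair p p'" and X: "is_factor p X" "is_factor p X'" and Y: "is_factor p' Y" "is_factor p' Y'"
    and eq: "\<And>P. P \<in> partP p p' \<Longrightarrow> submatrix X (RP p p' P) P * submatrix Y P (CP p p' P)
      = submatrix X' (RP p p' P) P * submatrix Y' P (CP p p' P)"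
  shows "X * Y = X' * Y'"
proof -
  have c: "X * Y \<in> carrier_mat (nrows p) (ncols p')" "X' * Y' \<in> carrier_mat (nrows p) (ncols p')"
    using X Y cp by (auto simp: is_factor_iff chain_pair_def)
  show ?thesis
  proof (rule eq_matI)
    fix r e assume "r < dim_row (X' * Y')" "e < dim_col (X' * Y')"
    then have re: "r < nrows p" "e < ncols p'" using c(2) by auto
    show "(X * Y) $$ (r,e) = (X' * Y') $$ (r,e)"
    proof (cases "\<exists>P\<in>partP p p'. r \<in> RP p p' P \<and> e \<in> CP p p' P")
      case True
      then obtain P where P: "P \<in> partP p p'" "r \<in> RP p p' P" "e \<in> CP p p' P" by blast
      have sub: "submatrix (X * Y) (RP p p' P) (CP p p' P) = submatrix (X' * Y') (RP p p' P) (CP p p' P)"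
        unfolding submatrix_mult_block[OF cp X(1) Y(1) P(1)] submatrix_mult_block[OF cp X(2) Y(2) P(1)] by (rule eq[OF P(1)])
      have d: "r < dim_row (X * Y)" "e < dim_col (X * Y)" "r < dim_row (X' * Y')" "e < dim_col (X' * Y')"
        using c re by auto
      show ?thesis
        using submatrix_index_card[OF d(1,2) P(2,3)] submatrix_index_card[OF d(3,4) P(2,3)] sub by simp
    next
      case False
      then show ?thesis
        using mult_entry_outside[OF cp X(1) Y(1) re] mult_entry_outside[OF cp X(2) Y(2) re] by auto
    qed
  qed (simp_all only: carrier_matD[OF c(1)] carrier_matD[OF c(2)])
qed

text \<open>The second sum runs over the entries outside all rectangles. Products of factors vanish
  there, so it is an error common to all candidates.\<close>

lemma frob_sq_blocks:
  assumes cp: "chain_pair p p'" and M: "M \<in> carrier_mat (nrows p) (ncols p')"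
  shows "(frob M)\<^sup>2 = (\<Sum>P\<in>partP p p'. (frob (submatrix M (RP p p' P) (CP p p' P)))\<^sup>2) +
    (\<Sum>(r,c)\<in>{..<nrows p} \<times> {..<ncols p'} - (\<Union>P\<in>partP p p'. RP p p' P \<times> CP p p' P). (cmod (M $$ (r,c)))\<^sup>2)"
proof -
  let ?T = "{..<nrows p} \<times> {..<ncols p'}" and ?B = "\<Union>P\<in>partP p p'. RP p p' P \<times> CP p p' P"
  let ?f = "\<lambda>(r,c). (cmod (M $$ (r,c)))\<^sup>2"
  have BT: "?B \<subseteq> ?T" using partP_subsets[OF cp] by fast
  have fin: "finite (RP p p' P \<times> CP p p' P)" if "P \<in> partP p p'" for P
    using partP_subsets(3,4)[OF cp that] finite_subset by blast
  have "(frob M)\<^sup>2 = sum ?f ?T" unfolding frob_sq[OF M] by (simp add: sum.cartesian_product)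
  also have "\<dots> = sum ?f ?B + sum ?f (?T - ?B)"
    using sum.subset_diff[OF BT, of ?f] by (simp add: add.commute)
  also have "sum ?f ?B = (\<Sum>P\<in>partP p p'. sum ?f (RP p p' P \<times> CP p p' P))"
    by (rule sum.UNION_disjoint[OF finite_partP]) (use fin partP_disjoint[OF cp] in blast)+
  also have "\<dots> = (\<Sum>P\<in>partP p p'. (frob (submatrix M (RP p p' P) (CP p p' P)))\<^sup>2)"
    by (intro sum.cong refl) (simp add: frob_submatrix_sq[OF M partP_subsets(3,4)[OF cp]] sum.cartesian_product)
  finally show ?thesis .
qed

text \<open>The blocks have disjoint rectangles and independent entries, so the block problems
  decouple and their minima add up; outside the rectangles all candidates agree.\<close>

lemma two_factor_optimal:
  assumes cp: "chain_pair p p'" and M: "M \<in> carrier_mat (nrows p) (ncols p')" and tf: "two_factor M p p' X Y"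
    and X': "is_factor p X'" and Y': "is_factor p' Y'"
  shows "frob (M - X * Y) \<le> frob (M - X' * Y')"
proof -
  have XY: "is_factor p X" "is_factor p' Y" using tf block_shaped_iff[OF cp] by (auto simp: two_factor_def)
  have cXY: "U * V \<in> carrier_mat (nrows p) (ncols p')" if "is_factor p U" "is_factor p' V" for U V
    using that cp by (auto simp: is_factor_iff chain_pair_def)
  have cM: "M - U * V \<in> carrier_mat (nrows p) (ncols p')" if "is_factor p U" "is_factor p' V" for U V
    by (rule minus_carrier_mat[OF cXY[OF that]])
  have block: "submatrix (M - U * V) (RP p p' P) (CP p p' P) =
      submatrix M (RP p p' P) (CP p p' P) - submatrix U (RP p p' P) P * submatrix V P (CP p p' P)"
    if "is_factor p U" "is_factor p' V" "P \<in> partP p p'" for U V P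
    using submatrix_minus[OF M cXY[OF that(1,2)] partP_subsets(3,4)[OF cp that(3)]] submatrix_mult_block[OF cp that] by simp
  let ?D = "{..<nrows p} \<times> {..<ncols p'} - (\<Union>P\<in>partP p p'. RP p p' P \<times> CP p p' P)"
  have out: "(\<Sum>(r,c)\<in>?D. (cmod ((M - U * V) $$ (r,c)))\<^sup>2) = (\<Sum>(r,c)\<in>?D. (cmod (M $$ (r,c)))\<^sup>2)"
    if UV: "is_factor p U" "is_factor p' V" for U V
  proof -
    have e: "(M - U * V) $$ (r,c) = M $$ (r,c)" if rc: "(r,c) \<in> ?D" for r c
    proof -
      have "(U * V) $$ (r,c) = 0"
        by (rule mult_entry_outside[OF cp UV]) (use rc in auto)
      moreover have "(M - U * V) $$ (r,c) = M $$ (r,c) - (U * V) $$ (r,c)"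
        by (rule index_minus_mat) (use cXY[OF UV] rc in auto)
      ultimately show ?thesis by simp
    qed
    show ?thesis by (rule sum.cong[OF refl]) (simp only: split_paired_all prod.case e)
  qed
  have le: "(frob (submatrix (M - X * Y) (RP p p' P) (CP p p' P)))\<^sup>2 \<le> (frob (submatrix (M - X' * Y') (RP p p' P) (CP p p' P)))\<^sup>2"
    if P: "P \<in> partP p p'" for P
  proof -
    have "submatrix X' (RP p p' P) P \<in> carrier_mat (card (RP p p' P)) (card P)"
      by (rule submatrix_carrier[OF _ partP_subsets(3,1)[OF cp P]]) (use X' in \<open>auto simp: is_factor_iff\<close>)
    moreover have "submatrix Y' P (CP p p' P) \<in> carrier_mat (card P) (card (CP p p' P))"
      by (rule submatrix_carrier[OF _ partP_subsets(2,4)[OF cp P]]) (use Y' in \<open>auto simp: is_factor_iff\<close>)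
    ultimately show ?thesis
      unfolding block[OF XY P] block[OF X' Y' P] using tf P by (intro power_mono) (auto simp: two_factor_def)
  qed
  have "(frob (M - X * Y))\<^sup>2 \<le> (frob (M - X' * Y'))\<^sup>2"
    unfolding frob_sq_blocks[OF cp cM[OF XY]] frob_sq_blocks[OF cp cM[OF X' Y']] out[OF XY] out[OF X' Y']
    by (intro add_right_mono sum_mono le)
  then show ?thesis by (rule power2_le_imp_le) simp
qed

lemma two_factor_factors:
  "chain_pair p p' \<Longrightarrow> two_factor M p p' X Y \<Longrightarrow> is_factor p X \<and> is_factor p' Y"
  using block_shaped_iff by (auto simp: two_factor_def)

section \<open>Existence of TwoFactor and Ortho results from prescribed blocks\<close>

lemma assemble_blocks:
  assumes cp: "chain_pair p p'"
    and H: "\<And>P. P \<in> partP p p' \<Longrightarrow> H P \<in> carrier_mat (card (RP p p' P)) (card P)"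
    and K: "\<And>P. P \<in> partP p p' \<Longrightarrow> K P \<in> carrier_mat (card P) (card (CP p p' P))"
  obtains X Y where "block_shaped p p' X Y"
    "\<And>P. P \<in> partP p p' \<Longrightarrow> submatrix X (RP p p' P) P = H P"
    "\<And>P. P \<in> partP p p' \<Longrightarrow> submatrix Y P (CP p p' P) = K P"
proof
  \<comment> \<open>Counting the smaller members inverts \<open>pick\<close>: each entry is read at
    the rank of its indices inside its own block.\<close>
  define X where "X = mat (nrows p) (ncols p) (\<lambda>(r,i). if supp p r i
    then H (Ucls p p' i) $$ (card {a \<in> RP p p' (Ucls p p' i). a < r}, card {a \<in> Ucls p p' i. a < i}) else 0)"
  define Y where "Y = mat (nrows p') (ncols p') (\<lambda>(i,c). if supp p' i c
    then K (Ucls p p' i) $$ (card {a \<in> Ucls p p' i. a < i}, card {a \<in> CP p p' (Ucls p p' i). a < c}) else 0)"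
  have cX: "X \<in> carrier_mat (nrows p) (ncols p)" and cY: "Y \<in> carrier_mat (nrows p') (ncols p')"
    by (auto simp: X_def Y_def)
  show "block_shaped p p' X Y"
    unfolding block_shaped_iff[OF cp] by (auto simp: is_factor_def X_def Y_def)
  fix P assume P: "P \<in> partP p p'"
  note sub = partP_subsets[OF cp P]
  show "submatrix X (RP p p' P) P = H P"
  proof (rule eq_matI)
    fix x y assume "x < dim_row (H P)" "y < dim_col (H P)"
    then have xy: "x < card (RP p p' P)" "y < card P" using H[OF P] by auto
    have in_P: "pick (RP p p' P) x \<in> RP p p' P" "pick P y \<in> P" using pick_in_set_le xy by auto
    note eqs = partP_eqs[OF cp P in_P(2)]
    have "supp p (pick (RP p p' P) x) (pick P y)" using in_P(1) eqs(4) by blast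
    then show "submatrix X (RP p p' P) P $$ (x,y) = H P $$ (x,y)"
      unfolding submatrix_entry[OF cX sub(3,1) xy]
      using supp_bounds[of p "pick (RP p p' P) x" "pick P y"] card_pick_le[OF xy(1)] card_pick_le[OF xy(2)]
      by (simp add: X_def eqs(2)[symmetric])
  qed (use submatrix_carrier[OF cX sub(3,1)] H[OF P] in auto)
  show "submatrix Y P (CP p p' P) = K P"
  proof (rule eq_matI)
    fix y x assume "y < dim_row (K P)" "x < dim_col (K P)"
    then have xy: "x < card (CP p p' P)" "y < card P" using K[OF P] by auto
    have in_P: "pick (CP p p' P) x \<in> CP p p' P" "pick P y \<in> P" using pick_in_set_le xy by auto
    note eqs = partP_eqs[OF cp P in_P(2)]
    have "supp p' (pick P y) (pick (CP p p' P) x)" using in_P(1) eqs(5) by blast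
    then show "submatrix Y P (CP p p' P) $$ (y,x) = K P $$ (y,x)"
      unfolding submatrix_entry[OF cY sub(2,4) xy(2,1)]
      using supp_bounds[of p' "pick P y" "pick (CP p p' P) x"] card_pick_le[OF xy(1)] card_pick_le[OF xy(2)]
      by (simp add: Y_def eqs(2)[symmetric])
  qed (use submatrix_carrier[OF cY sub(2,4)] K[OF P] in auto)
qed

lemma two_factor_exists:
  assumes cp: "chain_pair p p'" and M: "M \<in> carrier_mat (nrows p) (ncols p')"
  shows "\<exists>X Y. two_factor M p p' X Y"
proof -
  define good where "good P H K \<longleftrightarrow> H \<in> carrier_mat (card (RP p p' P)) (card P) \<and> K \<in> carrier_mat (card P) (card (CP p p' P)) \<and>
    (\<forall>H' K'. H' \<in> carrier_mat (card (RP p p' P)) (card P) \<longrightarrow> K' \<in> carrier_mat (card P) (card (CP p p' P)) \<longrightarrow>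
      frob (submatrix M (RP p p' P) (CP p p' P) - H * K) \<le> frob (submatrix M (RP p p' P) (CP p p' P) - H' * K'))" for P H K
  have "\<exists>H K. good P H K" if P: "P \<in> partP p p'" for P
  proof -
    have "submatrix M (RP p p' P) (CP p p' P) \<in> carrier_mat (card (RP p p' P)) (card (CP p p' P))"
      by (rule submatrix_carrier[OF M partP_subsets(3,4)[OF cp P]])
    from best_rank_approximation_exists[OF this partP_cards(1)[OF cp P]] obtain H K
      where "H \<in> carrier_mat (card (RP p p' P)) (card P)" "K \<in> carrier_mat (card P) (card (CP p p' P))"
        "\<And>H' K'. H' \<in> carrier_mat (card (RP p p' P)) (card P) \<Longrightarrow> K' \<in> carrier_mat (card P) (card (CP p p' P)) \<Longrightarrow>
      frob (submatrix M (RP p p' P) (CP p p' P) - H * K) \<le> frob (submatrix M (RP p p' P) (CP p p' P) - H' * K')"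
      by metis
    then show ?thesis unfolding good_def by blast
  qed
  then obtain H K where HK: "\<And>P. P \<in> partP p p' \<Longrightarrow> good P (H P) (K P)" by metis
  have c: "H P \<in> carrier_mat (card (RP p p' P)) (card P)" "K P \<in> carrier_mat (card P) (card (CP p p' P))"
    if "P \<in> partP p p'" for P using HK[OF that] by (auto simp: good_def)
  obtain X Y where XY: "block_shaped p p' X Y" "\<And>P. P \<in> partP p p' \<Longrightarrow> submatrix X (RP p p' P) P = H P"
    "\<And>P. P \<in> partP p p' \<Longrightarrow> submatrix Y P (CP p p' P) = K P"
    using assemble_blocks[where H = H and K = K, OF cp c] by blast
  have "two_factor M p p' X Y" unfolding two_factor_def
  proof (intro conjI ballI XY(1))
    fix P assume P: "P \<in> partP p p'"
    show "\<forall>H' K'. H' \<in> carrier_mat (card (RP p p' P)) (card P) \<longrightarrow> K' \<in> carrier_mat (card P) (card (CP p p' P)) \<longrightarrow>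
      frob (submatrix M (RP p p' P) (CP p p' P) - submatrix X (RP p p' P) P * submatrix Y P (CP p p' P))
       \<le> frob (submatrix M (RP p p' P) (CP p p' P) - H' * K')"
      using HK[OF P] unfolding XY(2)[OF P] XY(3)[OF P] good_def by blast
  qed
  then show ?thesis by blast
qed

lemma ortho_exists:
  assumes cp: "chain_pair p p'" and X: "X \<in> carrier_mat (nrows p) (ncols p)" and Y: "Y \<in> carrier_mat (nrows p') (ncols p')"
  shows "\<exists>X' Y'. ortho p p' X Y u X' Y'"
proof -
  have cX: "submatrix X (RP p p' P) P \<in> carrier_mat (card (RP p p' P)) (card P)" if "P \<in> partP p p'" for P
    by (rule submatrix_carrier[OF X partP_subsets(3,1)[OF cp that]])
  have cY: "submatrix Y P (CP p p' P) \<in> carrier_mat (card P) (card (CP p p' P))" if "P \<in> partP p p'" for P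
    by (rule submatrix_carrier[OF Y partP_subsets(2,4)[OF cp that]])
  show ?thesis
  proof (cases u)
    case Column
    have "\<exists>Q R. is_QR (submatrix X (RP p p' P) P) Q R" if P: "P \<in> partP p p'" for P
      using QR_exists[of "submatrix X (RP p p' P) P"] cX[OF P] partP_cards(1)[OF cp P] by (metis carrier_matD)
    then obtain Q R where QR: "\<And>P. P \<in> partP p p' \<Longrightarrow> is_QR (submatrix X (RP p p' P) P) (Q P) (R P)" by metis
    have c: "Q P \<in> carrier_mat (card (RP p p' P)) (card P)" "R P * submatrix Y P (CP p p' P) \<in> carrier_mat (card P) (card (CP p p' P))"
      if P: "P \<in> partP p p'" for P
      using QR[OF P] cX[OF P] cY[OF P] unfolding is_QR_def by (metis carrier_matD mult_carrier_mat)+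
    obtain X' Y' where XY: "block_shaped p p' X' Y'" "\<And>P. P \<in> partP p p' \<Longrightarrow> submatrix X' (RP p p' P) P = Q P"
      "\<And>P. P \<in> partP p p' \<Longrightarrow> submatrix Y' P (CP p p' P) = R P * submatrix Y P (CP p p' P)"
      using assemble_blocks[where H = Q and K = "\<lambda>P. R P * submatrix Y P (CP p p' P)", OF cp c] by blast
    then have "ortho p p' X Y u X' Y'" unfolding ortho_def Column using QR by auto
    then show ?thesis by blast
  next
    case Row
    have "\<exists>Q R. is_QR (transpose_mat (submatrix Y P (CP p p' P))) Q R" if P: "P \<in> partP p p'" for P
      using QR_exists[of "transpose_mat (submatrix Y P (CP p p' P))"] cY[OF P] partP_cards(2)[OF cp P]
      by (metis carrier_matD index_transpose_mat(2,3))
    then obtain Q R where QR: "\<And>P. P \<in> partP p p' \<Longrightarrow> is_QR (transpose_mat (submatrix Y P (CP p p' P))) (Q P) (R P)" by metis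
    have c0: "Q P \<in> carrier_mat (card (CP p p' P)) (card P)" "R P \<in> carrier_mat (card P) (card P)"
      if P: "P \<in> partP p p'" for P
      using QR[OF P] cY[OF P] unfolding is_QR_def by (metis carrier_matD index_transpose_mat(2,3))+
    have c: "submatrix X (RP p p' P) P * transpose_mat (R P) \<in> carrier_mat (card (RP p p' P)) (card P)"
      "transpose_mat (Q P) \<in> carrier_mat (card P) (card (CP p p' P))"
      if P: "P \<in> partP p p'" for P
      using c0[OF P] cX[OF P] by auto
    obtain X' Y' where XY: "block_shaped p p' X' Y'"
      "\<And>P. P \<in> partP p p' \<Longrightarrow> submatrix X' (RP p p' P) P = submatrix X (RP p p' P) P * transpose_mat (R P)"
      "\<And>P. P \<in> partP p p' \<Longrightarrow> submatrix Y' P (CP p p' P) = transpose_mat (Q P)"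
      using assemble_blocks[where H = "\<lambda>P. submatrix X (RP p p' P) P * transpose_mat (R P)" and K = "\<lambda>P. transpose_mat (Q P)", OF cp c] by blast
    then have "ortho p p' X Y u X' Y'" unfolding ortho_def Row using QR by auto
    then show ?thesis by blast
  qed
qed

section \<open>Products and Gram matrices after Ortho\<close>

lemma ortho_factors:
  "chain_pair p p' \<Longrightarrow> ortho p p' X Y u X' Y' \<Longrightarrow> is_factor p X' \<and> is_factor p' Y'"
  using block_shaped_iff by (auto simp: ortho_def)

text \<open>On each block the triangular factor only changes sides: \<open>Q * R\<close> is
  reassociated with the other factor, in row mode after transposition.\<close>

lemma ortho_mult:
  assumes cp: "chain_pair p p'" and X: "is_factor p X" and Y: "is_factor p' Y" and o: "ortho p p' X Y u X' Y'"
  shows "X' * Y' = X * Y"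
proof (rule mult_eq_if_blocks_eq[OF cp])
  fix P assume P: "P \<in> partP p p'"
  note sub = partP_subsets[OF cp P]
  have cX: "submatrix X (RP p p' P) P \<in> carrier_mat (card (RP p p' P)) (card P)"
    by (rule submatrix_carrier[OF _ sub(3,1)]) (use X in \<open>auto simp: is_factor_iff\<close>)
  have cY: "submatrix Y P (CP p p' P) \<in> carrier_mat (card P) (card (CP p p' P))"
    by (rule submatrix_carrier[OF _ sub(2,4)]) (use Y in \<open>auto simp: is_factor_iff\<close>)
  show "submatrix X' (RP p p' P) P * submatrix Y' P (CP p p' P) = submatrix X (RP p p' P) P * submatrix Y P (CP p p' P)"
  proof (cases u)
    case Column
    then obtain Q R where QR: "is_QR (submatrix X (RP p p' P) P) Q R" "submatrix X' (RP p p' P) P = Q"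
      "submatrix Y' P (CP p p' P) = R * submatrix Y P (CP p p' P)" using o P unfolding ortho_def by auto
    have c: "Q \<in> carrier_mat (card (RP p p' P)) (card P)" "R \<in> carrier_mat (card P) (card P)" "submatrix X (RP p p' P) P = Q * R"
      using QR(1) unfolding is_QR_def carrier_matD[OF cX] by blast+
    show ?thesis unfolding QR(2,3) c(3) by (rule assoc_mult_mat[OF c(1,2) cY, symmetric])
  next
    case Row
    then obtain Q R where QR: "is_QR (transpose_mat (submatrix Y P (CP p p' P))) Q R"
      "submatrix X' (RP p p' P) P = submatrix X (RP p p' P) P * transpose_mat R"
      "submatrix Y' P (CP p p' P) = transpose_mat Q" using o P unfolding ortho_def by auto
    have c: "Q \<in> carrier_mat (card (CP p p' P)) (card P)" "R \<in> carrier_mat (card P) (card P)"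
      "transpose_mat (submatrix Y P (CP p p' P)) = Q * R"
      using QR(1) unfolding is_QR_def index_transpose_mat carrier_matD[OF cY] by blast+
    have "submatrix Y P (CP p p' P) = transpose_mat (Q * R)" using c(3) by (metis transpose_transpose)
    then have e: "submatrix Y P (CP p p' P) = transpose_mat R * transpose_mat Q" using transpose_mult[OF c(1,2)] by simp
    show ?thesis unfolding QR(2,3) e by (rule assoc_mult_mat[OF cX]) (use c in auto)
  qed
qed (use X Y ortho_factors[OF cp o] in auto)

text \<open>Column \<open>i\<close> vanishes outside the rows \<open>I\<close>, so the Gram entry is
  already that of the block.\<close>

lemma block_gram_entry:
  assumes I: "I \<subseteq> {..<m}" and P: "P \<subseteq> {..<n}" and F: "F \<in> carrier_mat m n" and ik: "i \<in> P" "k \<in> P"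
    and z: "\<And>r. r < m \<Longrightarrow> r \<notin> I \<Longrightarrow> F $$ (r,i) = 0"
    and Q: "ctrans (submatrix F I P) * submatrix F I P = 1\<^sub>m (card P)"
  shows "(ctrans F * F) $$ (i,k) = (if i = k then 1 else 0)"
proof -
  have fin: "finite I" "finite P" using I P finite_subset by blast+
  let ?Q = "submatrix F I P" and ?i = "card {a \<in> P. a < i}" and ?k = "card {a \<in> P. a < k}"
  have cQ: "?Q \<in> carrier_mat (card I) (card P)" by (rule submatrix_carrier[OF F I P])
  have lt: "?i < card P" "?k < card P" using card_less_card[OF fin(2)] ik by auto
  have pick: "pick P ?i = i" "pick P ?k = k" using pick_card_in_set ik by auto
  have ikn: "i < n" "k < n" using ik P by auto
  have "(ctrans F * F) $$ (i,k) = (\<Sum>r<m. cnj (F $$ (r,i)) * F $$ (r,k))"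
    by (rule ctrans_mult_entry[OF F F ikn])
  also have "\<dots> = (\<Sum>r\<in>I. cnj (F $$ (r,i)) * F $$ (r,k))"
    by (rule sum.mono_neutral_right) (use I z in auto)
  also have "\<dots> = (\<Sum>x<card I. cnj (F $$ (pick I x,i)) * F $$ (pick I x,k))"
    by (rule sum_pick[OF fin(1), symmetric])
  also have "\<dots> = (\<Sum>x<card I. cnj (?Q $$ (x,?i)) * ?Q $$ (x,?k))"
    by (intro sum.cong refl) (simp add: submatrix_entry[OF F I P _ lt(1)] submatrix_entry[OF F I P _ lt(2)] pick)
  also have "\<dots> = (ctrans ?Q * ?Q) $$ (?i,?k)" by (rule ctrans_mult_entry[OF cQ cQ lt, symmetric])
  also have "\<dots> = (if ?i = ?k then 1 else 0)" unfolding Q using lt by simp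
  also have "?i = ?k \<longleftrightarrow> i = k" using pick by metis
  finally show ?thesis .
qed

lemma transpose_submatrix:
  assumes "A \<in> carrier_mat m n" "I \<subseteq> {..<m}" "J \<subseteq> {..<n}"
  shows "submatrix (transpose_mat A) J I = transpose_mat (submatrix A I J)"
proof (rule eq_matI)
  have c: "submatrix (transpose_mat A) J I \<in> carrier_mat (card J) (card I)"
    by (rule submatrix_carrier[OF _ assms(3,2)]) (use assms in auto)
  note c' = submatrix_carrier[OF assms]
  show "dim_row (submatrix (transpose_mat A) J I) = dim_row (transpose_mat (submatrix A I J))"
    "dim_col (submatrix (transpose_mat A) J I) = dim_col (transpose_mat (submatrix A I J))" using c c' by auto
  fix x y assume "x < dim_row (transpose_mat (submatrix A I J))" "y < dim_col (transpose_mat (submatrix A I J))"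
  then have xy: "x < card J" "y < card I" using c' by auto
  have cT: "transpose_mat A \<in> carrier_mat n m" using assms by auto
  have "pick I y < m" "pick J x < n" using pick_in_set_le xy assms by blast+
  then show "submatrix (transpose_mat A) J I $$ (x,y) = transpose_mat (submatrix A I J) $$ (x,y)"
    unfolding submatrix_entry[OF cT assms(3,2) xy] using c' xy assms(1) submatrix_entry[OF assms xy(2,1)] by simp
qed

lemma ortho_col_orth:
  assumes cp: "chain_pair p p'" and o: "ortho p p' X Y Column X' Y'" and X: "X \<in> carrier_mat (nrows p) (ncols p)"
  shows "col_orth (same_block p p') X'"
  unfolding col_orth_def
proof (intro allI impI)
  have X': "is_factor p X'" using ortho_factors[OF cp o] by simp
  then have cX': "X' \<in> carrier_mat (nrows p) (ncols p)" by (simp add: is_factor_iff)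
  fix i k assume "i < dim_col X'" "k < dim_col X'" and s: "same_block p p' i k"
  then have ik: "i < ncols p" "k < ncols p" using cX' by auto
  define P where "P = Ucls p p' i"
  have P: "P \<in> partP p p'" "i \<in> P" using Ucls_self[OF cp ik(1)] by (auto simp: P_def)
  have kP: "k \<in> P" using s ik by (simp add: P_def Ucls_eq[OF cp ik(1)])
  note sub = partP_subsets[OF cp P(1)] and eqs = partP_eqs[OF cp P]
  have cX: "submatrix X (RP p p' P) P \<in> carrier_mat (card (RP p p' P)) (card P)" by (rule submatrix_carrier[OF X sub(3,1)])
  obtain Q R where QR: "is_QR (submatrix X (RP p p' P) P) Q R" "submatrix X' (RP p p' P) P = Q"
    using o P(1) unfolding ortho_def by auto
  show "(ctrans X' * X') $$ (i,k) = (if i = k then 1 else 0)"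
  proof (rule block_gram_entry[OF sub(3,1) cX' P(2) kP])
    show "ctrans (submatrix X' (RP p p' P) P) * submatrix X' (RP p p' P) P = 1\<^sub>m (card P)"
      using QR unfolding is_QR_def carrier_matD[OF cX] by blast
    fix r assume "r < nrows p" "r \<notin> RP p p' P"
    then show "X' $$ (r,i) = 0" using X' ik eqs(4) by (auto simp: is_factor_def)
  qed
qed

lemma ortho_row_orth:
  assumes cp: "chain_pair p p'" and o: "ortho p p' X Y Row X' Y'" and Y: "Y \<in> carrier_mat (nrows p') (ncols p')"
  shows "col_orth (same_block p p') (transpose_mat Y')"
  unfolding col_orth_def
proof (intro allI impI)
  have Y': "is_factor p' Y'" using ortho_factors[OF cp o] by simp
  then have cY': "Y' \<in> carrier_mat (nrows p') (ncols p')" by (simp add: is_factor_iff)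
  have N: "ncols p = nrows p'" using cp by (simp add: chain_pair_def)
  fix i k assume "i < dim_col (transpose_mat Y')" "k < dim_col (transpose_mat Y')" and s: "same_block p p' i k"
  then have ik: "i < ncols p" "k < ncols p" using cY' N by auto
  define P where "P = Ucls p p' i"
  have P: "P \<in> partP p p'" "i \<in> P" using Ucls_self[OF cp ik(1)] by (auto simp: P_def)
  have kP: "k \<in> P" using s ik by (simp add: P_def Ucls_eq[OF cp ik(1)])
  note sub = partP_subsets[OF cp P(1)] and eqs = partP_eqs[OF cp P]
  have cY: "submatrix Y P (CP p p' P) \<in> carrier_mat (card P) (card (CP p p' P))" by (rule submatrix_carrier[OF Y sub(2,4)])
  have cT: "transpose_mat Y' \<in> carrier_mat (ncols p') (nrows p')" using cY' by simp
  obtain Q R where QR: "is_QR (transpose_mat (submatrix Y P (CP p p' P))) Q R" "submatrix Y' P (CP p p' P) = transpose_mat Q"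
    using o P(1) unfolding ortho_def by auto
  have e: "submatrix (transpose_mat Y') (CP p p' P) P = Q"
    using transpose_submatrix[OF cY' sub(2,4)] QR(2) by simp
  show "(ctrans (transpose_mat Y') * transpose_mat Y') $$ (i,k) = (if i = k then 1 else 0)"
  proof (rule block_gram_entry[OF sub(4,2) cT P(2) kP])
    show "ctrans (submatrix (transpose_mat Y') (CP p p' P) P) * submatrix (transpose_mat Y') (CP p p' P) P = 1\<^sub>m (card P)"
      using QR(1) unfolding e is_QR_def index_transpose_mat carrier_matD[OF cY] by blast
    fix c assume "c < ncols p'" "c \<notin> CP p p' P"
    then show "transpose_mat Y' $$ (c,i) = 0" using Y' ik N eqs(5) cY' by (auto simp: is_factor_def)
  qed
qed

subsection \<open>Interval patterns of an architecture\<close>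

lemma piv_same: "piv \<beta> q q = \<beta> ! (q - 1)"
  by (simp add: piv_def)

lemma piv_Suc: "q \<le> t \<Longrightarrow> piv \<beta> q (Suc t) = pstar (piv \<beta> q t) (\<beta> ! t)"
  by (simp add: piv_def)

lemma pstar_sel:
  "pa (pstar p p') = pa p" "pb (pstar p p') = pb p * pd p div pd p'"
  "pc (pstar p p') = pa p' * pc p' div pa p" "pd (pstar p p') = pd p'"
  by (auto simp: pstar_def)

locale butterfly_architecture =
  fixes \<beta> :: "pattern list"
  assumes arch: "architecture \<beta>" and chain: "chainable_arch \<beta>" and nonred: "\<not> redundant_arch \<beta>"
    and nonempty: "\<beta> \<noteq> []"
begin

abbreviation (input) L :: nat where "L \<equiv> length \<beta>"

text \<open>The inner dimension at the interface after factor \<open>l\<close>. Dimensions at the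
  two ends, \<open>av\<close> at the left end and \<open>dv\<close> at the right end determine the
  support of every interval pattern (\<open>supp_piv\<close>).\<close>

definition level :: "nat \<Rightarrow> nat" where
  "level l = (if l = 0 then nrows (\<beta> ! 0) else ncols (\<beta> ! (l - 1)))"
definition av :: "nat \<Rightarrow> nat" where "av q = pa (\<beta> ! (q - 1))"
definition dv :: "nat \<Rightarrow> nat" where "dv t = pd (\<beta> ! (t - 1))"

lemma ok: "1 \<le> l \<Longrightarrow> l \<le> L \<Longrightarrow> pattern_ok (\<beta> ! (l - 1))"
  using arch by (auto simp: architecture_def)

text \<open>The ratio at a cut in multiplied-out form, free of division; the two strict bounds are
  non-redundancy.\<close>

lemma ratio_facts:
  assumes "1 \<le> s" "s < L"
  obtains r where "av s * pc (\<beta> ! (s - 1)) = r * av (Suc s)" "pb (\<beta> ! s) * dv (Suc s) = r * dv s"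
    "r < pb (\<beta> ! (s - 1))" "r < pc (\<beta> ! s)" "av s dvd av (Suc s)" "dv (Suc s) dvd dv s"
proof -
  have s: "Suc (s - 1) = s" "Suc (s - 1) < L" using assms by auto
  have c: "chainable (\<beta> ! (s - 1)) (\<beta> ! s)" using chain s unfolding chainable_arch_def by metis
  have n: "\<not> redundant_pair (\<beta> ! (s - 1)) (\<beta> ! s)" using nonred s unfolding redundant_arch_def by metis
  let ?r = "ratio (\<beta> ! (s - 1)) (\<beta> ! s)"
  show thesis
  proof (rule that[of ?r])
    show "av s * pc (\<beta> ! (s - 1)) = ?r * av (Suc s)"
      using c unfolding chainable_def ratio_def av_def diff_Suc_1 by (metis dvd_div_mult_self)
    have "?r = pb (\<beta> ! s) * pd (\<beta> ! s) div pd (\<beta> ! (s - 1))" using c by (simp add: chainable_def ratio_def)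
    then show "pb (\<beta> ! s) * dv (Suc s) = ?r * dv s"
      using c by (simp add: chainable_def dv_def)
  qed (use c n in \<open>auto simp: chainable_def redundant_pair_def av_def dv_def\<close>)
qed

lemma av_dvd: "1 \<le> q \<Longrightarrow> q \<le> q' \<Longrightarrow> q' \<le> L \<Longrightarrow> av q dvd av q'"
proof (induction q')
  case (Suc n)
  show ?case
  proof (cases "q = Suc n")
    case False
    then have n: "1 \<le> n" "n < L" "q \<le> n" using Suc by auto
    have "av n dvd av (Suc n)" by (rule ratio_facts[OF n(1,2)])
    then show ?thesis using Suc n by (meson dvd_trans less_imp_le)
  qed simp
qed simp

lemma dv_dvd: "1 \<le> t \<Longrightarrow> t \<le> t' \<Longrightarrow> t' \<le> L \<Longrightarrow> dv t' dvd dv t"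
proof (induction t')
  case (Suc n)
  show ?case
  proof (cases "t = Suc n")
    case False
    then have n: "1 \<le> n" "n < L" "t \<le> n" using Suc by auto
    have "dv (Suc n) dvd dv n" by (rule ratio_facts[OF n(1,2)])
    then show ?thesis using Suc n by (meson dvd_trans less_imp_le)
  qed simp
qed simp

lemma level_Suc: "Suc l \<le> L \<Longrightarrow> nrows (\<beta> ! l) = level l"
  using arch by (cases l) (auto simp: level_def architecture_def)

text \<open>The last two conjuncts carry non-redundancy over to merged patterns: a merged pattern
  has at least the row size \<open>b\<close> of its last pattern and the column size
  \<open>c\<close> of its first one.\<close>

lemma piv_facts:
  assumes "1 \<le> q" "q \<le> t" "t \<le> L"
  shows "pattern_ok (piv \<beta> q t) \<and> pa (piv \<beta> q t) = av q \<and> pd (piv \<beta> q t) = dv t \<and>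
    nrows (piv \<beta> q t) = level (q - 1) \<and> ncols (piv \<beta> q t) = level t \<and>
    pb (\<beta> ! (t - 1)) \<le> pb (piv \<beta> q t) \<and> pc (\<beta> ! (q - 1)) \<le> pc (piv \<beta> q t)"
  using assms(2,3)
proof (induction t rule: dec_induct)
  case base
  then show ?case using assms ok[of q] level_Suc[of "q - 1"] by (auto simp: piv_same av_def dv_def level_def)
next
  case (step t)
  let ?p = "piv \<beta> q t" and ?p2 = "\<beta> ! t"
  have t: "1 \<le> t" "t < L" using step assms by auto
  have IH: "pattern_ok ?p" "pa ?p = av q" "pd ?p = dv t" "nrows ?p = level (q - 1)" "ncols ?p = level t"
    "pb (\<beta> ! (t - 1)) \<le> pb ?p" "pc (\<beta> ! (q - 1)) \<le> pc ?p" using step by auto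
  have e: "piv \<beta> q (Suc t) = pstar ?p ?p2" by (rule piv_Suc[OF step(1)])
  have p2: "pa ?p2 = av (Suc t)" "pd ?p2 = dv (Suc t)" by (auto simp: av_def dv_def)
  obtain r where r: "av t * pc (\<beta> ! (t - 1)) = r * av (Suc t)" "pb ?p2 * dv (Suc t) = r * dv t"
    "r < pb (\<beta> ! (t - 1))" "r < pc ?p2" "dv (Suc t) dvd dv t" by (rule ratio_facts[OF t])
  have aq: "av q dvd av (Suc t)" using av_dvd assms t step by auto
  have okp: "pa ?p > 0" "pb ?p > 0" "pc ?p > 0" "pd ?p > 0" using IH(1) by (auto simp: pattern_ok_def)
  have ok2: "pa ?p2 > 0" "pb ?p2 > 0" "pc ?p2 > 0" "pd ?p2 > 0" using ok[of "Suc t"] t by (auto simp: pattern_ok_def)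
  have b: "pb (pstar ?p ?p2) * dv (Suc t) = pb ?p * dv t"
    using r(5) by (simp add: pstar_sel IH p2)
  have c: "av q * pc (pstar ?p ?p2) = av (Suc t) * pc ?p2"
    using aq by (simp add: pstar_sel IH p2)
  have pos: "dv (Suc t) > 0" "dv t > 0" "av q > 0" "av (Suc t) > 0" using okp ok2 IH p2 by auto
  have okn: "pb (pstar ?p ?p2) > 0" "pc (pstar ?p ?p2) > 0"
    using b c okp ok2 pos by (metis mult_is_0 neq0_conv)+
  \<comment> \<open>\<open>r\<close> is below \<open>pb ?p\<close>, and \<open>r * dv t\<close>
    equals \<open>pb ?p2 * dv (Suc t)\<close>; comparing the products and cancelling
    \<open>dv (Suc t)\<close> gives the bound.\<close>
  have "pb ?p2 * dv (Suc t) \<le> pb (pstar ?p ?p2) * dv (Suc t)"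
    unfolding b r(2) using r(3) IH(6) by (intro mult_right_mono) auto
  then have b2: "pb ?p2 \<le> pb (pstar ?p ?p2)" using pos by simp
  \<comment> \<open>The inner dimension at \<open>t\<close>, computed from the merged pattern and
    from its last pattern, yields \<open>av q * pc ?p = r * av (Suc t)\<close>.\<close>
  have "av q * pc ?p * dv t = level t" using IH by (simp add: ncols_def)
  also have "level t = av t * pc (\<beta> ! (t - 1)) * dv t" using t by (simp add: level_def ncols_def av_def dv_def)
  finally have "av q * pc ?p = r * av (Suc t)" using r(1) pos by simp
  then have "av q * pc ?p \<le> av q * pc (pstar ?p ?p2)" unfolding c using r(4) by (simp add: mult.commute)
  then have c2: "pc ?p \<le> pc (pstar ?p ?p2)" using pos by simp
  have "nrows (pstar ?p ?p2) = level (q - 1)"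
    using b IH(4) by (simp add: nrows_def pstar_sel(1,4) p2 mult.assoc IH)
  moreover have "ncols (pstar ?p ?p2) = level (Suc t)"
    using c by (simp add: ncols_def pstar_sel(1,4) p2 IH level_def)
  ultimately show ?case unfolding e using okn okp ok2 b2 c2 IH by (auto simp: pattern_ok_def pstar_sel(1,4) p2)
qed

lemma piv_dims:
  assumes "1 \<le> q" "q \<le> t" "t \<le> L"
  shows "nrows (piv \<beta> q t) = level (q - 1)" "ncols (piv \<beta> q t) = level t"
  using piv_facts[OF assms] by auto

text \<open>The ratio at a cut is that of the two adjacent patterns, whatever the outer ends, and
  the sizes of the merged patterns dominate those of the adjacent ones.\<close>

lemma piv_chain_pair:
  assumes "1 \<le> q" "q \<le> s" "s < t" "t \<le> L"
  shows "chain_pair (piv \<beta> q s) (piv \<beta> (Suc s) t)"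
proof -
  have p: "1 \<le> q" "q \<le> s" "s \<le> L" and p': "1 \<le> Suc s" "Suc s \<le> t" "t \<le> L" and s: "1 \<le> s" "s < L" using assms by auto
  note f = piv_facts[OF p] and f' = piv_facts[OF p']
  obtain r where r: "av s * pc (\<beta> ! (s - 1)) = r * av (Suc s)" "r < pb (\<beta> ! (s - 1))" "r < pc (\<beta> ! s)"
    by (rule ratio_facts[OF s])
  have "level s = av (Suc s) * r * dv s"
    using r(1) s by (simp add: level_def ncols_def av_def dv_def)
  moreover have "r \<le> pb (piv \<beta> q s)" "r \<le> pc (piv \<beta> (Suc s) t)" using r f f' by auto
  moreover have "av q dvd av (Suc s)" "dv t dvd dv s" using av_dvd dv_dvd assms by auto
  ultimately show ?thesis unfolding chain_pair_def using f f' by auto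
qed

text \<open>The chunk containing \<open>i\<close> when the indices at interface \<open>l\<close> are
  divided into \<open>av q\<close> consecutive chunks of equal length.\<close>

definition akey :: "nat \<Rightarrow> nat \<Rightarrow> nat \<Rightarrow> nat" where "akey q l i = i div (level l div av q)"

text \<open>The block relation at cut \<open>s\<close>. By \<open>same_block_piv\<close> it does not
  depend on the outer ends of the two intervals, so orthonormality of a factor keeps its meaning
  when a neighbouring interval is split.\<close>

definition same :: "nat \<Rightarrow> nat \<Rightarrow> nat \<Rightarrow> bool" where
  "same s i j \<longleftrightarrow> akey (Suc s) s i = akey (Suc s) s j \<and> i mod dv s = j mod dv s"

lemma same_refl: "same s i i" by (simp add: same_def)

lemma same_block_piv:
  assumes "1 \<le> q" "q \<le> s" "s < t" "t \<le> L"
  shows "same_block (piv \<beta> q s) (piv \<beta> (Suc s) t) = same s"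
  using piv_facts[of q s] piv_facts[of "Suc s" t] assms
  by (auto simp: fun_eq_iff same_block_def same_def akey_def)

lemma supp_piv:
  assumes "1 \<le> q" "q \<le> t" "t \<le> L"
  shows "supp (piv \<beta> q t) i j \<longleftrightarrow> i < level (q - 1) \<and> j < level t \<and> akey q (q - 1) i = akey q t j \<and> i mod dv t = j mod dv t"
proof -
  let ?p = "piv \<beta> q t"
  have f: "pattern_ok ?p" "pa ?p = av q" "pd ?p = dv t" "nrows ?p = level (q - 1)" "ncols ?p = level t"
    using piv_facts[OF assms] by auto
  have "level (q - 1) div av q = pb ?p * pd ?p" "level t div av q = pc ?p * pd ?p"
    unfolding f(4)[symmetric] f(5)[symmetric] f(2)[symmetric] using f(1)
    by (auto simp: nrows_def ncols_def pattern_ok_def mult.assoc)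
  then show ?thesis using f by (simp add: supp_def akey_def)
qed

lemma av_dvd_level:
  assumes "1 \<le> q" "q \<le> Suc l" "q \<le> L" "l \<le> L"
  shows "av q dvd level l"
proof (cases "q \<le> l")
  case True
  then show ?thesis using piv_facts[of q l] assms by (metis dvd_mult2 dvd_triv_left mult.assoc ncols_def)
next
  case False
  then have "q = Suc l" using assms by simp
  then show ?thesis using level_Suc[of l] assms by (metis av_def diff_Suc_1 dvd_mult2 dvd_triv_left nrows_def)
qed

text \<open>As \<open>av q\<close> divides \<open>av q'\<close>, chunks for \<open>q\<close> are
  unions of chunks for \<open>q'\<close>; the bounds ensure that \<open>av q'\<close> divides both
  dimensions.\<close>

lemma akey_coarse:
  assumes "akey q' l i = akey q' l' j" "1 \<le> q" "q \<le> q'" "q' \<le> Suc l" "q' \<le> Suc l'" "q' \<le> L" "l \<le> L" "l' \<le> L"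
  shows "akey q l i = akey q l' j"
proof -
  obtain k where k: "av q' = av q * k" using av_dvd[of q q'] assms by auto
  have pos: "av q' > 0" using ok[of q'] assms by (simp add: av_def pattern_ok_def)
  then have posq: "av q > 0" using k by auto
  have "akey q x y = akey q' x y div k" if x: "q' \<le> Suc x" "x \<le> L" for x y
  proof -
    obtain c where c: "level x = av q' * c" using av_dvd_level[of q' x] assms x by auto
    have "level x div av q' = c" "level x div av q = c * k" using c k pos posq by (simp_all add: mult_ac)
    then show ?thesis unfolding akey_def by (simp add: div_mult2_eq)
  qed
  then show ?thesis using assms by simp
qed

lemma dv_coarse:
  assumes "i mod dv t = j mod dv t" "1 \<le> t" "t \<le> t'" "t' \<le> L"
  shows "i mod dv t' = j mod dv t'"
  using dv_dvd[of t t'] assms by (metis mod_mod_cancel)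

text \<open>Chunks get coarser towards smaller left ends and residues towards larger right ends, so
  both conditions pass through the interface \<open>s\<close>.\<close>

lemma supp_trans:
  assumes "1 \<le> q" "q \<le> s" "s < t" "t \<le> L" "supp (piv \<beta> q s) r i" "supp (piv \<beta> (Suc s) t) i e"
  shows "supp (piv \<beta> q t) r e"
proof -
  have a: "r < level (q - 1)" "akey q (q - 1) r = akey q s i" "r mod dv s = i mod dv s"
    "e < level t" "akey (Suc s) s i = akey (Suc s) t e" "i mod dv t = e mod dv t"
    using assms supp_piv[of q s] supp_piv[of "Suc s" t] by auto
  have "akey q s i = akey q t e" by (rule akey_coarse[OF a(5)]) (use assms in auto)
  moreover have "r mod dv t = i mod dv t" by (rule dv_coarse[OF a(3)]) (use assms in auto)
  ultimately show ?thesis using a assms by (auto simp: supp_piv)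
qed

lemma supp_same:
  assumes "1 \<le> q" "q \<le> s" "s < t" "t \<le> L" "supp (piv \<beta> q s) r i" "supp (piv \<beta> q s) r l"
    "supp (piv \<beta> (Suc s) t) i e" "supp (piv \<beta> (Suc s) t) l e"
  shows "same s i l"
  using assms by (auto simp: supp_piv same_def)

text \<open>The nesting of supports: the shared row \<open>r\<close> makes \<open>i\<close> and
  \<open>j\<close> agree modulo \<open>dv s'\<close>, the shared column \<open>e\<close> makes their
  chunks for \<open>Suc s\<close> agree. Hence projecting the first factor commutes with multiplying
  by a factor after \<open>s'\<close>.\<close>

lemma supp_ext_left:
  assumes "1 \<le> q" "q \<le> s" "s < s'" "s' < t" "t \<le> L"
    "supp (piv \<beta> q s) r i" "supp (piv \<beta> q s') r j" "supp (piv \<beta> (Suc s') t) j e" "supp (piv \<beta> (Suc s) t) i e"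
  shows "supp (piv \<beta> (Suc s) s') i j"
proof -
  have a: "i < level s" "j < level s'" "r mod dv s = i mod dv s" "r mod dv s' = j mod dv s'"
    "akey (Suc s') s' j = akey (Suc s') t e" "akey (Suc s) s i = akey (Suc s) t e"
    using assms supp_piv[of q s] supp_piv[of q s'] supp_piv[of "Suc s'" t] supp_piv[of "Suc s" t] by auto
  have "akey (Suc s) s' j = akey (Suc s) t e" by (rule akey_coarse[OF a(5)]) (use assms in auto)
  moreover have "r mod dv s' = i mod dv s'" by (rule dv_coarse[OF a(3)]) (use assms in auto)
  ultimately show ?thesis using a assms by (auto simp: supp_piv)
qed

text \<open>As in \<open>supp_ext_left\<close> with rows and columns exchanged: the shared column
  gives equal chunks, the shared row equal residues.\<close>

lemma supp_ext_right:
  assumes "1 \<le> q" "q \<le> s'" "s' < s" "s < t" "t \<le> L"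
    "supp (piv \<beta> (Suc s) t) i r" "supp (piv \<beta> (Suc s') t) j r" "supp (piv \<beta> q s') e j" "supp (piv \<beta> q s) e i"
  shows "supp (piv \<beta> (Suc s') s) j i"
proof -
  have a: "i < level s" "j < level s'" "akey (Suc s) s i = akey (Suc s) t r" "akey (Suc s') s' j = akey (Suc s') t r"
    "e mod dv s' = j mod dv s'" "e mod dv s = i mod dv s"
    using assms supp_piv[of "Suc s" t] supp_piv[of "Suc s'" t] supp_piv[of q s'] supp_piv[of q s] by auto
  have "akey (Suc s') s i = akey (Suc s') t r" by (rule akey_coarse[OF a(3)]) (use assms in auto)
  moreover have "e mod dv s = j mod dv s" by (rule dv_coarse[OF a(5)]) (use assms in auto)
  ultimately show ?thesis using a assms by (auto simp: supp_piv)
qed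

subsection \<open>Factors on intervals\<close>

definition fac :: "nat \<Rightarrow> nat \<Rightarrow> complex mat \<Rightarrow> bool" where
  "fac q t X \<longleftrightarrow> X \<in> carrier_mat (level (q - 1)) (level t) \<and> supported (supp (piv \<beta> q t)) X"

lemma fac_iff: "1 \<le> q \<Longrightarrow> q \<le> t \<Longrightarrow> t \<le> L \<Longrightarrow> is_factor (piv \<beta> q t) X \<longleftrightarrow> fac q t X"
  by (simp add: is_factor_iff fac_def piv_dims)

lemma fac_carrier: "fac q t X \<Longrightarrow> X \<in> carrier_mat (level (q - 1)) (level t)"
  by (simp add: fac_def)

lemma fac_mult:
  assumes "1 \<le> q" "q \<le> s" "s < t" "t \<le> L" "fac q s X" "fac (Suc s) t Y"
  shows "fac q t (X * Y)"
  unfolding fac_def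
proof
  have c: "X \<in> carrier_mat (level (q - 1)) (level s)" "Y \<in> carrier_mat (level s) (level t)"
    using assms(5,6) by (auto simp: fac_def)
  then show "X * Y \<in> carrier_mat (level (q - 1)) (level t)" by simp
  show "supported (supp (piv \<beta> q t)) (X * Y)"
    by (rule supported_mult[of "supp (piv \<beta> q s)" X "supp (piv \<beta> (Suc s) t)" Y, OF _ _ c])
      (use assms supp_trans[OF assms(1-4)] in \<open>auto simp: fac_def\<close>)
qed

lemma fac_diff: "fac q t X \<Longrightarrow> fac q t Y \<Longrightarrow> fac q t (X - Y)"
  unfolding fac_def by (auto intro: supported_diff)

lemma fac_left_isometry:
  assumes "1 \<le> q" "q \<le> s" "s < t" "t \<le> L" "fac q s X" "col_orth (same s) X" "fac (Suc s) t Z"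
  shows "frob (X * Z) = frob Z"
proof (rule frob_isometry)
  show "X \<in> carrier_mat (level (q - 1)) (level s)" "Z \<in> carrier_mat (level s) (level t)"
    using assms(5,7) by (auto simp: fac_def)
  show "supported (supp (piv \<beta> q s)) X" "supported (supp (piv \<beta> (Suc s) t)) Z" using assms(5,7) by (auto simp: fac_def)
qed (use assms supp_same same_refl in blast)+

lemma fac_right_isometry:
  assumes "1 \<le> q" "q \<le> s" "s < t" "t \<le> L" "fac (Suc s) t X" "col_orth (same s) (transpose_mat X)" "fac q s Z"
  shows "frob (Z * X) = frob Z"
proof -
  have c: "Z \<in> carrier_mat (level (q - 1)) (level s)" "X \<in> carrier_mat (level s) (level t)"
    using assms(5,7) by (auto simp: fac_def)
  have "frob (transpose_mat X * transpose_mat Z) = frob (transpose_mat Z)"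
  proof (rule frob_isometry)
    show "transpose_mat X \<in> carrier_mat (level t) (level s)" "transpose_mat Z \<in> carrier_mat (level s) (level (q - 1))"
      using c by auto
    show "supported (\<lambda>r i. supp (piv \<beta> (Suc s) t) i r) (transpose_mat X)" "supported (\<lambda>i e. supp (piv \<beta> q s) e i) (transpose_mat Z)"
      using assms(5,7) supported_transpose by (auto simp: fac_def)
  qed (use assms supp_same same_refl in blast)+
  then show ?thesis using frob_transpose transpose_mult[OF c] by metis
qed

text \<open>Pushes a competitor with a later cut \<open>s'\<close> through the orthonormal factor
  \<open>X\<close>: \<open>V\<close> is kept, and \<open>W\<close> replaces \<open>U\<close> on the
  interval that starts after \<open>s\<close>.\<close>

lemma fac_compress_left:
  assumes b: "1 \<le> q" "q \<le> s" "s < s'" "s' < t" "t \<le> L" and X: "fac q s X" "col_orth (same s) X"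
    and Z: "fac (Suc s) t Z" and B: "B \<in> carrier_mat (level (q - 1)) (level t)"
    and p: "perp (supp (piv \<beta> (Suc s) t)) X (B - X * Z)" and U: "fac q s' U" and V: "fac (Suc s') t V"
  obtains W where "fac (Suc s) s' W" "frob (Z - W * V) \<le> frob (B - U * V)"
proof -
  have c: "X \<in> carrier_mat (level (q - 1)) (level s)" "Z \<in> carrier_mat (level s) (level t)"
    "U \<in> carrier_mat (level (q - 1)) (level s')" "V \<in> carrier_mat (level s') (level t)"
    using X Z U V by (auto simp: fac_def)
  have st: "s < t" "q \<le> s'" "Suc s \<le> s'" "1 \<le> Suc s" "s' \<le> L" using b by auto
  obtain W where "W \<in> carrier_mat (level s) (level s')" "supported (supp (piv \<beta> (Suc s) s')) W"
    "frob (Z - W * V) \<le> frob (B - U * V)"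
  proof (rule compress_left[OF c(1,2) B c(3,4), of "supp (piv \<beta> q s)" "supp (piv \<beta> (Suc s) t)" "supp (piv \<beta> q s')"
        "supp (piv \<beta> (Suc s') t)" "same s" "supp (piv \<beta> (Suc s) s')"])
    show "supported (supp (piv \<beta> q s)) X" "supported (supp (piv \<beta> (Suc s) t)) Z" "supported (supp (piv \<beta> q s')) U"
      "supported (supp (piv \<beta> (Suc s') t)) V" using X Z U V by (auto simp: fac_def)
    show "same s i l" if "supp (piv \<beta> q s) r i" "supp (piv \<beta> q s) r l" "supp (piv \<beta> (Suc s) t) i e" "supp (piv \<beta> (Suc s) t) l e" for r i l e
      by (rule supp_same[OF b(1,2) st(1) b(5) that])
    show "same s i l" if "supp (piv \<beta> q s) r i" "supp (piv \<beta> q s) r l" "supp (piv \<beta> (Suc s) s') i e" "supp (piv \<beta> (Suc s) s') l e" for r i l e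
      by (rule supp_same[OF b(1,2,3) st(5) that])
    show "supp (piv \<beta> q s') r j" if "supp (piv \<beta> q s) r i" "supp (piv \<beta> (Suc s) s') i j" for r i j
      by (rule supp_trans[OF b(1,2,3) st(5) that])
    show "supp (piv \<beta> (Suc s) t) i e" if "supp (piv \<beta> (Suc s) s') i j" "supp (piv \<beta> (Suc s') t) j e" for i j e
      by (rule supp_trans[OF st(4,3) b(4,5) that])
    show "supp (piv \<beta> (Suc s) s') i j" if "supp (piv \<beta> q s) r i" "supp (piv \<beta> q s') r j" "supp (piv \<beta> (Suc s') t) j e"
      "supp (piv \<beta> (Suc s) t) i e" for r i j e
      by (rule supp_ext_left[OF b that])
  qed (use X p same_refl in auto)
  then show thesis using that by (auto simp: fac_def)
qed

lemma fac_compress_right: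
  assumes b: "1 \<le> q" "q \<le> s'" "s' < s" "s < t" "t \<le> L" and X: "fac (Suc s) t X" "col_orth (same s) (transpose_mat X)"
    and Z: "fac q s Z" and B: "B \<in> carrier_mat (level (q - 1)) (level t)"
    and p: "perp (\<lambda>i e. supp (piv \<beta> q s) e i) (transpose_mat X) (transpose_mat (B - Z * X))"
    and U: "fac (Suc s') t U" and V: "fac q s' V"
  obtains W where "fac (Suc s') s W" "frob (Z - V * W) \<le> frob (B - V * U)"
proof -
  have c: "X \<in> carrier_mat (level s) (level t)" "Z \<in> carrier_mat (level (q - 1)) (level s)"
    "U \<in> carrier_mat (level s') (level t)" "V \<in> carrier_mat (level (q - 1)) (level s')"
    using X Z U V by (auto simp: fac_def)
  have st: "q \<le> s" "Suc s' \<le> s" "1 \<le> Suc s'" "s \<le> L" using b by auto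
  obtain W where "W \<in> carrier_mat (level s') (level s)" "supported (supp (piv \<beta> (Suc s') s)) W"
    "frob (Z - V * W) \<le> frob (B - V * U)"
  proof (rule compress_right[OF c(1,2) B c(3,4), of "supp (piv \<beta> (Suc s) t)" "supp (piv \<beta> q s)" "supp (piv \<beta> (Suc s') t)"
        "supp (piv \<beta> q s')" "same s" "supp (piv \<beta> (Suc s') s)"])
    show "supported (supp (piv \<beta> (Suc s) t)) X" "supported (supp (piv \<beta> q s)) Z" "supported (supp (piv \<beta> (Suc s') t)) U"
      "supported (supp (piv \<beta> q s')) V" using X Z U V by (auto simp: fac_def)
    show "same s i l" if "supp (piv \<beta> (Suc s) t) i r" "supp (piv \<beta> (Suc s) t) l r" "supp (piv \<beta> q s) e i" "supp (piv \<beta> q s) e l" for r i l e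
      by (rule supp_same[OF b(1) st(1) b(4,5) that(3,4,1,2)])
    show "same s i l" if "supp (piv \<beta> (Suc s) t) i r" "supp (piv \<beta> (Suc s) t) l r" "supp (piv \<beta> (Suc s') s) e i" "supp (piv \<beta> (Suc s') s) e l" for r i l e
      by (rule supp_same[OF st(3,2) b(4,5) that(3,4,1,2)])
    show "supp (piv \<beta> (Suc s') t) j r" if "supp (piv \<beta> (Suc s) t) i r" "supp (piv \<beta> (Suc s') s) j i" for r i j
      by (rule supp_trans[OF st(3,2) b(4,5) that(2,1)])
    show "supp (piv \<beta> q s) e i" if "supp (piv \<beta> (Suc s') s) j i" "supp (piv \<beta> q s') e j" for i j e
      by (rule supp_trans[OF b(1,2,3) st(4) that(2,1)])
    show "supp (piv \<beta> (Suc s') s) j i" if "supp (piv \<beta> (Suc s) t) i r" "supp (piv \<beta> (Suc s') t) j r" "supp (piv \<beta> q s') e j"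
      "supp (piv \<beta> q s) e i" for r i j e
      by (rule supp_ext_right[OF b that])
  qed (use X p same_refl in auto)
  then show thesis using that by (auto simp: fac_def)
qed

text \<open>Carries masked orthogonality of a residual from right end \<open>m\<close> to right end
  \<open>t\<close>, so that local optimality survives attaching factors on the right.\<close>

lemma fac_perp_left:
  assumes b: "1 \<le> q" "q \<le> s" "s < m" "m < t" "t \<le> L" and X: "fac q s X" and D: "fac q m D" and V: "fac (Suc m) t V"
    and p: "perp (supp (piv \<beta> (Suc s) m)) X D"
  shows "perp (supp (piv \<beta> (Suc s) t)) X (D * V)"
proof (rule perp_mult)
  show "X \<in> carrier_mat (level (q - 1)) (level s)" "D \<in> carrier_mat (level (q - 1)) (level m)" "V \<in> carrier_mat (level m) (level t)"
    using X D V by (auto simp: fac_def)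
  show "supported (supp (piv \<beta> q s)) X" "supported (supp (piv \<beta> q m)) D" "supported (supp (piv \<beta> (Suc m) t)) V"
    using X D V by (auto simp: fac_def)
  show "perp (supp (piv \<beta> (Suc s) m)) X D" by (rule p)
qed (use supp_ext_left[OF b] in blast)

lemma fac_perp_right:
  assumes b: "1 \<le> q" "q \<le> m" "m < s" "s < t" "t \<le> L" and X: "fac (Suc s) t X" and D: "fac (Suc m) t D" and V: "fac q m V"
    and p: "perp (\<lambda>i e. supp (piv \<beta> (Suc m) s) e i) (transpose_mat X) (transpose_mat D)"
  shows "perp (\<lambda>i e. supp (piv \<beta> q s) e i) (transpose_mat X) (transpose_mat (V * D))"
proof -
  have c: "X \<in> carrier_mat (level s) (level t)" "D \<in> carrier_mat (level m) (level t)" "V \<in> carrier_mat (level (q - 1)) (level m)"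
    using X D V by (auto simp: fac_def)
  have "perp (\<lambda>i e. supp (piv \<beta> q s) e i) (transpose_mat X) (transpose_mat D * transpose_mat V)"
  proof (rule perp_mult)
    show "transpose_mat X \<in> carrier_mat (level t) (level s)" "transpose_mat D \<in> carrier_mat (level t) (level m)"
      "transpose_mat V \<in> carrier_mat (level m) (level (q - 1))"
      using c by auto
    show "supported (\<lambda>r i. supp (piv \<beta> (Suc s) t) i r) (transpose_mat X)" "supported (\<lambda>r i. supp (piv \<beta> (Suc m) t) i r) (transpose_mat D)"
      "supported (\<lambda>r i. supp (piv \<beta> q m) i r) (transpose_mat V)"
      using X D V supported_transpose by (auto simp: fac_def)
    show "perp (\<lambda>i e. supp (piv \<beta> (Suc m) s) e i) (transpose_mat X) (transpose_mat D)" by (rule p)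
  qed (use supp_ext_right[OF b] in blast)
  then show ?thesis using transpose_mult[OF c(3,2)] by simp
qed

subsection \<open>Products of chained factors\<close>

text \<open>The empty list stands for the empty interval \<open>q = Suc m\<close>, so a missing left
  or right side needs no separate treatment.\<close>

fun chained :: "nat \<Rightarrow> nat \<Rightarrow> bstate \<Rightarrow> bool" where
  "chained q m [] \<longleftrightarrow> q = Suc m"
| "chained q m (((u,v),X) # st) \<longleftrightarrow> u = q \<and> q \<le> v \<and> fac q v X \<and> chained (Suc v) m st"

text \<open>Products of side factors appear as actions on the middle matrix; an empty side then acts
  trivially, without any empty product.\<close>

definition lmul :: "bstate \<Rightarrow> complex mat \<Rightarrow> complex mat" where
  "lmul st Z = foldr (\<lambda>x Z. snd x * Z) st Z"

definition rmul :: "complex mat \<Rightarrow> bstate \<Rightarrow> complex mat" where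
  "rmul Z st = foldl (\<lambda>Z x. Z * snd x) Z st"

text \<open>A factor on the left is orthonormal relative to the cut at its right end; in
  \<open>right_orth\<close> the relevant cut is the one just before the left end.\<close>

definition left_orth :: "bstate \<Rightarrow> bool" where
  "left_orth st \<longleftrightarrow> (\<forall>x\<in>set st. col_orth (same (snd (fst x))) (snd x))"

definition right_orth :: "bstate \<Rightarrow> bool" where
  "right_orth st \<longleftrightarrow> (\<forall>x\<in>set st. col_orth (same (fst (fst x) - 1)) (transpose_mat (snd x)))"

lemma lmul_simps [simp]: "lmul [] Z = Z" "lmul (x # st) Z = snd x * lmul st Z"
  by (simp_all add: lmul_def)

lemma rmul_simps [simp]: "rmul Z [] = Z" "rmul Z (x # st) = rmul (Z * snd x) st"
  by (simp_all add: rmul_def)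

lemma orth_simps [simp]: "left_orth []" "left_orth (x # st) \<longleftrightarrow> col_orth (same (snd (fst x))) (snd x) \<and> left_orth st"
  "right_orth []" "right_orth (x # st) \<longleftrightarrow> col_orth (same (fst (fst x) - 1)) (transpose_mat (snd x)) \<and> right_orth st"
  by (auto simp: left_orth_def right_orth_def)

lemma chained_le: "chained q m st \<Longrightarrow> q \<le> Suc m"
  by (induction q m st rule: chained.induct) auto

lemma lmul_carrier:
  "chained q m Ls \<Longrightarrow> Z \<in> carrier_mat (level m) n \<Longrightarrow> lmul Ls Z \<in> carrier_mat (level (q - 1)) n"
  by (induction q m Ls rule: chained.induct) (auto dest!: fac_carrier)

lemma rmul_carrier:
  "chained (Suc m) t Rs \<Longrightarrow> Z \<in> carrier_mat n (level m) \<Longrightarrow> rmul Z Rs \<in> carrier_mat n (level t)"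
proof (induction Rs arbitrary: m Z)
  case (Cons x Rs)
  then show ?case by (cases x rule: prod.exhaust[case_product prod.exhaust]) (auto dest!: fac_carrier)
qed auto

lemma lmul_fac:
  "chained q m Ls \<Longrightarrow> 1 \<le> q \<Longrightarrow> m < t \<Longrightarrow> t \<le> L \<Longrightarrow> fac (Suc m) t Z \<Longrightarrow> fac q t (lmul Ls Z)"
proof (induction q m Ls rule: chained.induct)
  case (2 q m u v X st)
  have "v \<le> m" using chained_le[of "Suc v" m st] 2 by auto
  then show ?case using 2 by (auto intro!: fac_mult[of q v t])
qed auto

lemma rmul_fac:
  "chained (Suc m) t Rs \<Longrightarrow> 1 \<le> q \<Longrightarrow> q \<le> m \<Longrightarrow> t \<le> L \<Longrightarrow> fac q m Z \<Longrightarrow> fac q t (rmul Z Rs)"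
proof (induction Rs arbitrary: m Z)
  case (Cons x Rs)
  obtain u v X where x: "x = ((u,v),X)" by (metis prod.collapse)
  have "v \<le> t" using chained_le[of "Suc v" t Rs] Cons.prems x by auto
  then have "fac q v (Z * X)" using Cons.prems x by (intro fac_mult[of q m v]) auto
  then show ?case using Cons x by auto
qed auto

lemma lmul_minus:
  "chained q m Ls \<Longrightarrow> A \<in> carrier_mat (level m) n \<Longrightarrow> B \<in> carrier_mat (level m) n \<Longrightarrow>
    lmul Ls (A - B) = lmul Ls A - lmul Ls B"
proof (induction q m Ls rule: chained.induct)
  case (2 q m u v X st)
  have c: "X \<in> carrier_mat (level (q - 1)) (level v)" "lmul st A \<in> carrier_mat (level v) n" "lmul st B \<in> carrier_mat (level v) n"
    using 2 lmul_carrier[of "Suc v" m st] by (auto dest: fac_carrier)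
  then show ?case using 2 mult_minus_distrib_mat[OF c] by auto
qed auto

lemma lmul_mult:
  "chained q m Ls \<Longrightarrow> A \<in> carrier_mat (level m) n \<Longrightarrow> B \<in> carrier_mat n k \<Longrightarrow> lmul Ls (A * B) = lmul Ls A * B"
proof (induction q m Ls rule: chained.induct)
  case (2 q m u v X st)
  have c: "X \<in> carrier_mat (level (q - 1)) (level v)" "lmul st A \<in> carrier_mat (level v) n"
    using 2 lmul_carrier[of "Suc v" m st] by (auto dest: fac_carrier)
  then show ?case using 2 assoc_mult_mat[OF c] by auto
qed auto

lemma rmul_minus:
  "chained (Suc m) t Rs \<Longrightarrow> A \<in> carrier_mat n (level m) \<Longrightarrow> B \<in> carrier_mat n (level m) \<Longrightarrow>
    rmul (A - B) Rs = rmul A Rs - rmul B Rs"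
proof (induction Rs arbitrary: m A B)
  case (Cons x Rs)
  obtain u v X where x: "x = ((u,v),X)" by (metis prod.collapse)
  have c: "X \<in> carrier_mat (level m) (level v)" "chained (Suc v) t Rs" using Cons x by (auto dest: fac_carrier)
  have c': "A * X \<in> carrier_mat n (level v)" "B * X \<in> carrier_mat n (level v)" using Cons.prems c by auto
  show ?case using Cons.IH[OF c(2) c'] minus_mult_distrib_mat[OF Cons.prems(2,3) c(1)] x by simp
qed auto

lemma rmul_mult:
  "chained (Suc m) t Rs \<Longrightarrow> A \<in> carrier_mat n k \<Longrightarrow> B \<in> carrier_mat k (level m) \<Longrightarrow> rmul (A * B) Rs = A * rmul B Rs"
proof (induction Rs arbitrary: m B)
  case (Cons x Rs)
  obtain u v X where x: "x = ((u,v),X)" by (metis prod.collapse)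
  have c: "X \<in> carrier_mat (level m) (level v)" "chained (Suc v) t Rs" using Cons x by (auto dest: fac_carrier)
  have c': "B * X \<in> carrier_mat k (level v)" using Cons.prems c by auto
  show ?case using Cons.IH[OF c(2) Cons.prems(2) c'] assoc_mult_mat[OF Cons.prems(2,3) c(1)] x by simp
qed auto

lemma lmul_rmul:
  "chained (Suc m) t Rs \<Longrightarrow> chained q k Ls \<Longrightarrow> Z \<in> carrier_mat (level k) (level m) \<Longrightarrow>
    lmul Ls (rmul Z Rs) = rmul (lmul Ls Z) Rs"
proof (induction Rs arbitrary: m Z)
  case (Cons x Rs)
  obtain u v X where x: "x = ((u,v),X)" by (metis prod.collapse)
  have c: "X \<in> carrier_mat (level m) (level v)" "chained (Suc v) t Rs" using Cons x by (auto dest: fac_carrier)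
  have c': "Z * X \<in> carrier_mat (level k) (level v)" using Cons.prems c by auto
  show ?case using Cons.IH[OF c(2) Cons.prems(2) c'] lmul_mult[OF Cons.prems(2,3) c(1)] x by simp
qed auto

section \<open>Isometry and stripping of the side factors\<close>

lemma lmul_isometry:
  "chained q m Ls \<Longrightarrow> left_orth Ls \<Longrightarrow> 1 \<le> q \<Longrightarrow> m < t \<Longrightarrow> t \<le> L \<Longrightarrow> fac (Suc m) t Z \<Longrightarrow> frob (lmul Ls Z) = frob Z"
proof (induction q m Ls rule: chained.induct)
  case (2 q m u v X st)
  have v: "v \<le> m" using chained_le[of "Suc v" m st] 2 by auto
  have "fac (Suc v) t (lmul st Z)" by (rule lmul_fac[of "Suc v" m]) (use 2 in auto)
  then have "frob (X * lmul st Z) = frob (lmul st Z)"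
    using 2 v by (intro fac_left_isometry[of q v t]) auto
  then show ?case using 2 by auto
qed auto

lemma rmul_isometry:
  "chained (Suc m) t Rs \<Longrightarrow> right_orth Rs \<Longrightarrow> 1 \<le> q \<Longrightarrow> q \<le> m \<Longrightarrow> t \<le> L \<Longrightarrow> fac q m Z \<Longrightarrow> frob (rmul Z Rs) = frob Z"
proof (induction Rs arbitrary: m Z)
  case (Cons x Rs)
  obtain u v X where x: "x = ((u,v),X)" by (metis prod.collapse)
  have v: "v \<le> t" using chained_le[of "Suc v" t Rs] Cons.prems x by auto
  have "fac q v (Z * X)" using Cons.prems x v by (intro fac_mult[of q m v]) auto
  then have "frob (rmul (Z * X) Rs) = frob (Z * X)" using Cons.IH[of v "Z * X"] Cons.prems x by simp
  also have "\<dots> = frob Z" using Cons.prems x v by (intro fac_right_isometry[of q m v]) auto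
  finally show ?case using x by simp
qed auto

text \<open>Each left factor is peeled off by compressing an exact product, whose residual is zero.
  The condition on \<open>Z\<close> is vacuous for the empty list, which admits the unstructured
  input of the first step.\<close>

lemma lmul_strip:
  "chained q m Ls \<Longrightarrow> left_orth Ls \<Longrightarrow> 1 \<le> q \<Longrightarrow> m < s' \<Longrightarrow> s' < t \<Longrightarrow> t \<le> L \<Longrightarrow> (Ls \<noteq> [] \<longrightarrow> fac (Suc m) t Z) \<Longrightarrow>
    fac q s' U \<Longrightarrow> fac (Suc s') t V \<Longrightarrow> \<exists>W. fac (Suc m) s' W \<and> frob (Z - W * V) \<le> frob (lmul Ls Z - U * V)"
proof (induction q m Ls arbitrary: U rule: chained.induct)
  case (2 q m u v X st)
  have v: "v \<le> m" using chained_le[of "Suc v" m st] 2 by auto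
  have Z: "fac (Suc m) t Z" and X: "fac q v X" using 2 by auto
  have Z': "fac (Suc v) t (lmul st Z)" by (rule lmul_fac[of "Suc v" m]) (use 2 Z in auto)
  have XZ: "X * lmul st Z \<in> carrier_mat (level (q - 1)) (level t)"
    using fac_carrier[OF X] fac_carrier[OF Z'] by simp
  obtain W where W: "fac (Suc v) s' W" "frob (lmul st Z - W * V) \<le> frob (X * lmul st Z - U * V)"
    by (rule fac_compress_left[of q v s' t X "lmul st Z" "X * lmul st Z" U V])
      (use 2 v Z' X XZ perp_self_minus[OF fac_carrier[OF X] XZ] in auto)
  have "\<exists>W'. fac (Suc m) s' W' \<and> frob (Z - W' * V) \<le> frob (lmul st Z - W * V)"
    by (rule "2.IH") (use "2.prems" Z W(1) in auto)
  then obtain W' where "fac (Suc m) s' W'" "frob (Z - W' * V) \<le> frob (lmul st Z - W * V)" by blast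
  then show ?case using W by (intro exI[of _ W']) auto
qed auto

lemma rmul_strip:
  "chained (Suc m) t Rs \<Longrightarrow> right_orth Rs \<Longrightarrow> 1 \<le> q \<Longrightarrow> q \<le> s' \<Longrightarrow> s' < m \<Longrightarrow> t \<le> L \<Longrightarrow> (Rs \<noteq> [] \<longrightarrow> fac q m Z) \<Longrightarrow>
    fac q s' V \<Longrightarrow> fac (Suc s') t U \<Longrightarrow> \<exists>W. fac (Suc s') m W \<and> frob (Z - V * W) \<le> frob (rmul Z Rs - V * U)"
proof (induction Rs arbitrary: m Z)
  case (Cons x Rs)
  obtain u v X where x: "x = ((u,v),X)" by (metis prod.collapse)
  have v: "v \<le> t" "Suc m \<le> v" using chained_le[of "Suc v" t Rs] Cons.prems x by auto
  have Z: "fac q m Z" and X: "fac (Suc m) v X" using Cons.prems x by auto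
  have ZX: "fac q v (Z * X)" using Cons.prems x v by (intro fac_mult[of q m v]) auto
  obtain W where W: "fac (Suc s') v W" "frob (Z * X - V * W) \<le> frob (rmul (Z * X) Rs - V * U)"
    using Cons.IH[of v "Z * X"] Cons.prems x v ZX by auto
  have cXt: "transpose_mat X \<in> carrier_mat (level v) (level m)" using fac_carrier[OF X] by simp
  have c0: "Z * X - Z * X \<in> carrier_mat (level (q - 1)) (level v)" by (rule minus_carrier_mat[OF fac_carrier[OF ZX]])
  have p: "perp (\<lambda>i e. supp (piv \<beta> q m) e i) (transpose_mat X) (transpose_mat (Z * X - Z * X))"
    unfolding transpose_minus[OF fac_carrier[OF ZX] fac_carrier[OF ZX]]
    by (rule perp_self_minus[OF cXt, of _ "level (q - 1)"]) (use fac_carrier[OF ZX] in simp)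
  obtain W' where "fac (Suc s') m W'" "frob (Z - V * W') \<le> frob (Z * X - V * W)"
    by (rule fac_compress_right[of q s' m v X Z "Z * X" W V]) (use Cons.prems x v Z X W fac_carrier[OF ZX] p in auto)
  then show ?case using W x by (intro exI[of _ W']) auto
qed auto

lemma rmul_perp:
  "chained (Suc m) t Rs \<Longrightarrow> 1 \<le> q \<Longrightarrow> q \<le> s \<Longrightarrow> s < m \<Longrightarrow> t \<le> L \<Longrightarrow> fac q s X \<Longrightarrow> (Rs \<noteq> [] \<longrightarrow> fac q m D) \<Longrightarrow>
    perp (supp (piv \<beta> (Suc s) m)) X D \<Longrightarrow> perp (supp (piv \<beta> (Suc s) t)) X (rmul D Rs)"
proof (induction Rs arbitrary: m D)
  case (Cons x Rs)
  obtain u v Y where x: "x = ((u,v),Y)" by (metis prod.collapse)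
  have v: "v \<le> t" "Suc m \<le> v" using chained_le[of "Suc v" t Rs] Cons.prems x by auto
  have D: "fac q m D" and Y: "fac (Suc m) v Y" using Cons.prems x by auto
  have "perp (supp (piv \<beta> (Suc s) v)) X (D * Y)"
    by (rule fac_perp_left[of q s m v]) (use Cons.prems v D Y in auto)
  moreover have "fac q v (D * Y)" using Cons.prems v D Y by (intro fac_mult[of q m v]) auto
  ultimately show ?case using Cons.IH[of v "D * Y"] Cons.prems x v by auto
qed auto

lemma lmul_perp:
  "chained q m Ls \<Longrightarrow> 1 \<le> q \<Longrightarrow> m < s \<Longrightarrow> s < t \<Longrightarrow> t \<le> L \<Longrightarrow> fac (Suc s) t X \<Longrightarrow> (Ls \<noteq> [] \<longrightarrow> fac (Suc m) t D) \<Longrightarrow>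
    perp (\<lambda>i e. supp (piv \<beta> (Suc m) s) e i) (transpose_mat X) (transpose_mat D) \<Longrightarrow>
    perp (\<lambda>i e. supp (piv \<beta> q s) e i) (transpose_mat X) (transpose_mat (lmul Ls D))"
proof (induction q m Ls rule: chained.induct)
  case (2 q m u v Y st)
  have v: "v \<le> m" using chained_le[of "Suc v" m st] 2 by auto
  have D: "fac (Suc m) t D" and Y: "fac q v Y" using 2 by auto
  have D': "fac (Suc v) t (lmul st D)" by (rule lmul_fac[of "Suc v" m]) (use 2 D in auto)
  have "perp (\<lambda>i e. supp (piv \<beta> (Suc v) s) e i) (transpose_mat X) (transpose_mat (lmul st D))"
    by (rule "2.IH") (use 2 D in auto)
  then show ?case using 2 v D' Y by (simp add: fac_perp_right[of q v s t])
qed auto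

subsection \<open>One step of the algorithm\<close>

text \<open>The situation after the two sweeps: \<open>M\<close> is the factor about to be split at
  \<open>s\<close>. Without side factors it may be the input matrix itself, for which no support can
  be assumed.\<close>

context
  fixes Ls Rs :: bstate and q s t :: nat and M X Y :: "complex mat"
  assumes Ls: "chained 1 (q - 1) Ls" "left_orth Ls" and Rs: "chained (Suc t) L Rs" "right_orth Rs"
    and b: "1 \<le> q" "q \<le> s" "s < t" "t \<le> L"
    and M: "M \<in> carrier_mat (level (q - 1)) (level t)" and facM: "Ls \<noteq> [] \<or> Rs \<noteq> [] \<longrightarrow> fac q t M"
    and tf: "two_factor M (piv \<beta> q s) (piv \<beta> (Suc s) t) X Y"
begin

abbreviation (input) before where "before \<equiv> lmul Ls (rmul M Rs)"
abbreviation (input) after where "after \<equiv> lmul Ls (rmul (X * Y) Rs)"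

lemma step_chain_pair: "chain_pair (piv \<beta> q s) (piv \<beta> (Suc s) t)"
  by (rule piv_chain_pair[OF b])

lemma step_factors: "fac q s X" "fac (Suc s) t Y"
  using two_factor_factors[OF step_chain_pair tf] b fac_iff by auto

lemma step_product: "fac q t (X * Y)"
  by (rule fac_mult[OF b step_factors])

lemma step_optimal:
  assumes "fac q s X'" "fac (Suc s) t Y'"
  shows "frob (M - X * Y) \<le> frob (M - X' * Y')"
proof (rule two_factor_optimal[OF step_chain_pair _ tf])
  show "M \<in> carrier_mat (nrows (piv \<beta> q s)) (ncols (piv \<beta> (Suc s) t))"
    using M b by (simp add: piv_dims)
qed (use assms b fac_iff in auto)

lemma q_pred: "Suc (q - 1) = q" using b by simp

text \<open>Stripping the side factors turns \<open>U * V\<close> into a local competitor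
  \<open>W * W'\<close> with no larger error, local optimality compares it with
  \<open>X * Y\<close>, and the side factors do not change the norm of the local error.\<close>

lemma step_error:
  assumes U: "fac 1 s U" and V: "fac (Suc s) L V"
  shows "frob (before - after) \<le> frob (before - U * V)"
proof -
  have cXY: "X * Y \<in> carrier_mat (level (q - 1)) (level t)" by (rule fac_carrier[OF step_product])
  have cM: "rmul M Rs \<in> carrier_mat (level (q - 1)) (level L)" "rmul (X * Y) Rs \<in> carrier_mat (level (q - 1)) (level L)"
    using rmul_carrier[OF Rs(1)] M cXY by auto
  have r: "fac q L (rmul Z Rs)" if "fac q t Z" for Z
    by (rule rmul_fac[OF Rs(1)]) (use b that in auto)
  have "\<exists>W. fac (Suc (q - 1)) s W \<and> frob (rmul M Rs - W * V) \<le> frob (lmul Ls (rmul M Rs) - U * V)"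
    by (rule lmul_strip[OF Ls]) (use b U V facM r in auto)
  then obtain W where W: "fac q s W" "frob (rmul M Rs - W * V) \<le> frob (before - U * V)" unfolding q_pred by blast
  have "\<exists>W'. fac (Suc s) t W' \<and> frob (M - W * W') \<le> frob (rmul M Rs - W * V)"
    by (rule rmul_strip[OF Rs, of q]) (use b V W facM in auto)
  then obtain W' where W': "fac (Suc s) t W'" "frob (M - W * W') \<le> frob (rmul M Rs - W * V)" by blast
  have "before - after = lmul Ls (rmul M Rs - rmul (X * Y) Rs)"
    by (rule lmul_minus[OF Ls(1) cM, symmetric])
  also have "rmul M Rs - rmul (X * Y) Rs = rmul (M - X * Y) Rs"
    by (rule rmul_minus[OF Rs(1) M cXY, symmetric])
  finally have e: "before - after = lmul Ls (rmul (M - X * Y) Rs)" .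
  \<comment> \<open>The isometries require a supported difference. That can fail only without side
    factors, and then they are trivial.\<close>
  have "frob (before - after) = frob (M - X * Y)"
  proof (cases "Ls \<noteq> [] \<or> Rs \<noteq> []")
    case True
    then have D: "fac q t (M - X * Y)" using facM fac_diff step_product by blast
    have "frob (lmul Ls (rmul (M - X * Y) Rs)) = frob (rmul (M - X * Y) Rs)"
      by (rule lmul_isometry[OF Ls, of L]) (use b r[OF D] q_pred in auto)
    also have "\<dots> = frob (M - X * Y)" by (rule rmul_isometry[OF Rs b(1) _ _ D]) (use b in auto)
    finally show ?thesis unfolding e .
  next
    case False
    then show ?thesis unfolding e by simp
  qed
  also have "\<dots> \<le> frob (M - W * W')" by (rule step_optimal[OF W(1) W'(1)])
  finally show ?thesis using W(2) W'(2) by linarith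
qed

text \<open>The projection acts from the left, so the competitor for the new product can keep
  \<open>V\<close> and change only its first factor.\<close>

lemma step_monotone_right:
  assumes s': "s < s'" "s' < L" and U: "fac 1 s' U" and V: "fac (Suc s') L V"
  shows "\<exists>U'. fac 1 s' U' \<and> frob (after - U' * V) \<le> frob (before - U * V)"
proof -
  let ?p = "piv \<beta> q s" and ?p' = "piv \<beta> (Suc s) t"
  have "X \<in> carrier_mat (nrows ?p) (ncols ?p)" "Y \<in> carrier_mat (nrows ?p') (ncols ?p')"
    using fac_carrier[OF step_factors(1)] fac_carrier[OF step_factors(2)] b by (auto simp: piv_dims)
  note cXY = this
  \<comment> \<open>This QR decomposition belongs to the proof, not to the algorithm; it exposes
    \<open>X * Y\<close> as a projection of \<open>M\<close>.\<close>
  obtain F Z where o: "ortho ?p ?p' X Y Column F Z" using ortho_exists[OF step_chain_pair cXY] by blast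
  have F: "fac q s F" and Z: "fac (Suc s) t Z" using ortho_factors[OF step_chain_pair o] b fac_iff by auto
  have FZ: "F * Z = X * Y" using ortho_mult[OF step_chain_pair _ _ o] step_factors b fac_iff by auto
  have orth: "col_orth (same s) F" using ortho_col_orth[OF step_chain_pair o cXY(1)] same_block_piv[OF b] by simp
  have cF: "F \<in> carrier_mat (level (q - 1)) (level s)" and cZ: "Z \<in> carrier_mat (level s) (level t)"
    using fac_carrier[OF F] fac_carrier[OF Z] by auto
  have cFZ: "F * Z \<in> carrier_mat (level (q - 1)) (level t)" using cF cZ by simp
  \<comment> \<open>With the orthonormal \<open>F\<close> fixed, optimality over all pairs includes
    optimality of \<open>Z\<close> alone, hence the normal equations.\<close>
  have p0: "perp (supp ?p') F (M - F * Z)"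
  proof (rule minimal_imp_perp[OF cF cZ M, of "supp ?p" "supp ?p'" "same s"])
    show "frob (M - F * Z) \<le> frob (M - F * N)" if "N \<in> carrier_mat (level s) (level t)" "supported (supp ?p') N" for N
      unfolding FZ by (rule step_optimal[OF F]) (use that in \<open>auto simp: fac_def\<close>)
    show "same s i l" if "supp ?p r i" "supp ?p r l" "supp ?p' i e" "supp ?p' l e" for r i l e
      by (rule supp_same[OF b that])
  qed (use F Z orth same_refl in \<open>auto simp: fac_def\<close>)
  have D: "Rs \<noteq> [] \<longrightarrow> fac q t (M - F * Z)" using facM fac_diff step_product FZ by simp
  \<comment> \<open>The normal equations for \<open>M\<close> persist when the right factors are
    attached, now for the interval reaching to \<open>L\<close>.\<close>
  have "perp (supp (piv \<beta> (Suc s) L)) F (rmul (M - F * Z) Rs)"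
    by (rule rmul_perp[OF Rs(1) b(1,2,3) _ F D p0]) simp
  also have "rmul (M - F * Z) Rs = rmul M Rs - F * rmul Z Rs"
    using rmul_minus[OF Rs(1) M cFZ] rmul_mult[OF Rs(1) cF cZ] by simp
  finally have p: "perp (supp (piv \<beta> (Suc s) L)) F (rmul M Rs - F * rmul Z Rs)" .
  have r: "fac q L (rmul N Rs)" if "fac q t N" for N
    by (rule rmul_fac[OF Rs(1)]) (use b that in auto)
  have "\<exists>W. fac (Suc (q - 1)) s' W \<and> frob (rmul M Rs - W * V) \<le> frob (lmul Ls (rmul M Rs) - U * V)"
    by (rule lmul_strip[OF Ls]) (use b s' U V facM r in auto)
  then obtain W where W: "fac q s' W" "frob (rmul M Rs - W * V) \<le> frob (before - U * V)" unfolding q_pred by blast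
  have rZ: "fac (Suc s) L (rmul Z Rs)" by (rule rmul_fac[OF Rs(1) _ _ _ Z]) (use b in auto)
  \<comment> \<open>Projecting replaces \<open>W\<close> by \<open>F * W2\<close> and leaves
    \<open>V\<close> alone.\<close>
  obtain W2 where W2: "fac (Suc s) s' W2" "frob (rmul Z Rs - W2 * V) \<le> frob (rmul M Rs - W * V)"
    by (rule fac_compress_left[OF b(1,2) s' _ F orth rZ rmul_carrier[OF Rs(1) M] p W(1) V]) auto
  have FW: "fac q s' (F * W2)" by (rule fac_mult[OF b(1,2) s'(1) _ F W2(1)]) (use s' in simp)
  \<comment> \<open>Attaching the stripped left factors again gives a competitor for the whole new
    product.\<close>
  have U': "fac 1 s' (lmul Ls (F * W2))"
    by (rule lmul_fac[OF Ls(1)]) (use b s' FW q_pred in auto)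
  have cV: "V \<in> carrier_mat (level s') (level L)" and cW2: "W2 \<in> carrier_mat (level s) (level s')"
    and crZ: "rmul Z Rs \<in> carrier_mat (level s) (level L)"
    using fac_carrier[OF V] fac_carrier[OF W2(1)] fac_carrier[OF rZ] by auto
  have WV: "fac (Suc s) L (W2 * V)" by (rule fac_mult[OF _ _ s'(2) _ W2(1) V]) (use s' in auto)
  then have N: "fac (Suc s) L (rmul Z Rs - W2 * V)" using fac_diff rZ by blast
  have FN: "fac q L (F * (rmul Z Rs - W2 * V))" by (rule fac_mult[OF b(1,2) _ _ F N]) (use b in auto)
  have c: "F * rmul Z Rs \<in> carrier_mat (level (q - 1)) (level L)" "F * W2 \<in> carrier_mat (level (q - 1)) (level s')"
    "F * W2 * V \<in> carrier_mat (level (q - 1)) (level L)" using cF crZ cW2 cV by auto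
  have "after = lmul Ls (F * rmul Z Rs)" using rmul_mult[OF Rs(1) cF cZ] FZ by simp
  moreover have "lmul Ls (F * W2) * V = lmul Ls (F * W2 * V)" by (rule lmul_mult[OF Ls(1) c(2) cV, symmetric])
  ultimately have "after - lmul Ls (F * W2) * V = lmul Ls (F * rmul Z Rs - F * W2 * V)"
    using lmul_minus[OF Ls(1) c(1,3)] by simp
  also have "F * rmul Z Rs - F * W2 * V = F * (rmul Z Rs - W2 * V)"
    using mult_minus_distrib_mat[OF cF crZ fac_carrier[OF WV, simplified]] assoc_mult_mat[OF cF cW2 cV] by simp
  finally have "frob (after - lmul Ls (F * W2) * V) = frob (lmul Ls (F * (rmul Z Rs - W2 * V)))" by simp
  also have "\<dots> = frob (F * (rmul Z Rs - W2 * V))"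
    by (rule lmul_isometry[OF Ls, of L]) (use b FN q_pred in auto)
  also have "\<dots> = frob (rmul Z Rs - W2 * V)"
    by (rule fac_left_isometry[OF b(1,2) _ _ F orth N]) (use b in auto)
  finally show ?thesis using U' W(2) W2(2) by (intro exI[of _ "lmul Ls (F * W2)"]) auto
qed

text \<open>Mirror image of \<open>step_monotone_right\<close>: \<open>U\<close> is kept, the
  orthonormal factor stands on the right, the left factors stay attached and the right ones are
  stripped.\<close>

lemma step_monotone_left:
  assumes s': "1 \<le> s'" "s' < s" and U: "fac 1 s' U" and V: "fac (Suc s') L V"
  shows "\<exists>V'. fac (Suc s') L V' \<and> frob (after - U * V') \<le> frob (before - U * V)"
proof -
  let ?p = "piv \<beta> q s" and ?p' = "piv \<beta> (Suc s) t"
  have "X \<in> carrier_mat (nrows ?p) (ncols ?p)" "Y \<in> carrier_mat (nrows ?p') (ncols ?p')"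
    using fac_carrier[OF step_factors(1)] fac_carrier[OF step_factors(2)] b by (auto simp: piv_dims)
  note cXY = this
  obtain Z F where o: "ortho ?p ?p' X Y Row Z F" using ortho_exists[OF step_chain_pair cXY] by blast
  have Z: "fac q s Z" and F: "fac (Suc s) t F" using ortho_factors[OF step_chain_pair o] b fac_iff by auto
  have ZF: "Z * F = X * Y" using ortho_mult[OF step_chain_pair _ _ o] step_factors b fac_iff by auto
  have orth: "col_orth (same s) (transpose_mat F)" using ortho_row_orth[OF step_chain_pair o cXY(2)] same_block_piv[OF b] by simp
  have cZ: "Z \<in> carrier_mat (level (q - 1)) (level s)" and cF: "F \<in> carrier_mat (level s) (level t)"
    using fac_carrier[OF F] fac_carrier[OF Z] by auto
  have cZF: "Z * F \<in> carrier_mat (level (q - 1)) (level t)" using cF cZ by simp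
  have tr: "transpose_mat (M - N * F) = transpose_mat M - transpose_mat F * transpose_mat N"
    if N: "N \<in> carrier_mat (level (q - 1)) (level s)" for N
    using transpose_minus[OF M mult_carrier_mat[OF N cF]] transpose_mult[OF N cF] by simp
  have p0: "perp (\<lambda>i e. supp ?p e i) (transpose_mat F) (transpose_mat (M - Z * F))"
    unfolding tr[OF cZ]
  proof (rule minimal_imp_perp[of "transpose_mat F" "level t" "level s" "transpose_mat Z" "level (q - 1)" "transpose_mat M"
        "\<lambda>r i. supp ?p' i r" "\<lambda>i e. supp ?p e i" "same s"])
    show "supported (\<lambda>r i. supp ?p' i r) (transpose_mat F)" "supported (\<lambda>i e. supp ?p e i) (transpose_mat Z)"
      using supported_transpose F Z by (auto simp: fac_def)
    show "frob (transpose_mat M - transpose_mat F * transpose_mat Z) \<le> frob (transpose_mat M - transpose_mat F * N)"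
      if N: "N \<in> carrier_mat (level s) (level (q - 1))" "supported (\<lambda>i e. supp ?p e i) N" for N
    proof -
      have cN: "transpose_mat N \<in> carrier_mat (level (q - 1)) (level s)" using N by simp
      have "fac q s (transpose_mat N)" using cN supported_transpose[OF N(2)] by (simp add: fac_def)
      then have "frob (M - Z * F) \<le> frob (M - transpose_mat N * F)" unfolding ZF by (intro step_optimal F)
      then show ?thesis using tr[OF cZ] tr[OF cN] frob_transpose[of "M - Z * F"] frob_transpose[of "M - transpose_mat N * F"] by simp
    qed
    show "same s i l" if "supp ?p' i r" "supp ?p' l r" "supp ?p e i" "supp ?p e l" for r i l e
      by (rule supp_same[OF b that(3,4,1,2)])
  qed (use cF cZ M orth same_refl in auto)
  have D: "Ls \<noteq> [] \<longrightarrow> fac (Suc (q - 1)) t (M - Z * F)" using facM fac_diff step_product ZF q_pred by simp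
  have "perp (\<lambda>i e. supp (piv \<beta> 1 s) e i) (transpose_mat F) (transpose_mat (lmul Ls (M - Z * F)))"
    by (rule lmul_perp[OF Ls(1) _ _ b(3,4) F D]) (use b p0 q_pred in auto)
  also have "lmul Ls (M - Z * F) = lmul Ls M - lmul Ls Z * F"
    using lmul_minus[OF Ls(1) M cZF] lmul_mult[OF Ls(1) cZ cF] by simp
  finally have p: "perp (\<lambda>i e. supp (piv \<beta> 1 s) e i) (transpose_mat F) (transpose_mat (lmul Ls M - lmul Ls Z * F))" .
  have clM: "lmul Ls M \<in> carrier_mat (level 0) (level t)" using lmul_carrier[OF Ls(1) M] by simp
  have l: "fac 1 t' (lmul Ls N)" if "fac q t' N" "q \<le> t'" "t' \<le> L" for N t'
    by (rule lmul_fac[OF Ls(1)]) (use b that q_pred in auto)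
  \<comment> \<open>Left and right multiplications commute, so the right factors can be stripped
    although \<open>before\<close> applies them innermost.\<close>
  have swap: "lmul Ls (rmul N Rs) = rmul (lmul Ls N) Rs" if "N \<in> carrier_mat (level (q - 1)) (level t)" for N
    by (rule lmul_rmul[OF Rs(1) Ls(1) that])
  have "\<exists>W. fac (Suc s') t W \<and> frob (lmul Ls M - U * W) \<le> frob (rmul (lmul Ls M) Rs - U * V)"
    by (rule rmul_strip[OF Rs, of 1]) (use b s' U V facM l[of t M] in auto)
  then obtain W where W: "fac (Suc s') t W" "frob (lmul Ls M - U * W) \<le> frob (before - U * V)" unfolding swap[OF M] by blast
  have lZ: "fac 1 s (lmul Ls Z)" using l[OF Z] b by simp
  obtain W2 where W2: "fac (Suc s') s W2" "frob (lmul Ls Z - U * W2) \<le> frob (lmul Ls M - U * W)"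
    by (rule fac_compress_right[OF _ s' b(3,4) F orth lZ _ p W(1) U]) (use clM in auto)
  have WF: "fac (Suc s') t (W2 * F)" by (rule fac_mult[OF _ _ b(3,4) W2(1) F]) (use s' in auto)
  have V': "fac (Suc s') L (rmul (W2 * F) Rs)"
    by (rule rmul_fac[OF Rs(1) _ _ _ WF]) (use b s' in auto)
  have cU: "U \<in> carrier_mat (level 0) (level s')" and cW2: "W2 \<in> carrier_mat (level s') (level s)"
    and clZ: "lmul Ls Z \<in> carrier_mat (level 0) (level s)"
    using fac_carrier[OF U] fac_carrier[OF W2(1)] fac_carrier[OF lZ] by auto
  have UW: "fac 1 s (U * W2)" by (rule fac_mult[OF _ s' _ U W2(1)]) (use b in auto)
  then have N: "fac 1 s (lmul Ls Z - U * W2)" using fac_diff lZ by blast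
  have NF: "fac 1 t ((lmul Ls Z - U * W2) * F)" by (rule fac_mult[OF _ _ b(3,4) N F]) (use b in auto)
  have cUW: "U * W2 \<in> carrier_mat (level 0) (level s)" using cU cW2 by simp
  have c: "lmul Ls Z * F \<in> carrier_mat (level 0) (level t)" "W2 * F \<in> carrier_mat (level s') (level t)"
    "U * (W2 * F) \<in> carrier_mat (level 0) (level t)" using cF clZ cW2 cU by auto
  have "after = rmul (lmul Ls Z * F) Rs" using swap[OF cZF] lmul_mult[OF Ls(1) cZ cF] ZF by simp
  moreover have "U * rmul (W2 * F) Rs = rmul (U * (W2 * F)) Rs" by (rule rmul_mult[OF Rs(1) cU c(2), symmetric])
  ultimately have "after - U * rmul (W2 * F) Rs = rmul (lmul Ls Z * F - U * (W2 * F)) Rs"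
    using rmul_minus[OF Rs(1) c(1,3)] by simp
  also have "lmul Ls Z * F - U * (W2 * F) = (lmul Ls Z - U * W2) * F"
    using minus_mult_distrib_mat[OF clZ cUW cF] assoc_mult_mat[OF cU cW2 cF] by simp
  finally have "frob (after - U * rmul (W2 * F) Rs) = frob (rmul ((lmul Ls Z - U * W2) * F) Rs)" by simp
  also have "\<dots> = frob ((lmul Ls Z - U * W2) * F)"
    by (rule rmul_isometry[OF Rs _ _ _ NF]) (use b in auto)
  also have "\<dots> = frob (lmul Ls Z - U * W2)"
    by (rule fac_right_isometry[OF _ _ b(3,4) F orth N]) (use b in auto)
  finally show ?thesis using V' W(2) W2(2) by (intro exI[of _ "rmul (W2 * F) Rs"]) auto
qed

end

subsection \<open>Sweeps\<close>

lemma chained_append: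
  assumes "1 \<le> q"
  shows "chained q m (xs @ ys) \<longleftrightarrow> (\<exists>k. chained q k xs \<and> chained (Suc k) m ys)"
  using assms
proof (induction xs arbitrary: q)
  case Nil
  show ?case
  proof
    assume "chained q m ([] @ ys)"
    then show "\<exists>k. chained q k [] \<and> chained (Suc k) m ys" using Nil by (intro exI[of _ "q - 1"]) auto
  qed auto
next
  case (Cons x xs)
  obtain u v X where x: "x = ((u,v),X)" by (metis prod.collapse)
  show ?case using Cons.IH[of "Suc v"] x by auto
qed

definition sprod :: "bstate \<Rightarrow> complex mat" where
  "sprod st = mat_prod_list (map snd st)"

lemma sprod_Cons: "sprod [x] = snd x" "ys \<noteq> [] \<Longrightarrow> sprod (x # ys) = snd x * sprod ys"
  by (cases ys; simp add: sprod_def)+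

lemma sprod_append: "ys \<noteq> [] \<Longrightarrow> sprod (xs @ ys) = lmul xs (sprod ys)"
  by (induction xs) (auto simp: sprod_Cons)

lemma sprod_rmul:
  "chained (Suc m) t Rs \<Longrightarrow> snd x \<in> carrier_mat n (level m) \<Longrightarrow> sprod (x # Rs) = rmul (snd x) Rs"
proof (induction Rs arbitrary: x m n)
  case (Cons y Rs)
  obtain u v Y where y: "y = ((u,v),Y)" by (metis prod.collapse)
  have c: "chained (Suc v) t Rs" "Y \<in> carrier_mat (level m) (level v)" using Cons.prems y by (auto dest: fac_carrier)
  have "sprod (y # Rs) = rmul Y Rs" using Cons.IH[OF c(1), of y] c y by auto
  moreover have "rmul (snd x * Y) Rs = snd x * rmul Y Rs"
    by (rule rmul_mult[OF c(1) Cons.prems(2) c(2)])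
  ultimately show ?case using y by (simp add: sprod_Cons)
qed (simp add: sprod_Cons)

lemma sprod_split:
  assumes "chained (Suc t) L Rs" "M \<in> carrier_mat n (level t)"
  shows "sprod (Ls @ ((q,t),M) # Rs) = lmul Ls (rmul M Rs)"
  using sprod_append[of "((q,t),M) # Rs" Ls] sprod_rmul[OF assms(1), of "((q,t),M)"] assms by simp

lemma sprod_split2:
  assumes "chained (Suc t) L Rs" "X \<in> carrier_mat n (level s)" "fac (Suc s) t Y" "s < t"
  shows "sprod (Ls @ ((q,s),X) # ((Suc s,t),Y) # Rs) = lmul Ls (rmul (X * Y) Rs)"
proof -
  have "chained (Suc s) L (((Suc s,t),Y) # Rs)" using assms by simp
  then have "sprod (((q,s),X) # ((Suc s,t),Y) # Rs) = rmul X (((Suc s,t),Y) # Rs)"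
    using sprod_rmul[of s L "((Suc s,t),Y) # Rs" "((q,s),X)"] assms by auto
  then show ?thesis using sprod_append[of "((q,s),X) # ((Suc s,t),Y) # Rs" Ls] by simp
qed

abbreviation (input) lorth :: "(nat \<times> nat) \<times> complex mat \<Rightarrow> bool" where
  "lorth x \<equiv> col_orth (same (snd (fst x))) (snd x)"
abbreviation (input) rorth :: "(nat \<times> nat) \<times> complex mat \<Rightarrow> bool" where
  "rorth x \<equiv> col_orth (same (fst (fst x) - 1)) (transpose_mat (snd x))"

lemma chained_split2:
  assumes "chained 1 L st" "Suc k < length st"
  obtains q s t X Y Ls Rs where "st = Ls @ ((q,s),X) # ((Suc s,t),Y) # Rs" "length Ls = k" "chained 1 (q - 1) Ls"
    "chained (Suc t) L Rs" "1 \<le> q" "q \<le> s" "s < t" "t \<le> L" "fac q s X" "fac (Suc s) t Y"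
proof -
  obtain q s X where x: "st ! k = ((q,s),X)" by (metis prod.collapse)
  obtain q' t Y where y: "st ! Suc k = ((q',t),Y)" by (metis prod.collapse)
  define Ls Rs where "Ls = take k st" and "Rs = drop (Suc (Suc k)) st"
  have st: "st = Ls @ ((q,s),X) # ((q',t),Y) # Rs"
    using assms(2) unfolding Ls_def Rs_def x[symmetric] y[symmetric]
    by (simp add: Cons_nth_drop_Suc Suc_lessD)
  then obtain m where m: "chained 1 m Ls" "chained (Suc m) L (((q,s),X) # ((q',t),Y) # Rs)"
    using assms(1) chained_append[of 1 L Ls] by auto
  then have f: "q = Suc m" "q \<le> s" "q' = Suc s" "Suc s \<le> t" "fac q s X" "fac q' t Y" "chained (Suc t) L Rs" by auto
  have "t \<le> L" using chained_le[OF f(7)] by simp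
  show thesis
  proof (rule that[of Ls q s X t Y Rs])
    show "st = Ls @ ((q,s),X) # ((Suc s,t),Y) # Rs" using st unfolding f(3) .
    show "length Ls = k" using assms(2) by (simp add: Ls_def)
    show "fac (Suc s) t Y" using f(6) unfolding f(3) .
  qed (use f m(1) \<open>t \<le> L\<close> in simp_all)
qed

text \<open>Ortho changes only how the product of two neighbours is distributed between them, hence
  neither the total product nor the intervals.\<close>

lemma ortho_at_chained:
  assumes st: "chained 1 L st" and o: "ortho_at \<beta> u k st st'"
  shows "chained 1 L st'" "sprod st' = sprod st" "map fst st' = map fst st"
    "u = Column \<Longrightarrow> lorth (st' ! k)" "u = Row \<Longrightarrow> rorth (st' ! Suc k)"
proof -
  have len: "Suc k < length st" "length st' = length st" using o by (auto simp: ortho_at_def)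
  obtain q s t X Y Ls Rs where d: "st = Ls @ ((q,s),X) # ((Suc s,t),Y) # Rs" "length Ls = k" "chained 1 (q - 1) Ls"
    "chained (Suc t) L Rs" and b: "1 \<le> q" "q \<le> s" "s < t" "t \<le> L" and XY: "fac q s X" "fac (Suc s) t Y"
    by (rule chained_split2[OF st len(1)])
  have nth: "st ! k = ((q,s),X)" "st ! Suc k = ((Suc s,t),Y)" using d(1,2) by (auto simp: nth_append)
  obtain X' Y' where n': "st' ! k = ((q,s),X')" "st' ! Suc k = ((Suc s,t),Y')"
    using o nth unfolding ortho_at_def by (metis fst_conv prod.collapse)
  have oo: "ortho (piv \<beta> q s) (piv \<beta> (Suc s) t) X Y u X' Y'"
    using o nth n' by (simp add: ortho_at_def)
  have st': "st' = Ls @ ((q,s),X') # ((Suc s,t),Y') # Rs"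
  proof (rule nth_equalityI)
    show "length st' = length (Ls @ ((q,s),X') # ((Suc s,t),Y') # Rs)" using len d by simp
    fix i assume i: "i < length st'"
    consider "i = k" | "i = Suc k" | "i \<noteq> k" "i \<noteq> Suc k" by blast
    then show "st' ! i = (Ls @ ((q,s),X') # ((Suc s,t),Y') # Rs) ! i"
    proof cases
      case 3
      then have "st' ! i = st ! i" using o i len by (simp add: ortho_at_def)
      then show ?thesis using d(1,2) 3 by (auto simp: nth_append nth_Cons split: nat.splits)
    qed (use n' d(2) in \<open>auto simp: nth_append\<close>)
  qed
  note cp = piv_chain_pair[OF b]
  have XY': "fac q s X'" "fac (Suc s) t Y'" using ortho_factors[OF cp oo] b fac_iff by auto
  have eq: "X' * Y' = X * Y" using ortho_mult[OF cp _ _ oo] XY b fac_iff by auto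
  show "chained 1 L st'" unfolding st' using chained_append[of 1 L Ls] d(3,4) XY' b by auto
  show "map fst st' = map fst st" unfolding st' d(1) by simp
  show "sprod st' = sprod st" unfolding st' d(1)
    using sprod_split2[OF d(4) fac_carrier[OF XY'(1)] XY'(2) b(3), of Ls q]
      sprod_split2[OF d(4) fac_carrier[OF XY(1)] XY(2) b(3), of Ls q] eq by simp
  have c: "X \<in> carrier_mat (nrows (piv \<beta> q s)) (ncols (piv \<beta> q s))"
    "Y \<in> carrier_mat (nrows (piv \<beta> (Suc s) t)) (ncols (piv \<beta> (Suc s) t))"
    using fac_carrier[OF XY(1)] fac_carrier[OF XY(2)] b by (auto simp: piv_dims)
  show "lorth (st' ! k)" if "u = Column"
    using ortho_col_orth[OF cp oo[unfolded that] c(1)] same_block_piv[OF b] n' by simp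
  show "rorth (st' ! Suc k)" if "u = Row"
    using ortho_row_orth[OF cp oo[unfolded that] c(2)] same_block_piv[OF b] n' by simp
qed

lemma ortho_at_exists:
  assumes st: "chained 1 L st" and k: "Suc k < length st"
  shows "\<exists>st'. ortho_at \<beta> u k st st'"
proof -
  obtain q s t X Y Ls Rs where d: "st = Ls @ ((q,s),X) # ((Suc s,t),Y) # Rs" "length Ls = k"
    and b: "1 \<le> q" "q \<le> s" "s < t" "t \<le> L" and XY: "fac q s X" "fac (Suc s) t Y"
    by (rule chained_split2[OF st k])
  have c: "X \<in> carrier_mat (nrows (piv \<beta> q s)) (ncols (piv \<beta> q s))"
    "Y \<in> carrier_mat (nrows (piv \<beta> (Suc s) t)) (ncols (piv \<beta> (Suc s) t))"
    using fac_carrier[OF XY(1)] fac_carrier[OF XY(2)] b by (auto simp: piv_dims)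
  obtain X' Y' where o: "ortho (piv \<beta> q s) (piv \<beta> (Suc s) t) X Y u X' Y'"
    using ortho_exists[OF piv_chain_pair[OF b] c] by blast
  have "ortho_at \<beta> u k st (Ls @ ((q,s),X') # ((Suc s,t),Y') # Rs)"
    using o d unfolding ortho_at_def by (auto simp: nth_append nth_Cons split: nat.splits)
  then show ?thesis by blast
qed

text \<open>The call at position \<open>i\<close> alters positions \<open>i\<close> and
  \<open>Suc i\<close> only; the factors made orthonormal earlier lie before them.\<close>

lemma left_sweep_invariant:
  assumes st: "chained 1 L st" and len: "length sts = j" and st0: "sts ! 0 = st"
    and step: "\<forall>i. Suc i < j \<longrightarrow> ortho_at \<beta> Column i (sts ! i) (sts ! Suc i)" and i: "i < j"
  shows "chained 1 L (sts ! i) \<and> sprod (sts ! i) = sprod st \<and> map fst (sts ! i) = map fst st \<and> (\<forall>k<i. lorth (sts ! i ! k))"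
  using i
proof (induction i)
  case 0
  then show ?case using st st0 by simp
next
  case (Suc i)
  then have IH: "chained 1 L (sts ! i)" "sprod (sts ! i) = sprod st" "map fst (sts ! i) = map fst st" "\<forall>k<i. lorth (sts ! i ! k)"
    by auto
  have o: "ortho_at \<beta> Column i (sts ! i) (sts ! Suc i)" using step Suc by blast
  note oc = ortho_at_chained[OF IH(1) o]
  have "lorth (sts ! Suc i ! k)" if "k < Suc i" for k
  proof (cases "k = i")
    case False
    then have "k < i" using that by simp
    moreover have "sts ! Suc i ! k = sts ! i ! k" using o \<open>k < i\<close> by (auto simp: ortho_at_def)
    ultimately show ?thesis using IH(4) by simp
  qed (use oc(4) in simp)
  then show ?case using oc(1-3) IH by simp
qed

text \<open>The positions descend to \<open>j - 1\<close> at the lowest, so the left factors, all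
  below \<open>j - 1\<close>, keep their orthonormality; the last call hands its triangular factor
  to the factor about to be split.\<close>

lemma right_sweep_invariant:
  assumes st: "chained 1 L st" and j: "1 \<le> j" "j \<le> length st" and len: "length sts = Suc (length st - j)" and st0: "sts ! 0 = st"
    and lo: "\<forall>k<j - 1. lorth (st ! k)"
    and step: "\<forall>i. i < length st - j \<longrightarrow> ortho_at \<beta> Row (length st - 2 - i) (sts ! i) (sts ! Suc i)" and i: "i \<le> length st - j"
  shows "chained 1 L (sts ! i) \<and> sprod (sts ! i) = sprod st \<and> map fst (sts ! i) = map fst st \<and>
    (\<forall>k<j - 1. lorth (sts ! i ! k)) \<and> (\<forall>k. length st - i \<le> k \<and> k < length st \<longrightarrow> rorth (sts ! i ! k))"
  using i
proof (induction i)
  case 0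
  then show ?case using st st0 lo by auto
next
  case (Suc i)
  let ?k = "length st - 2 - i"
  have IH: "chained 1 L (sts ! i)" "sprod (sts ! i) = sprod st" "map fst (sts ! i) = map fst st" "\<forall>k<j - 1. lorth (sts ! i ! k)"
    "\<forall>k. length st - i \<le> k \<and> k < length st \<longrightarrow> rorth (sts ! i ! k)"
    using Suc by auto
  have o: "ortho_at \<beta> Row ?k (sts ! i) (sts ! Suc i)" using step Suc.prems by simp
  note oc = ortho_at_chained[OF IH(1) o]
  have len_i: "length (sts ! i) = length st" using IH(3) by (metis length_map)
  have kj: "j - 1 \<le> ?k" "Suc ?k = length st - Suc i" using Suc.prems j by auto
  have same: "sts ! Suc i ! k = sts ! i ! k" if "k < length st" "k \<noteq> ?k" "k \<noteq> Suc ?k" for k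
    using o that len_i by (auto simp: ortho_at_def)
  have "lorth (sts ! Suc i ! k)" if "k < j - 1" for k
    using same[of k] IH(4) that kj j by auto
  moreover have "rorth (sts ! Suc i ! k)" if "length st - Suc i \<le> k" "k < length st" for k
  proof (cases "k = Suc ?k")
    case True
    then show ?thesis using oc(5) by simp
  next
    case False
    then have "length st - i \<le> k" "k \<noteq> ?k" using that kj by auto
    then show ?thesis using same[of k] False IH(5) that by auto
  qed
  ultimately show ?case using oc(1-3) IH by simp
qed

text \<open>The second case is the initial state, whose single matrix is the input and need not be a
  factor of the merged pattern.\<close>

definition wf_state :: "bstate \<Rightarrow> bool" where
  "wf_state st \<longleftrightarrow> chained 1 L st \<or> (\<exists>A. A \<in> carrier_mat (level 0) (level L) \<and> st = [((1,L),A)])"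

lemma sweeps:
  assumes wf: "wf_state st" and j: "1 \<le> j" "j \<le> length st" and qt: "fst (st ! (j - 1)) = (q,t)"
    and ls: "left_sweep \<beta> j st st1" and rs: "right_sweep \<beta> j st1 st2"
  obtains Ls M Rs where "st2 = Ls @ ((q,t),M) # Rs" "length Ls = j - 1" "map fst st2 = map fst st" "sprod st2 = sprod st"
    "chained 1 (q - 1) Ls" "left_orth Ls" "chained (Suc t) L Rs" "right_orth Rs" "1 \<le> q" "q \<le> t" "t \<le> L"
    "M \<in> carrier_mat (level (q - 1)) (level t)" "Ls \<noteq> [] \<or> Rs \<noteq> [] \<longrightarrow> fac q t M"
proof -
  obtain sts where sts: "length sts = j" "sts ! 0 = st" "sts ! (j - 1) = st1"
    "\<forall>i. Suc i < j \<longrightarrow> ortho_at \<beta> Column i (sts ! i) (sts ! Suc i)" using ls unfolding left_sweep_def by blast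
  obtain sts' where sts': "length sts' = Suc (length st1 - j)" "sts' ! 0 = st1" "sts' ! (length st1 - j) = st2"
    "\<forall>i. i < length st1 - j \<longrightarrow> ortho_at \<beta> Row (length st1 - 2 - i) (sts' ! i) (sts' ! Suc i)"
    using rs unfolding right_sweep_def Let_def by blast
  show thesis
  proof (cases "chained 1 L st")
    case True
    have 1: "chained 1 L st1" "sprod st1 = sprod st" "map fst st1 = map fst st" "\<forall>k<j - 1. lorth (st1 ! k)"
      using left_sweep_invariant[OF True sts(1,2,4), of "j - 1"] j sts(3) by auto
    have len1: "length st1 = length st" using 1(3) by (metis length_map)
    have 2: "chained 1 L st2" "sprod st2 = sprod st1" "map fst st2 = map fst st1" "\<forall>k<j - 1. lorth (st2 ! k)"
      "\<forall>k. length st1 - (length st1 - j) \<le> k \<and> k < length st1 \<longrightarrow> rorth (st2 ! k)"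
      using right_sweep_invariant[OF 1(1) j(1) _ sts'(1,2) 1(4) sts'(4), of "length st1 - j"] j sts'(3) len1 by auto
    have len2: "length st2 = length st" using 2(3) len1 by (metis length_map)
    define Ls Rs M where "Ls = take (j - 1) st2" and "Rs = drop j st2" and "M = snd (st2 ! (j - 1))"
    have "map fst st2 ! (j - 1) = map fst st ! (j - 1)" using 1(3) 2(3) by simp
    then have "fst (st2 ! (j - 1)) = (q,t)" using qt j len2 by simp
    then have x: "st2 ! (j - 1) = ((q,t),M)" by (metis M_def prod.collapse)
    have st2: "st2 = Ls @ ((q,t),M) # Rs"
      using id_take_nth_drop[of "j - 1" st2] j len2 x by (simp add: Ls_def Rs_def)
    obtain m where m: "chained 1 m Ls" "chained (Suc m) L (((q,t),M) # Rs)"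
      using 2(1) chained_append[of 1 L Ls] st2 by auto
    have "left_orth Ls" unfolding left_orth_def
    proof
      fix x assume "x \<in> set Ls"
      then obtain k where "k < j - 1" "x = st2 ! k" using j len2 by (auto simp: in_set_conv_nth Ls_def)
      then show "lorth x" using 2(4) by simp
    qed
    moreover have "right_orth Rs" unfolding right_orth_def
    proof
      fix x assume "x \<in> set Rs"
      then obtain k where "k < length st2 - j" "x = st2 ! (j + k)" using j len2 by (auto simp: in_set_conv_nth Rs_def)
      then show "rorth x" using 2(5) len1 len2 j by auto
    qed
    moreover have f: "q = Suc m" "q \<le> t" "fac q t M" "chained (Suc t) L Rs" using m by auto
    moreover have "t \<le> L" using chained_le[OF f(4)] by simp
    moreover have "length Ls = j - 1" using j len2 by (simp add: Ls_def)
    ultimately show thesis using that[of Ls M Rs] st2 1 2 m fac_carrier[of q t M] by auto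
  next
    case False
    then obtain A where A: "A \<in> carrier_mat (level 0) (level L)" "st = [((1,L),A)]" using wf by (auto simp: wf_state_def)
    \<comment> \<open>With a single interval both sweeps are empty.\<close>
    then have "j = 1" using j by simp
    then have "st1 = st" using sts by simp
    then have "st2 = st" using sts' A \<open>j = 1\<close> by simp
    then show thesis using that[of "[]" A "[]"] A qt \<open>j = 1\<close> nonempty by (auto simp: Suc_le_eq)
  qed
qed

section \<open>Existence of the sweeps\<close>

lemma left_sweep_exists:
  assumes st: "chained 1 L st" and i: "i < length st"
  shows "\<exists>sts. length sts = Suc i \<and> sts ! 0 = st \<and> (\<forall>k. Suc k < Suc i \<longrightarrow> ortho_at \<beta> Column k (sts ! k) (sts ! Suc k))"
  using i
proof (induction i)
  case 0
  show ?case by (intro exI[of _ "[st]"]) auto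
next
  case (Suc i)
  then obtain sts where sts: "length sts = Suc i" "sts ! 0 = st" "\<forall>k. Suc k < Suc i \<longrightarrow> ortho_at \<beta> Column k (sts ! k) (sts ! Suc k)"
    by auto
  have inv: "chained 1 L (sts ! i)" "map fst (sts ! i) = map fst st"
    using left_sweep_invariant[OF st sts, of i] by auto
  then have "Suc i < length (sts ! i)" using Suc.prems by (metis length_map)
  then obtain st' where "ortho_at \<beta> Column i (sts ! i) st'" using ortho_at_exists[OF inv(1)] by blast
  then show ?case using sts by (intro exI[of _ "sts @ [st']"]) (auto simp: nth_append less_Suc_eq)
qed

lemma right_sweep_exists:
  assumes st: "chained 1 L st" and j: "1 \<le> j" "j \<le> length st" and i: "i \<le> length st - j"
  shows "\<exists>sts. length sts = Suc i \<and> sts ! 0 = st \<and>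
    (\<forall>k<i. ortho_at \<beta> Row (length st - 2 - k) (sts ! k) (sts ! Suc k)) \<and> chained 1 L (sts ! i) \<and> map fst (sts ! i) = map fst st"
  using i
proof (induction i)
  case 0
  show ?case using st by (intro exI[of _ "[st]"]) auto
next
  case (Suc i)
  then obtain sts where sts: "length sts = Suc i" "sts ! 0 = st" "\<forall>k<i. ortho_at \<beta> Row (length st - 2 - k) (sts ! k) (sts ! Suc k)"
    and inv: "chained 1 L (sts ! i)" "map fst (sts ! i) = map fst st"
    by auto
  have "length (sts ! i) = length st" using inv(2) by (metis length_map)
  then have "Suc (length st - 2 - i) < length (sts ! i)" using Suc.prems j by simp
  then obtain st' where o: "ortho_at \<beta> Row (length st - 2 - i) (sts ! i) st'" using ortho_at_exists[OF inv(1)] by blast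
  then show ?case using sts ortho_at_chained(1,3)[OF inv(1) o] inv
    by (intro exI[of _ "sts @ [st']"]) (auto simp: nth_append less_Suc_eq)
qed

lemma sweeps_exist:
  assumes wf: "wf_state st" and j: "1 \<le> j" "j \<le> length st"
  shows "\<exists>st1 st2. left_sweep \<beta> j st st1 \<and> right_sweep \<beta> j st1 st2"
proof (cases "chained 1 L st")
  case True
  have "j - 1 < length st" using j by linarith
  then obtain sts where sts: "length sts = Suc (j - 1)" "sts ! 0 = st" "\<forall>k. Suc k < Suc (j - 1) \<longrightarrow> ortho_at \<beta> Column k (sts ! k) (sts ! Suc k)"
    using left_sweep_exists[OF True] by blast
  have ls: "left_sweep \<beta> j st (sts ! (j - 1))" unfolding left_sweep_def using sts j by (intro exI[of _ sts]) auto
  have inv: "chained 1 L (sts ! (j - 1))" "map fst (sts ! (j - 1)) = map fst st"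
    using left_sweep_invariant[OF True sts, of "j - 1"] by auto
  have len: "length (sts ! (j - 1)) = length st" using inv(2) by (metis length_map)
  obtain sts' where sts': "length sts' = Suc (length st - j)" "sts' ! 0 = sts ! (j - 1)"
    "\<forall>k<length st - j. ortho_at \<beta> Row (length st - 2 - k) (sts' ! k) (sts' ! Suc k)"
    using right_sweep_exists[OF inv(1) j(1), of "length st - j"] j len by auto
  have "right_sweep \<beta> j (sts ! (j - 1)) (sts' ! (length st - j))"
    unfolding right_sweep_def Let_def len using sts' by blast
  then show ?thesis using ls by blast
next
  case False
  then have "length st = 1" using wf by (auto simp: wf_state_def)
  then have "j = 1" using j by simp
  then have "left_sweep \<beta> j st st" "right_sweep \<beta> j st st"
    unfolding left_sweep_def right_sweep_def Let_def using \<open>length st = 1\<close> by (auto intro!: exI[of _ "[st]"])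
  then show ?thesis by blast
qed

subsection \<open>Error of the algorithm\<close>

lemma Ebeta_eq:
  assumes "1 \<le> s" "s < L"
  shows "Ebeta \<beta> s B = Inf {frob (B - U * V) | U V. fac 1 s U \<and> fac (Suc s) L V}"
  unfolding Ebeta_def using assms fac_iff by simp

lemma Ebeta_le:
  assumes "1 \<le> s" "s < L" "fac 1 s U" "fac (Suc s) L V"
  shows "Ebeta \<beta> s B \<le> frob (B - U * V)"
  unfolding Ebeta_eq[OF assms(1,2)]
  by (rule cInf_lower) (use assms in \<open>auto intro!: bdd_belowI[of _ 0]\<close>)

lemma le_Ebeta:
  assumes "1 \<le> s" "s < L" and "\<And>U V. fac 1 s U \<Longrightarrow> fac (Suc s) L V \<Longrightarrow> x \<le> frob (B - U * V)"
  shows "x \<le> Ebeta \<beta> s B"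
  unfolding Ebeta_eq[OF assms(1,2)]
proof (rule cInf_greatest)
  \<comment> \<open>Zero matrices are factors, so the infimum runs over a nonempty set.\<close>
  have "fac q t (0\<^sub>m (level (q - 1)) (level t))" for q t by (simp add: fac_def supported_def)
  then show "{frob (B - U * V) | U V. fac 1 s U \<and> fac (Suc s) L V} \<noteq> {}" by blast
qed (use assms(3) in auto)

text \<open>The right ends of the intervals are \<open>L\<close> and the cuts made so far, so the
  last hypothesis on \<open>s\<close> says that this cut is new.\<close>

lemma butterfly_step_invariant:
  assumes wf: "wf_state st" and step: "butterfly_step \<beta> s st st'" and s: "1 \<le> s" "s < L" "s \<notin> (snd \<circ> fst) ` set st"
  shows "chained 1 L st'" "length st' = Suc (length st)" "(snd \<circ> fst) ` set st' = insert s ((snd \<circ> fst) ` set st)"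
    "frob (sprod st - sprod st') \<le> Ebeta \<beta> s (sprod st)"
    "\<And>s'. 1 \<le> s' \<Longrightarrow> s' < L \<Longrightarrow> s' \<noteq> s \<Longrightarrow> Ebeta \<beta> s' (sprod st') \<le> Ebeta \<beta> s' (sprod st)"
proof -
  obtain j q t st1 st2 X Y where j: "1 \<le> j" "j \<le> length st" and qt: "fst (st ! (j - 1)) = (q,t)" "q \<le> s" "s \<le> t"
    and sw: "left_sweep \<beta> j st st1" "right_sweep \<beta> j st1 st2"
    and tf0: "two_factor (snd (st2 ! (j - 1))) (piv \<beta> q s) (piv \<beta> (Suc s) t) X Y"
    and st'0: "st' = take (j - 1) st2 @ [((q, s), X), ((Suc s, t), Y)] @ drop j st2"
    using step unfolding butterfly_step_def by blast
  obtain Ls M Rs where st2: "st2 = Ls @ ((q,t),M) # Rs" "length Ls = j - 1" "map fst st2 = map fst st" "sprod st2 = sprod st"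
    and Ls: "chained 1 (q - 1) Ls" "left_orth Ls" and Rs: "chained (Suc t) L Rs" "right_orth Rs"
    and q: "1 \<le> q" "q \<le> t" "t \<le> L"
    and M: "M \<in> carrier_mat (level (q - 1)) (level t)" "Ls \<noteq> [] \<or> Rs \<noteq> [] \<longrightarrow> fac q t M"
    by (rule sweeps[OF wf j qt(1) sw])
  have "st ! (j - 1) \<in> set st" using j by simp
  then have "t \<in> (snd \<circ> fst) ` set st" using qt(1) by (metis comp_apply image_eqI snd_conv)
  \<comment> \<open>\<open>t\<close> is a right end already present and \<open>s\<close> is not, so
    the interval is properly split.\<close>
  then have st: "s < t" using s(3) qt(3) by (metis le_neq_implies_less)
  have tf: "two_factor M (piv \<beta> q s) (piv \<beta> (Suc s) t) X Y" using tf0 st2(1,2) by (simp add: nth_append)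
  have st': "st' = Ls @ ((q,s),X) # ((Suc s,t),Y) # Rs" using st'0 st2(1,2) j by (simp add: Suc_diff_le)
  note ctx = Ls Rs q(1) qt(2) st q(3) M tf
  note XY = step_factors[OF ctx]
  show "chained 1 L st'" unfolding st' using chained_append[of 1 L Ls] Ls(1) Rs(1) XY q qt st by auto
  have "length st2 = length st" using st2(3) by (metis length_map)
  then show "length st' = Suc (length st)" unfolding st' using st2(1) by simp
  have "(snd \<circ> fst) ` set st = snd ` set (map fst st2)" unfolding st2(3) by (simp add: image_comp)
  then show "(snd \<circ> fst) ` set st' = insert s ((snd \<circ> fst) ` set st)" unfolding st' st2(1) by (auto simp: image_comp)
  have B: "sprod st = lmul Ls (rmul M Rs)" using sprod_split[OF Rs(1) M(1), of Ls q] st2 by simp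
  have B': "sprod st' = lmul Ls (rmul (X * Y) Rs)"
    unfolding st' by (rule sprod_split2[OF Rs(1) fac_carrier[OF XY(1)] XY(2) st])
  show "frob (sprod st - sprod st') \<le> Ebeta \<beta> s (sprod st)"
    unfolding B B' by (rule le_Ebeta[OF s(1,2) step_error[OF ctx]])
  fix s' assume s': "1 \<le> s'" "s' < L" "s' \<noteq> s"
  show "Ebeta \<beta> s' (sprod st') \<le> Ebeta \<beta> s' (sprod st)"
  proof (rule le_Ebeta[OF s'(1,2)])
    fix U V assume UV: "fac 1 s' U" "fac (Suc s') L V"
    show "Ebeta \<beta> s' (sprod st') \<le> frob (sprod st - U * V)"
    \<comment> \<open>A position after the new cut keeps \<open>V\<close>, one before it keeps
      \<open>U\<close>.\<close>
    proof (cases "s < s'")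
      case True
      then obtain U' where "fac 1 s' U'" "frob (sprod st' - U' * V) \<le> frob (sprod st - U * V)"
        using step_monotone_right[OF ctx True s'(2) UV] unfolding B B' by blast
      then show ?thesis using Ebeta_le[OF s'(1,2) _ UV(2)] order_trans by blast
    next
      case False
      then have "s' < s" using s' by simp
      then obtain V' where "fac (Suc s') L V'" "frob (sprod st' - U * V') \<le> frob (sprod st - U * V)"
        using step_monotone_left[OF ctx s'(1) _ UV] unfolding B B' by blast
      then show ?thesis using Ebeta_le[OF s'(1,2) UV(1)] order_trans by blast
    qed
  qed
qed

lemma chained_find:
  "chained q m st \<Longrightarrow> q \<le> s \<Longrightarrow> s \<le> m \<Longrightarrow> \<exists>i<length st. fst (fst (st ! i)) \<le> s \<and> s \<le> snd (fst (st ! i))"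
proof (induction q m st rule: chained.induct)
  case (2 q m u v X st)
  show ?case
  proof (cases "s \<le> v")
    case True
    then show ?thesis using 2 by (intro exI[of _ 0]) auto
  next
    case False
    then obtain i where "i < length st" "fst (fst (st ! i)) \<le> s" "s \<le> snd (fst (st ! i))" using 2 by auto
    then show ?thesis by (intro exI[of _ "Suc i"]) auto
  qed
qed auto

lemma butterfly_step_exists:
  assumes wf: "wf_state st" and s: "1 \<le> s" "s < L" "s \<notin> (snd \<circ> fst) ` set st"
  shows "\<exists>st'. butterfly_step \<beta> s st st'"
proof -
  have "\<exists>i<length st. fst (fst (st ! i)) \<le> s \<and> s \<le> snd (fst (st ! i))"
    using wf chained_find[of 1 L st s] s by (auto simp: wf_state_def)
  then obtain i q t where i: "i < length st" "fst (st ! i) = (q,t)" "q \<le> s" "s \<le> t" by (metis prod.collapse)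
  define j where "j = Suc i"
  have j: "1 \<le> j" "j \<le> length st" "fst (st ! (j - 1)) = (q,t)" using i by (auto simp: j_def)
  obtain st1 st2 where sw: "left_sweep \<beta> j st st1" "right_sweep \<beta> j st1 st2" using sweeps_exist[OF wf j(1,2)] by blast
  obtain Ls M Rs where st2: "st2 = Ls @ ((q,t),M) # Rs" "length Ls = j - 1" and q: "1 \<le> q" "t \<le> L"
    and M: "M \<in> carrier_mat (level (q - 1)) (level t)"
    by (rule sweeps[OF wf j sw])
  have "t \<in> (snd \<circ> fst) ` set st" using i by (metis comp_apply image_eqI nth_mem snd_conv)
  then have st: "s < t" using s(3) i(4) by (metis le_neq_implies_less)
  have "M \<in> carrier_mat (nrows (piv \<beta> q s)) (ncols (piv \<beta> (Suc s) t))"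
    using M q i st by (simp add: piv_dims)
  then obtain X Y where "two_factor M (piv \<beta> q s) (piv \<beta> (Suc s) t) X Y"
    using two_factor_exists[OF piv_chain_pair[OF q(1) i(3) st q(2)]] by blast
  moreover have "snd (st2 ! (j - 1)) = M" using st2 by (simp add: nth_append)
  ultimately show ?thesis unfolding butterfly_step_def using j i sw by blast
qed

text \<open>Counting: nonempty intervals tiling \<open>q\<close> to \<open>m\<close> cannot
  outnumber the indices, and in case of equality each is a singleton.\<close>

lemma chained_singletons:
  "chained q m st \<Longrightarrow> q + length st \<le> Suc m \<and>
    (q + length st = Suc m \<longrightarrow> (\<forall>i<length st. fac (q + i) (q + i) (snd (st ! i))))"
proof (induction q m st rule: chained.induct)
  case (2 q m u v X st)
  then have IH: "Suc v + length st \<le> Suc m" "Suc v + length st = Suc m \<longrightarrow> (\<forall>i<length st. fac (Suc v + i) (Suc v + i) (snd (st ! i)))"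
    and u: "u = q" "q \<le> v" "fac q v X" by auto
  have "fac (q + i) (q + i) (snd ((((u,v),X) # st) ! i))"
    if "q + length (((u,v),X) # st) = Suc m" "i < length (((u,v),X) # st)" for i
  proof -
    have "v = q" using that IH(1) u by simp
    then show ?thesis using that IH(2) u by (cases i) auto
  qed
  then show ?case using IH(1) u by auto
qed auto

section \<open>Partial and complete runs\<close>

context
  fixes A :: "complex mat" and \<sigma> :: "nat list"
  assumes A: "A \<in> carrier_mat (level 0) (level L)" and dist: "distinct \<sigma>" and set: "set \<sigma> = {1..L - 1}"
begin

text \<open>Runs stopped after \<open>J\<close> steps, so that existence can be shown by extending a
  run.\<close>

definition run :: "nat \<Rightarrow> bstate list \<Rightarrow> bool" where
  "run J sts \<longleftrightarrow> length sts = Suc J \<and> sts ! 0 = [((1,L),A)] \<and> (\<forall>i<J. butterfly_step \<beta> (\<sigma> ! i) (sts ! i) (sts ! Suc i))"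

lemma length_sigma: "length \<sigma> = L - 1"
  using distinct_card[OF dist] set by simp

lemma sigma_facts:
  assumes "J < L - 1"
  shows "1 \<le> \<sigma> ! J" "\<sigma> ! J < L" "\<sigma> ! J \<notin> set (take J \<sigma>)"
proof -
  have "\<sigma> ! J \<in> set \<sigma>" using assms length_sigma by simp
  then show "1 \<le> \<sigma> ! J" "\<sigma> ! J < L" unfolding set using assms by auto
  show "\<sigma> ! J \<notin> set (take J \<sigma>)"
    using dist assms length_sigma by (auto simp: in_set_conv_nth nth_eq_iff_index_eq)
qed

lemma sprod_carrier: "wf_state st \<Longrightarrow> sprod st \<in> carrier_mat (level 0) (level L)"
proof (cases "chained 1 L st")
  case True
  obtain q t X Rs where st: "st = ((q,t),X) # Rs" using True nonempty by (cases st) auto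
  then have "q = 1" "fac 1 t X" "chained (Suc t) L Rs" using True by auto
  then show ?thesis using sprod_rmul[of t L Rs "((q,t),X)"] rmul_carrier[of t L Rs X] st fac_carrier[of 1 t X] by auto
next
  case False
  moreover assume "wf_state st"
  ultimately show ?thesis by (auto simp: wf_state_def sprod_Cons)
qed

text \<open>A cut still to come has, for the current product, an error at most its error for
  \<open>A\<close>. So the step for \<open>\<sigma> ! i\<close> costs at most
  \<open>Ebeta \<beta> (\<sigma> ! i) A\<close>, and the costs add up by the triangle
  inequality.\<close>

lemma run_invariant:
  assumes run: "run J sts" and J: "J < L" and i: "i \<le> J"
  shows "wf_state (sts ! i) \<and> (i \<ge> 1 \<longrightarrow> chained 1 L (sts ! i)) \<and> length (sts ! i) = Suc i \<and>
    (snd \<circ> fst) ` set (sts ! i) = insert L (set (take i \<sigma>)) \<and>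
    (\<forall>s. 1 \<le> s \<and> s < L \<and> s \<notin> set (take i \<sigma>) \<longrightarrow> Ebeta \<beta> s (sprod (sts ! i)) \<le> Ebeta \<beta> s A) \<and>
    frob (A - sprod (sts ! i)) \<le> (\<Sum>k<i. Ebeta \<beta> (\<sigma> ! k) A)"
  using i
proof (induction i)
  case 0
  have "A - A = 0\<^sub>m (level 0) (level L)" using A by auto
  then have "frob (A - A) = 0" by (simp add: frob_def)
  then show ?case using run A by (auto simp: run_def wf_state_def sprod_Cons)
next
  case (Suc i)
  let ?st = "sts ! i" and ?st' = "sts ! Suc i" and ?s = "\<sigma> ! i"
  have IH: "wf_state ?st" "length ?st = Suc i" "(snd \<circ> fst) ` set ?st = insert L (set (take i \<sigma>))"
    "\<And>s. 1 \<le> s \<Longrightarrow> s < L \<Longrightarrow> s \<notin> set (take i \<sigma>) \<Longrightarrow> Ebeta \<beta> s (sprod ?st) \<le> Ebeta \<beta> s A"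
    "frob (A - sprod ?st) \<le> (\<Sum>k<i. Ebeta \<beta> (\<sigma> ! k) A)" using Suc by auto
  have step: "butterfly_step \<beta> ?s ?st ?st'" using run Suc.prems by (auto simp: run_def)
  have iL: "i < L - 1" using Suc.prems J by simp
  note sf = sigma_facts[OF iL]
  have nin: "?s \<notin> (snd \<circ> fst) ` set ?st" unfolding IH(3) using sf by simp
  note inv = butterfly_step_invariant[OF IH(1) step sf(1,2) nin]
  have wf': "wf_state ?st'" using inv(1) by (simp add: wf_state_def)
  have tk: "set (take (Suc i) \<sigma>) = insert ?s (set (take i \<sigma>))" using iL length_sigma by (simp add: take_Suc_conv_app_nth)
  have c: "sprod ?st \<in> carrier_mat (level 0) (level L)" "sprod ?st' \<in> carrier_mat (level 0) (level L)"
    using sprod_carrier IH(1) wf' by auto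
  have "A - sprod ?st' = (A - sprod ?st) + (sprod ?st - sprod ?st')"
    by (rule minus_add_minus_mat[OF A c, symmetric])
  then have "frob (A - sprod ?st') \<le> frob (A - sprod ?st) + frob (sprod ?st - sprod ?st')"
    using frob_triangle[OF minus_carrier_mat[OF c(1), of A] minus_carrier_mat[OF c(2), of "sprod ?st"]] by simp
  also have "\<dots> \<le> (\<Sum>k<i. Ebeta \<beta> (\<sigma> ! k) A) + Ebeta \<beta> ?s A"
    using IH(5) inv(4) IH(4)[OF sf] by linarith
  finally have bound: "frob (A - sprod ?st') \<le> (\<Sum>k<Suc i. Ebeta \<beta> (\<sigma> ! k) A)" by simp
  have "Ebeta \<beta> s (sprod ?st') \<le> Ebeta \<beta> s A" if "1 \<le> s" "s < L" "s \<notin> set (take (Suc i) \<sigma>)" for s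
    using inv(5)[of s] IH(4)[of s] that tk by auto
  then show ?case using wf' inv(1,2,3) IH(2,3) tk bound by auto
qed

text \<open>A partial run never gets stuck: by its invariant the next cut is new and lies properly
  inside one of the current intervals.\<close>

lemma run_exists: "J < L \<Longrightarrow> \<exists>sts. run J sts"
proof (induction J)
  case 0
  show ?case by (intro exI[of _ "[[((1,L),A)]]"]) (auto simp: run_def)
next
  case (Suc J)
  then obtain sts where run: "run J sts" by auto
  have inv: "wf_state (sts ! J)" "(snd \<circ> fst) ` set (sts ! J) = insert L (set (take J \<sigma>))"
    using run_invariant[OF run, of J] Suc.prems by auto
  have JL: "J < L - 1" using Suc.prems by simp
  obtain st' where "butterfly_step \<beta> (\<sigma> ! J) (sts ! J) st'"
    using butterfly_step_exists[OF inv(1) sigma_facts(1,2)[OF JL]] sigma_facts[OF JL] inv(2) by auto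
  then have "run (Suc J) (sts @ [st'])" using run by (auto simp: run_def nth_append less_Suc_eq)
  then show ?case by blast
qed

lemma butterfly_output_iff:
  "butterfly_output A \<beta> \<sigma> Xs \<longleftrightarrow> (\<exists>sts. run (L - 1) sts \<and> Xs = map snd (sts ! (L - 1)))"
proof -
  have "Suc (L - 1) = L" using nonempty by simp
  moreover have "i < L - 1 \<longleftrightarrow> Suc i < L" for i by auto
  ultimately show ?thesis unfolding butterfly_output_def Let_def run_def by auto
qed

lemma butterfly_output_correct:
  assumes "2 \<le> L" and out: "butterfly_output A \<beta> \<sigma> Xs"
  shows "in_Sigma_arch \<beta> Xs" "frob (A - mat_prod_list Xs) \<le> (\<Sum>k<L - 1. Ebeta \<beta> (\<sigma> ! k) A)"
proof -
  obtain sts where run: "run (L - 1) sts" and Xs: "Xs = map snd (sts ! (L - 1))"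
    using out butterfly_output_iff by auto
  have inv: "chained 1 L (sts ! (L - 1))" "length (sts ! (L - 1)) = L"
    "frob (A - sprod (sts ! (L - 1))) \<le> (\<Sum>k<L - 1. Ebeta \<beta> (\<sigma> ! k) A)"
    using run_invariant[OF run, of "L - 1"] assms(1) by auto
  then show "frob (A - mat_prod_list Xs) \<le> (\<Sum>k<L - 1. Ebeta \<beta> (\<sigma> ! k) A)" by (simp add: Xs sprod_def)
  have "fac (1 + i) (1 + i) (Xs ! i)" if "i < L" for i
    using chained_singletons[OF inv(1)] inv(2) that Xs by auto
  then have "is_factor (\<beta> ! i) (Xs ! i)" if "i < L" for i
    using fac_iff[of "Suc i" "Suc i" "Xs ! i"] that by (simp add: piv_same)
  then show "in_Sigma_arch \<beta> Xs" using inv(2) by (simp add: in_Sigma_arch_def Xs)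
qed

end

end

text \<open>Minimisers and QR factors are not unique, so the algorithm is a relation: an output must
  be shown to exist, and the bound must hold for every choice made along the way.\<close>

theorem theorem7p2:
  fixes \<beta> :: "pattern list" and A :: "complex mat" and \<sigma> :: "nat list"
  assumes "architecture \<beta>" and "chainable_arch \<beta>" and "\<not> redundant_arch \<beta>"
    and "length \<beta> \<ge> 2"
    and "A \<in> carrier_mat (nrows (\<beta> ! 0)) (ncols (\<beta> ! (length \<beta> - 1)))"
    and "distinct \<sigma>" and "set \<sigma> = {1..length \<beta> - 1}"
  shows "(\<exists>Xs. butterfly_output A \<beta> \<sigma> Xs) \<and>
         (\<forall>Xs. butterfly_output A \<beta> \<sigma> Xs \<longrightarrow>
            in_Sigma_arch \<beta> Xs \<and>
            frob (A - mat_prod_list Xs) \<le> (\<Sum>k<length \<beta> - 1. Ebeta \<beta> (\<sigma> ! k) A))"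
proof -
  interpret butterfly_architecture \<beta> by unfold_locales (use assms in auto)
  have A: "A \<in> carrier_mat (level 0) (level (length \<beta>))" using assms(4,5) by (auto simp: level_def)
  note ctx = A assms(6,7)
  have "length \<beta> - 1 < length \<beta>" using assms(4) by simp
  then have "\<exists>Xs. butterfly_output A \<beta> \<sigma> Xs"
    using run_exists[OF ctx] butterfly_output_iff[OF ctx] by blast
  then show ?thesis using butterfly_output_correct[OF ctx assms(4)] by blast
qed

end
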